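(* Let $r_1,\dots,r_k$ be fixed positive integers ($k\ge3$) and $r=r_1+\dots+r_k$. Let $\{G_i\}_{i\ge1}$ be a sequence of finite groups (not necessarily abelian) with identity $e$ and $|G_i|\to\infty$, such that the exponent of each $G_i$ divides $r$ and $\gcd(r_j,|G_i|)=1$ for all $j\in[1,k]$ and all $i$. Let $S_i=\{(x_1,\dots,x_k)\in G_i^k:\ x_1^{r_1}\cdots x_k^{r_k}=e\}$ and let $S_i^{(k)}$ be the set of elements of $S_i$ with pairwise distinct coordinates. Let $\beta>0$ and $0<\delta\le\min\{\beta/2,1/40\}$. Then there exist positive constants $i_0$, $c_1$, $c_2$, $C$ such that: (1) for each $i\ge i_0$ and every integer $t$ with $$\frac{C}{\delta}k^{-\frac{1}{k-1}}|G_i|^{\frac{1}{k-1}}\le t\le\frac{\delta}{2}|G_i|,$$ the number of subsets $X\subseteq G_i$ with $|X|=t$ and $X^k\cap S_i^{(k)}=\emptyset$ is at most $\binom{\beta|G_i|}{t}$; (2) with $p_{(S_i,G_i)}=|G_i|^{-\frac{k-2}{k-1}}$, $$\lim_{i\to\infty}\mathbb{P}\big([G_i]_p\text{ is }(\delta,S_i)_k\text{-stable}\big)=\begin{cases}1&\text{if }p\ge c_1p_{(S_i,G_i)},\\0&\text{if }p<c_2p_{(S_i,G_i)}.\end{cases}$$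
   Context: $[G]_p$ is the binomial random subset of $G$ containing each element independently with probability $p$. A set $X\subseteq G$ is $(\delta,S)_k$-stable (for $S\subseteq G^k$) if every $X'\subseteq X$ with $|X'|\ge\delta|X|$ contains some $(x_1,\dots,x_k)\in X'^k\cap S$ with pairwise distinct coordinates. *)

theory Defs
  imports "HOL-Algebra.Coset" "HOL-Probability.Probability"
begin

(* k-tuples over A are represented as lists of length k. *)
definition tuples :: "nat \<Rightarrow> 'a set \<Rightarrow> 'a list set" where
  "tuples k A = {xs. length xs = k \<and> set xs \<subseteq> A}"

definition distinct_tuples :: "'a list set \<Rightarrow> 'a list set" where
  "distinct_tuples S = {xs \<in> S. distinct xs}"

(* Only meaningful when some positive power annihilates the group, e.g. for finite groups. *)
definition group_exponent :: "('a, 'b) monoid_scheme \<Rightarrow> nat" where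
  "group_exponent G = (LEAST n. 0 < n \<and> (\<forall>x \<in> carrier G. x [^]\<^bsub>G\<^esub> n = \<one>\<^bsub>G\<^esub>))"

(* The group need not be abelian: the factors appear in the order of the lists. *)
definition power_product :: "('a, 'b) monoid_scheme \<Rightarrow> nat list \<Rightarrow> 'a list \<Rightarrow> 'a" where
  "power_product G rs xs =
     foldr (\<otimes>\<^bsub>G\<^esub>) (map2 (\<lambda>x n. x [^]\<^bsub>G\<^esub> n) xs rs) \<one>\<^bsub>G\<^esub>"

definition equation_solutions :: "('a, 'b) monoid_scheme \<Rightarrow> nat list \<Rightarrow> 'a list set" where
  "equation_solutions G rs =
     {xs \<in> tuples (length rs) (carrier G). power_product G rs xs = \<one>\<^bsub>G\<^esub>}"

definition stable :: "real \<Rightarrow> 'a list set \<Rightarrow> nat \<Rightarrow> 'a set \<Rightarrow> bool" where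
  "stable \<delta> S k X \<longleftrightarrow>
     (\<forall>X' \<subseteq> X. real (card X') \<ge> \<delta> * real (card X) \<longrightarrow>
        (\<exists>xs \<in> tuples k X' \<inter> S. distinct xs))"

(* Intended for finite A and 0 \<le> p \<le> 1: Pi_pmf presupposes a finite index set, and
   bernoulli_pmf truncates its parameter to the unit interval. *)
definition binomial_random_subset :: "'a set \<Rightarrow> real \<Rightarrow> 'a set pmf" where
  "binomial_random_subset A p =
     map_pmf (\<lambda>f. {x \<in> A. f x}) (Pi_pmf A False (\<lambda>_. bernoulli_pmf p))"

(* The threshold p_(S,G) for an equation in k variables over a group with n elements. *)
definition threshold :: "nat \<Rightarrow> nat \<Rightarrow> real" where
  "threshold k n = real n powr (- ((real k - 2) / (real k - 1)))"

end

theory Submission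
  imports Defs "HOL-Algebra.Multiplicative_Group"
begin

text \<open>
  Solutions of the equation form a \<open>k\<close>-uniform hypergraph on the group. A set of positive density
  spans a positive proportion of its edges: read a solution as a closed walk whose steps are the
  powers \<open>x\<^sub>j ^ r\<^sub>j\<close>; the diagonal solutions yield quadratically many edge-disjoint closed walks, and
  the regularity argument behind the removal lemma for cycles applies.

  Sparse independent sets are counted with the hard-core measure at fugacity \<open>n powr (- (k - 2) / (k - 1))\<close>.
  As long as the set of available vertices is dense, some vertex is occupied with probability
  noticeably below the fugacity, so that putting it into the independent set shrinks the partition
  function by a constant factor. As the partition function always lies between \<open>1\<close> and
  \<open>exp (n powr (1 / (k - 1)))\<close>, all but \<open>O (n powr (1 / (k - 1)))\<close> elements of an independent set lie in
  a small container determined by the others.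

  The threshold then follows from the union bound over independent sets above it, and from deleting
  one vertex from every solution below it, where the number of solutions is concentrated.
\<close>

section \<open>Regularity and removal of closed walks\<close>

text \<open>The partial products of a solution, started at an arbitrary group element, keep the
  factors in order; this accommodates noncommutative groups. Each solution then occurs once per
  starting point, so walk counts are the order of the group times solution counts. For cycles
  one-sided regularity is enough: \<open>dense_pair\<close> bounds densities from below only, and
  closed walks are counted by following sets of vertices of large degree. The fugacity l is fixed by
  (l n)^(k-1) = n: at this density about n edges have their first k - 1 vertices occupied, which is
  when a positive proportion of the vertices becomes blocked. There the logarithm of the partition
  function is at most N = n^(1/(k-1)) and each free choice costs a constant amount of it, so about N
  free choices are possible. A set of t elements, t being at least twice that number, has half of
  its elements in a container of size \<sigma>^2 n. Each of those contributes a factor \<sigma>^2,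
  that is, \<sigma> per element on average; hence supersaturation is asked for at density
  (\<gamma>/2)^2 to obtain a factor \<gamma> per element.\<close>

definition fibre :: "'w set \<Rightarrow> ('w \<Rightarrow> 'c) \<Rightarrow> 'w \<Rightarrow> 'w set" where
  "fibre P q u = {v \<in> P. q v = q u}"

text \<open>The conditional expectation of \<open>f\<close> given \<open>q\<close> under the uniform
  measure on \<open>P\<close>. Over an empty fibre it is 0, by division by zero.\<close>

definition fibre_avg :: "'w set \<Rightarrow> ('w \<Rightarrow> 'c) \<Rightarrow> ('w \<Rightarrow> real) \<Rightarrow> 'w \<Rightarrow> real" where
  "fibre_avg P q f u =
     (\<Sum>u'\<in>fibre P q u. f u') / real (card (fibre P q u))"

lemma sum_fibrewise_mono:
  fixes a b :: "'w \<Rightarrow> real"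
  assumes "finite P"
    and "\<And>u. u \<in> P \<Longrightarrow> (\<Sum>u'\<in>fibre P q u. a u') \<le> (\<Sum>u'\<in>fibre P q u. b u')"
  shows "sum a P \<le> sum b P"
proof -
  have "sum a P = (\<Sum>c\<in>q ` P. sum a {u'\<in>P. q u' = c})"
    using assms(1) by (rule sum.image_gen)
  also have "\<dots> \<le> (\<Sum>c\<in>q ` P. sum b {u'\<in>P. q u' = c})"
    by (rule sum_mono) (use assms(2) in \<open>auto simp: fibre_def\<close>)
  also have "\<dots> = sum b P"
    using assms(1) by (rule sum.image_gen[symmetric])
  finally show ?thesis .
qed

lemma sum_fibrewise_eq:
  fixes a b :: "'w \<Rightarrow> real"
  assumes "finite P"
    and "\<And>u. u \<in> P \<Longrightarrow> (\<Sum>u'\<in>fibre P q u. a u') = (\<Sum>u'\<in>fibre P q u. b u')"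
  shows "sum a P = sum b P"
proof (rule antisym)
  show "sum a P \<le> sum b P"
    by (rule sum_fibrewise_mono[where q = q]) (use assms in auto)
  show "sum b P \<le> sum a P"
    by (rule sum_fibrewise_mono[where q = q]) (use assms in auto)
qed

lemma fibre_avg_cong: "q x = q y \<Longrightarrow> fibre_avg P q f x = fibre_avg P q f y"
  by (simp add: fibre_avg_def fibre_def)

text \<open>On each fibre \<open>h\<close> is constant and averaging does not change the sum of
  \<open>f\<close>. This is the defining property of conditional expectation.\<close>

lemma sum_fibre_avg:
  assumes fin: "finite P" and h: "\<And>x y. x \<in> P \<Longrightarrow> y \<in> P \<Longrightarrow> q x = q y \<Longrightarrow> h x = h y"
  shows "(\<Sum>u\<in>P. h u * fibre_avg P q f u) = (\<Sum>u\<in>P. h u * f u)"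
proof (rule sum_fibrewise_eq[where q = q, OF fin])
  fix u assume w: "u \<in> P"
  let ?F = "(fibre P q u)"
  have c: "card ?F > 0" using w fin by (auto simp: fibre_def card_gt_0_iff)
  have "(\<Sum>u'\<in>?F. h u' * fibre_avg P q f u') = (\<Sum>u'\<in>?F. h u * fibre_avg P q f u)"
  proof (rule sum.cong[OF refl])
    fix x assume x: "x \<in> ?F"
    then have "h x = h u" using h[of x u] w by (auto simp: fibre_def)
    moreover have "fibre_avg P q f x = fibre_avg P q f u" using x by (auto simp: fibre_def intro: fibre_avg_cong)
    ultimately show "h x * fibre_avg P q f x = h u * fibre_avg P q f u" by simp
  qed
  also have "\<dots> = h u * (\<Sum>u'\<in>?F. f u')"
    using c by (simp add: fibre_avg_def)
  also have "\<dots> = (\<Sum>u'\<in>?F. h u * f u')" by (rule sum_distrib_left)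
  also have "\<dots> = (\<Sum>u'\<in>?F. h u' * f u')"
  proof (rule sum.cong[OF refl])
    fix x assume "x \<in> ?F"
    then have "h x = h u" using h[of x u] w by (simp add: fibre_def)
    then show "h u * f x = h x * f x" by simp
  qed
  finally show "(\<Sum>u'\<in>?F. h u' * fibre_avg P q f u') = (\<Sum>u'\<in>?F. h u' * f u')" .
qed

text \<open>Averaging over fibres is an orthogonal projection. As \<open>q'\<close> refines
  \<open>q\<close>, the average given \<open>q\<close> is constant on the fibres of
  \<open>q'\<close>, so the cross term equals the square of the coarser average.\<close>

lemma fibre_avg_pythagoras:
  assumes fin: "finite P"
    and refine: "\<And>x y. x \<in> P \<Longrightarrow> y \<in> P \<Longrightarrow> q' x = q' y \<Longrightarrow> q x = q y"
  shows "(\<Sum>u\<in>P. (fibre_avg P q' f u)\<^sup>2) =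
    (\<Sum>u\<in>P. (fibre_avg P q f u)\<^sup>2) + (\<Sum>u\<in>P. (fibre_avg P q' f u - fibre_avg P q f u)\<^sup>2)"
proof -
  let ?g = "fibre_avg P q f" and ?g' = "fibre_avg P q' f"
  have "(\<Sum>u\<in>P. ?g u * ?g' u) = (\<Sum>u\<in>P. ?g u * f u)"
    by (rule sum_fibre_avg[OF fin]) (blast intro: fibre_avg_cong refine)
  also have "\<dots> = (\<Sum>u\<in>P. ?g u * ?g u)"
    by (rule sum_fibre_avg[OF fin, symmetric]) (blast intro: fibre_avg_cong)
  finally have "(\<Sum>u\<in>P. ?g u * ?g' u) = (\<Sum>u\<in>P. (?g u)\<^sup>2)" by (simp add: power2_eq_square)
  moreover have "(\<Sum>u\<in>P. (?g' u - ?g u)\<^sup>2) =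
      (\<Sum>u\<in>P. (?g' u)\<^sup>2) + (\<Sum>u\<in>P. (?g u)\<^sup>2) - 2 * (\<Sum>u\<in>P. ?g u * ?g' u)"
    by (simp add: power2_diff sum.distrib sum_subtractf sum_distrib_left algebra_simps)
  ultimately show ?thesis by simp
qed

section \<open>Partitions into atoms, energy increment and regularity\<close>

definition atom :: "'a set \<Rightarrow> 'a set set \<Rightarrow> 'a \<Rightarrow> 'a set" where
  "atom V \<S> x = {y \<in> V. \<forall>S\<in>\<S>. x \<in> S \<longleftrightarrow> y \<in> S}"

text \<open>The lower half of \<epsilon>-regularity: large rectangles are never too sparse. The same
  \<open>c\<close> serves as relative size and as density.\<close>

definition dense_pair :: "real \<Rightarrow> ('a \<Rightarrow> 'a \<Rightarrow> bool) \<Rightarrow> 'a set \<Rightarrow> 'a set \<Rightarrow> bool" where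
  "dense_pair c E U W \<longleftrightarrow> (\<forall>U' W'. U' \<subseteq> U \<and> W' \<subseteq> W \<and> c * card U \<le> card U' \<and> c * card W \<le> card W' \<longrightarrow>
      c * card U' * card W' \<le> card {(x, y) \<in> U' \<times> W'. E x y})"

lemma atom_self: "x \<in> V \<Longrightarrow> x \<in> atom V \<S> x"
  by (simp add: atom_def)

lemma atom_subset: "atom V \<S> x \<subseteq> V"
  by (auto simp: atom_def)

lemma atom_eq_iff: "x \<in> V \<Longrightarrow> y \<in> V \<Longrightarrow> atom V \<S> x = atom V \<S> y \<longleftrightarrow> (\<forall>S\<in>\<S>. x \<in> S \<longleftrightarrow> y \<in> S)"
  unfolding atom_def by blast

lemma mem_atom_iff: "x \<in> V \<Longrightarrow> y \<in> atom V \<S> x \<longleftrightarrow> y \<in> V \<and> atom V \<S> y = atom V \<S> x"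
  unfolding atom_def by blast

lemma card_atoms_le:
  assumes "finite \<S>"
  shows "finite (atom V \<S> ` V)" "card (atom V \<S> ` V) \<le> 2 ^ card \<S>"
proof -
  have sub: "atom V \<S> ` V \<subseteq> (\<lambda>T. {y \<in> V. \<forall>S\<in>\<S>. S \<in> T \<longleftrightarrow> y \<in> S}) ` Pow \<S>"
  proof
    fix U assume "U \<in> atom V \<S> ` V"
    then obtain x where "x \<in> V" "U = atom V \<S> x" by blast
    then have "U = (\<lambda>T. {y \<in> V. \<forall>S\<in>\<S>. S \<in> T \<longleftrightarrow> y \<in> S}) {S\<in>\<S>. x \<in> S}"
      by (auto simp: atom_def)
    then show "U \<in> (\<lambda>T. {y \<in> V. \<forall>S\<in>\<S>. S \<in> T \<longleftrightarrow> y \<in> S}) ` Pow \<S>" by blast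
  qed
  then show "finite (atom V \<S> ` V)"
    by (rule finite_subset) (use assms in simp)
  have "card (atom V \<S> ` V) \<le> card (Pow \<S>)"
    using surj_card_le[OF _ sub] assms by simp
  then show "card (atom V \<S> ` V) \<le> 2 ^ card \<S>"
    using assms by (simp add: card_Pow)
qed

definition pair_density :: "'a set \<Rightarrow> 'a set set \<Rightarrow> ('a \<Rightarrow> 'a \<Rightarrow> bool) \<Rightarrow> 'a \<times> 'a \<Rightarrow> real" where
  "pair_density V \<S> E = fibre_avg (V \<times> V) (map_prod (atom V \<S>) (atom V \<S>)) (\<lambda>(x, y). of_bool (E x y))"

definition energy :: "'a set \<Rightarrow> 'a set set \<Rightarrow> ('a \<Rightarrow> 'a \<Rightarrow> bool) \<Rightarrow> real" where
  "energy V \<S> E = (\<Sum>u\<in>V \<times> V. (pair_density V \<S> E u)\<^sup>2)"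

lemma fibre_avg_bounds:
  assumes "\<And>u. 0 \<le> f u" "\<And>u. f u \<le> 1"
  shows "0 \<le> fibre_avg P q f u" "fibre_avg P q f u \<le> 1"
proof -
  define F where "F = (fibre P q u)"
  have "0 \<le> sum f F" using assms by (simp add: sum_nonneg)
  moreover have "sum f F \<le> real (card F)" using sum_bounded_above[of F f 1] assms by simp
  moreover have "fibre_avg P q f u = sum f F / card F" by (simp add: fibre_avg_def F_def)
  ultimately show "0 \<le> fibre_avg P q f u" "fibre_avg P q f u \<le> 1"
    by (simp_all add: divide_le_eq)
qed

lemma pair_density_bounds: "0 \<le> pair_density V \<S> E u" "pair_density V \<S> E u \<le> 1"
  unfolding pair_density_def by (rule fibre_avg_bounds; simp split: prod.split)+

lemma energy_le:
  assumes "finite V" shows "energy V \<S> E \<le> (real (card V))\<^sup>2"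
proof -
  have "energy V \<S> E \<le> (\<Sum>u\<in>V \<times> V. 1)"
    unfolding energy_def using pair_density_bounds[of V \<S> E] by (intro sum_mono) (simp add: power_le_one)
  then show ?thesis using assms by (simp add: card_cartesian_product power2_eq_square)
qed

lemma energy_refine:
  assumes "finite V" "\<S> \<subseteq> \<S>'"
  shows "energy V \<S>' E = energy V \<S> E + (\<Sum>u\<in>V \<times> V. (pair_density V \<S>' E u - pair_density V \<S> E u)\<^sup>2)"
  unfolding energy_def pair_density_def
proof (rule fibre_avg_pythagoras)
  fix x y :: "'a \<times> 'a"
  assume "x \<in> V \<times> V" "y \<in> V \<times> V"
    "map_prod (atom V \<S>') (atom V \<S>') x = map_prod (atom V \<S>') (atom V \<S>') y"
  then show "map_prod (atom V \<S>) (atom V \<S>) x = map_prod (atom V \<S>) (atom V \<S>) y"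
    using assms(2) by (cases x; cases y) (simp add: atom_eq_iff subset_iff)
qed (use assms in auto)

text \<open>Edges are counted here, not pairs of atoms: a sparse pair of atoms also fails to be
  dense, but it spans few edges and is therefore cheap to discard.\<close>

definition irregular :: "real \<Rightarrow> 'a set \<Rightarrow> 'a set set \<Rightarrow> ('a \<Rightarrow> 'a \<Rightarrow> bool) \<Rightarrow> ('a \<times> 'a) set" where
  "irregular c V \<S> E =
     {(x, y) \<in> V \<times> V. E x y \<and> \<not> dense_pair c E (atom V \<S> x) (atom V \<S> y)}"

text \<open>For each of the at most 4^card \<S> pairs of atoms, two witnesses against
  \<open>dense_pair\<close> are added to \<S>. With s = \<epsilon>/4 the gain is a product: the set
  \<open>D\<close> is a proportion 2 s of all pairs of vertices, the witnesses cover a proportion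
  s^2 of \<open>D\<close>, and an average drop of the density by s there is worth s^2.\<close>

lemma energy_increment:
  fixes \<epsilon> :: real
  assumes finV: "finite V" and finS: "finite \<S>" and eps: "0 < \<epsilon>"
    and bad: "real (card (irregular (\<epsilon> / 4) V \<S> E))
                > \<epsilon> * (real (card V))\<^sup>2"
  obtains \<S>' where "finite \<S>'" "\<S> \<subseteq> \<S>'" "card \<S>' \<le> card \<S> + 2 * 4 ^ card \<S>"
    "energy V \<S> E + 2 * (\<epsilon> / 4) ^ 5 * (real (card V))\<^sup>2 \<le> energy V \<S>' E"
proof -
  define s where "s = \<epsilon> / 4"
  define a where "a = atom V \<S>"
  define g where "g = pair_density V \<S> E"
  have s: "0 < s" "\<epsilon> = 4 * s" using eps by (auto simp: s_def)
  define Q where "Q U W U' W' \<longleftrightarrow> U' \<subseteq> U \<and> W' \<subseteq> W \<and> s * card U \<le> card U' \<and>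
      s * card W \<le> card W' \<and> card {(x, y) \<in> U' \<times> W'. E x y} \<le> s * card U' * card W'" for U W U' W'
  have "\<exists>U' W'. \<not> dense_pair s E U W \<longrightarrow> Q U W U' W'" for U W
  proof (cases "dense_pair s E U W")
    case False
    then obtain U' W' where "U' \<subseteq> U" "W' \<subseteq> W" "s * card U \<le> card U'" "s * card W \<le> card W'"
      "\<not> s * card U' * card W' \<le> card {(x, y) \<in> U' \<times> W'. E x y}"
      unfolding dense_pair_def by blast
    then show ?thesis by (intro exI[of _ U'] exI[of _ W']) (simp add: Q_def)
  qed simp
  then obtain wU wW where "\<And>U W. \<not> dense_pair s E U W \<Longrightarrow> Q U W (wU U W) (wW U W)"
    by metis
  note w = this[unfolded Q_def]
  define At where "At = a ` V"
  define \<S>' where "\<S>' = \<S> \<union> ((\<lambda>(U, W). wU U W) ` (At \<times> At) \<union> (\<lambda>(U, W). wW U W) ` (At \<times> At))"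
  have finAt: "finite At" and cardAt: "card At \<le> 2 ^ card \<S>"
    using card_atoms_le[OF finS, of V] by (auto simp: At_def a_def)
  have fin': "finite \<S>'" using finS finAt by (simp add: \<S>'_def)
  have cAt2: "card (At \<times> At) \<le> 4 ^ card \<S>"
  proof -
    have "card (At \<times> At) \<le> 2 ^ card \<S> * 2 ^ card \<S>"
      unfolding card_cartesian_product by (rule mult_mono[OF cardAt cardAt]) auto
    also have "\<dots> = (4::nat) ^ card \<S>" by (simp flip: power_mult_distrib)
    finally show ?thesis .
  qed
  have card': "card \<S>' \<le> card \<S> + 2 * 4 ^ card \<S>"
  proof -
    have "card \<S>' \<le> card \<S> + (card ((\<lambda>(U, W). wU U W) ` (At \<times> At)) + card ((\<lambda>(U, W). wW U W) ` (At \<times> At)))"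
      unfolding \<S>'_def by (meson card_Un_le order_trans add_left_mono)
    also have "\<dots> \<le> card \<S> + (card (At \<times> At) + card (At \<times> At))"
      by (intro add_mono order_refl card_image_le finite_cartesian_product finAt)
    finally show ?thesis using cAt2 by linarith
  qed
  define g' where "g' = pair_density V \<S>' E"
  define P where "P = V \<times> V"
  define f :: "'a \<times> 'a \<Rightarrow> real" where "f = (\<lambda>(x, y). of_bool (E x y))"
  define r where "r = map_prod a a"
  define r' where "r' = map_prod (atom V \<S>') (atom V \<S>')"
  have g_eq: "g = fibre_avg P r f" by (simp add: g_def pair_density_def P_def r_def f_def a_def)
  have g'_eq: "g' = fibre_avg P r' f" by (simp add: g'_def pair_density_def P_def r'_def f_def)
  have finP: "finite P" using finV by (simp add: P_def)
  have cardP: "real (card P) = (real (card V))\<^sup>2" by (simp add: P_def card_cartesian_product power2_eq_square)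
  define nd where "nd = (\<lambda>(x, y). \<not> dense_pair s E (a x) (a y))"
  define D where "D = {u \<in> P. nd u \<and> 2 * s \<le> g u}"
  define T where "T = {u \<in> D. fst u \<in> wU (a (fst u)) (a (snd u)) \<and> snd u \<in> wW (a (fst u)) (a (snd u))}"
  let ?I = "\<lambda>h. \<Sum>u\<in>P. of_bool (u \<in> T) * h u"
  have DO: "D \<subseteq> P" and TD: "T \<subseteq> D" by (auto simp: D_def T_def)
  have finD: "finite D" and finT: "finite T" using DO TD finP by (auto intro: finite_subset)
  have sumD: "(\<Sum>u\<in>P. of_bool (u \<in> D)) = real (card D)"
    using finP DO by (simp add: Int_absorb1)
  have sumT: "(\<Sum>u\<in>P. of_bool (u \<in> T)) = real (card T)"
    using finP DO TD by (simp add: Int_absorb1)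
  (* Irregular pairs of density below 2 s carry at most half of the bad edges; on the others
     (the set D) the density drops from 2 s to s on the witnessing sub-rectangle T. *)
  have cardD: "2 * s * card P \<le> card D"
  proof -
    define L where "L = {u \<in> P. f u = 1 \<and> g u < 2 * s}"
    have "irregular (\<epsilon> / 4) V \<S> E \<subseteq> D \<union> L"
      by (auto simp: irregular_def D_def L_def P_def f_def nd_def a_def s_def)
    then have "card (irregular (\<epsilon> / 4) V \<S> E) \<le> card (D \<union> L)"
      by (rule card_mono[rotated]) (use finD finP in \<open>auto simp: L_def\<close>)
    also have "\<dots> \<le> card D + card L" by (rule card_Un_le)
    finally have 1: "\<epsilon> * card P \<le> real (card D) + real (card L)"
      using bad unfolding cardP by linarith
    have "real (card L) = (\<Sum>u\<in>P. of_bool (f u = 1 \<and> g u < 2 * s))"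
      using finP by (simp add: L_def Int_def)
    also have "\<dots> = (\<Sum>u\<in>P. of_bool (g u < 2 * s) * f u)"
      by (rule sum.cong) (auto simp: f_def split: prod.split)
    also have "\<dots> = (\<Sum>u\<in>P. of_bool (g u < 2 * s) * g u)"
      unfolding g_eq
    proof (rule sum_fibre_avg[symmetric, OF finP])
      fix x y assume "r x = r y"
      then have "fibre_avg P r f x = fibre_avg P r f y" by (rule fibre_avg_cong)
      then show "of_bool (fibre_avg P r f x < 2 * s) = (of_bool (fibre_avg P r f y < 2 * s) :: real)" by simp
    qed
    also have "\<dots> \<le> (\<Sum>u\<in>P. 2 * s)" by (rule sum_mono) (use s in auto)
    finally have "real (card L) \<le> 2 * s * card P" by (simp add: mult_ac)
    moreover have "\<epsilon> * card P = 2 * (2 * s * card P)" using s by simp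
    ultimately show ?thesis using 1 by linarith
  qed
  have fibre: "fibre P r (x, y) = a x \<times> a y" if "x \<in> V" "y \<in> V" for x y
    using that by (auto simp: fibre_def P_def r_def a_def mem_atom_iff)
  have D_fibre: "(x', y') \<in> D \<longleftrightarrow> (x, y) \<in> D" if "(x, y) \<in> P" "x' \<in> a x" "y' \<in> a y" for x y x' y'
  proof -
    have *: "x' \<in> V" "y' \<in> V" "a x' = a x" "a y' = a y"
      using that by (auto simp: a_def mem_atom_iff P_def)
    then have "g (x', y') = g (x, y)"
      unfolding g_eq by (intro fibre_avg_cong) (simp add: r_def)
    then show ?thesis using * that by (simp add: D_def P_def nd_def)
  qed
  let ?wU = "\<lambda>x y. wU (a x) (a y)" and ?wW = "\<lambda>x y. wW (a x) (a y)"
  have T_fibre: "(a x \<times> a y) \<inter> T = ?wU x y \<times> ?wW x y" if xy: "(x, y) \<in> D" for x y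
  proof -
    have "(x, y) \<in> P" using xy DO by blast
    then have *: "(x', y') \<in> D" "a x' = a x" "a y' = a y" if "x' \<in> a x" "y' \<in> a y" for x' y'
      using that xy D_fibre[of x y x' y'] by (auto simp: a_def mem_atom_iff P_def)
    have sub: "?wU x y \<subseteq> a x" "?wW x y \<subseteq> a y"
      using w[of "a x" "a y"] xy by (auto simp: D_def nd_def)
    have "(x', y') \<in> (a x \<times> a y) \<inter> T \<longleftrightarrow> (x', y') \<in> ?wU x y \<times> ?wW x y" for x' y'
    proof (cases "x' \<in> a x \<and> y' \<in> a y")
      case True
      then show ?thesis using *[of x' y'] by (simp add: T_def)
    next
      case False
      then show ?thesis using sub by blast
    qed
    then show ?thesis by (simp only: set_eq_iff split_paired_All simp_thms)
  qed
  have T_fibre0: "(a x \<times> a y) \<inter> T = {}" if "(x, y) \<in> P" "(x, y) \<notin> D" for x y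
    using that D_fibre[of x y] TD by blast
  have fin_a: "finite (a x)" for x
    using finV atom_subset[of V \<S> x] unfolding a_def by (rule finite_subset[rotated])
  have cardT: "s\<^sup>2 * card D \<le> card T"
  proof -
    have "(\<Sum>u\<in>P. s\<^sup>2 * of_bool (u \<in> D)) \<le> (\<Sum>u\<in>P. of_bool (u \<in> T))"
    proof (rule sum_fibrewise_mono[where q = r, OF finP])
      fix u assume w0: "u \<in> P"
      obtain x y where [simp]: "u = (x, y)" by (cases u)
      have xy: "x \<in> V" "y \<in> V" using w0 by (auto simp: P_def)
      have sD: "(\<Sum>u'\<in>a x \<times> a y. s\<^sup>2 * of_bool (u' \<in> D)) = (\<Sum>u'\<in>a x \<times> a y. s\<^sup>2 * of_bool ((x, y) \<in> D))"
        by (rule sum.cong) (use D_fibre w0 in auto)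
      have sT: "(\<Sum>u'\<in>a x \<times> a y. of_bool (u' \<in> T)) = real (card ((a x \<times> a y) \<inter> T))"
        using fin_a by simp
      have "(\<Sum>u'\<in>a x \<times> a y. s\<^sup>2 * of_bool (u' \<in> D)) \<le> (\<Sum>u'\<in>a x \<times> a y. of_bool (u' \<in> T))"
      proof (cases "(x, y) \<in> D")
        case True
        then have nd: "\<not> dense_pair s E (a x) (a y)" by (auto simp: D_def nd_def)
        have "(s * card (a x)) * (s * card (a y)) \<le> card (?wU x y) * card (?wW x y)"
          unfolding of_nat_mult by (rule mult_mono) (use w[OF nd] s in auto)
        then show ?thesis unfolding sD sT T_fibre[OF True]
          using True by (simp add: card_cartesian_product power2_eq_square mult_ac)
      qed (simp add: sD sT)
      then show "(\<Sum>u'\<in>fibre P r u. s\<^sup>2 * of_bool (u' \<in> D))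
          \<le> (\<Sum>u'\<in>fibre P r u. of_bool (u' \<in> T))"
        using fibre[OF xy] by simp
    qed
    then show ?thesis by (simp only: sumD sumT flip: sum_distrib_left)
  qed
  have sumTf: "?I f \<le> s * card T"
  proof -
    have "?I f \<le> (\<Sum>u\<in>P. s * of_bool (u \<in> T))"
    proof (rule sum_fibrewise_mono[where q = r, OF finP])
      fix u assume w0: "u \<in> P"
      obtain x y where [simp]: "u = (x, y)" by (cases u)
      have xy: "x \<in> V" "y \<in> V" using w0 by (auto simp: P_def)
      have sT: "(\<Sum>u'\<in>a x \<times> a y. s * of_bool (u' \<in> T)) = s * real (card ((a x \<times> a y) \<inter> T))"
        using fin_a by (simp flip: sum_distrib_left)
      have "(\<Sum>u'\<in>a x \<times> a y. of_bool (u' \<in> T) * f u') = (\<Sum>u'\<in>a x \<times> a y. of_bool (u' \<in> T \<and> (case u' of (x, y) \<Rightarrow> E x y)))"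
        by (rule sum.cong) (auto simp: f_def)
      also have "\<dots> = card {u' \<in> (a x \<times> a y) \<inter> T. case u' of (x, y) \<Rightarrow> E x y}"
        using fin_a by (simp add: Int_def conj_ac)
      finally have sE: "(\<Sum>u'\<in>a x \<times> a y. of_bool (u' \<in> T) * f u') =
          real (card {u' \<in> (a x \<times> a y) \<inter> T. case u' of (x, y) \<Rightarrow> E x y})" .
      have "(\<Sum>u'\<in>a x \<times> a y. of_bool (u' \<in> T) * f u') \<le> (\<Sum>u'\<in>a x \<times> a y. s * of_bool (u' \<in> T))"
      proof (cases "(x, y) \<in> D")
        case True
        then have nd: "\<not> dense_pair s E (a x) (a y)" by (auto simp: D_def nd_def)
        have eq: "{u' \<in> X \<times> Y. case u' of (x, y) \<Rightarrow> E x y} = {(x, y) \<in> X \<times> Y. E x y}" for X Y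
          by auto
        show ?thesis unfolding sE sT T_fibre[OF True] eq
          using w[OF nd] by (simp add: card_cartesian_product mult_ac)
      next
        case False
        then show ?thesis unfolding sE sT using T_fibre0[of x y] w0 by simp
      qed
      then show "(\<Sum>u'\<in>fibre P r u. of_bool (u' \<in> T) * f u')
          \<le> (\<Sum>u'\<in>fibre P r u. s * of_bool (u' \<in> T))"
        using fibre[OF xy] by simp
    qed
    then show ?thesis by (simp only: sumT flip: sum_distrib_left)
  qed
  have refine: "a x = a y" if "x \<in> V" "y \<in> V" "atom V \<S>' x = atom V \<S>' y" for x y
    using that by (simp add: a_def atom_eq_iff \<S>'_def)
  \<comment> \<open>The witnesses belong to \<open>\<S>'\<close>, so \<open>T\<close> is a union of
    products of new atoms, and averaging over these preserves the number of edges in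
    \<open>T\<close>.\<close>
  have sumTg': "?I g' = ?I f"
    unfolding g'_eq
  proof (rule sum_fibre_avg[OF finP])
    fix p q assume pq: "p \<in> P" "q \<in> P" "r' p = r' q"
    obtain x y x' y' where [simp]: "p = (x, y)" "q = (x', y')" by (cases p; cases q)
    have V: "x \<in> V" "y \<in> V" "x' \<in> V" "y' \<in> V" using pq by (auto simp: P_def)
    have at: "atom V \<S>' x = atom V \<S>' x'" "atom V \<S>' y = atom V \<S>' y'"
      using pq by (auto simp: r'_def)
    have eq: "a x' = a x" "a y' = a y" using refine at V by metis+
    have "?wU x y \<in> \<S>'" "?wW x y \<in> \<S>'"
      using V by (force simp: \<S>'_def At_def)+
    then have "x \<in> ?wU x y \<longleftrightarrow> x' \<in> ?wU x y" "y \<in> ?wW x y \<longleftrightarrow> y' \<in> ?wW x y"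
      using at V by (auto simp: atom_eq_iff)
    moreover have "p \<in> D \<longleftrightarrow> q \<in> D"
      using D_fibre[of x y x' y'] V eq by (simp add: P_def a_def mem_atom_iff)
    ultimately show "of_bool (p \<in> T) = (of_bool (q \<in> T) :: real)"
      by (simp add: T_def eq)
  qed
  have sumTg: "2 * s * card T \<le> ?I g"
  proof -
    have "2 * s * card T = (\<Sum>u\<in>P. of_bool (u \<in> T) * (2 * s))"
      by (simp only: sumT mult.commute[of "2 * s"] flip: sum_distrib_right)
    also have "\<dots> \<le> ?I g"
      by (rule sum_mono) (use TD in \<open>auto simp: D_def\<close>)
    finally show ?thesis .
  qed
  \<comment> \<open>Cauchy-Schwarz in linear form: (g - g' - s)^2 \<ge> 0 converts an average drop
    of at least s on \<open>T\<close> into s^2 card T.\<close>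
  have "(\<Sum>u\<in>P. of_bool (u \<in> T) * (2 * s * (g u - g' u) - s\<^sup>2)) \<le> (\<Sum>u\<in>P. (g' u - g u)\<^sup>2)"
  proof (rule sum_mono)
    fix u assume "u \<in> P"
    have "2 * s * (g u - g' u) - s\<^sup>2 \<le> (g' u - g u)\<^sup>2"
      using zero_le_power2[of "g u - g' u - s"] by (simp add: power2_eq_square algebra_simps)
    then show "of_bool (u \<in> T) * (2 * s * (g u - g' u) - s\<^sup>2) \<le> (g' u - g u)\<^sup>2" by simp
  qed
  moreover have "(\<Sum>u\<in>P. of_bool (u \<in> T) * (2 * s * (g u - g' u) - s\<^sup>2)) =
     2 * s * ?I g - 2 * s * ?I g' - s\<^sup>2 * card T"
    unfolding sumT[symmetric] sum_distrib_left sum_subtractf[symmetric]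
    by (rule sum.cong) (auto simp: algebra_simps)
  moreover have "2 * s * (2 * s * card T) \<le> 2 * s * ?I g"
    using sumTg s by (intro mult_left_mono) auto
  moreover have "2 * s * ?I g' \<le> 2 * s * (s * card T)"
    using sumTf s unfolding sumTg' by (intro mult_left_mono) auto
  ultimately have "s\<^sup>2 * card T \<le> (\<Sum>u\<in>P. (g' u - g u)\<^sup>2)"
    by (simp add: power2_eq_square)
  moreover have "s\<^sup>2 * (s\<^sup>2 * (2 * s * card P)) \<le> s\<^sup>2 * (s\<^sup>2 * card D)"
    using cardD by (intro mult_left_mono) auto
  moreover have "s\<^sup>2 * (s\<^sup>2 * card D) \<le> s\<^sup>2 * card T"
    using cardT by (intro mult_left_mono) auto
  ultimately have "2 * s ^ 5 * card P \<le> (\<Sum>u\<in>P. (g' u - g u)\<^sup>2)"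
    by (simp add: power2_eq_square power_numeral_reduce mult_ac)
  moreover have "energy V \<S>' E = energy V \<S> E + (\<Sum>u\<in>P. (g' u - g u)\<^sup>2)"
    unfolding g_def g'_def P_def by (rule energy_refine[OF finV]) (simp add: \<S>'_def)
  ultimately have "energy V \<S> E + 2 * (\<epsilon> / 4) ^ 5 * (real (card V))\<^sup>2 \<le> energy V \<S>' E"
    by (simp add: cardP s_def)
  with fin' card' show thesis by (intro that[of \<S>']) (auto simp: \<S>'_def)
qed

text \<open>One family serves all k relations because their energies are added up: a refinement
  lowers none of them, and a relation that is still irregular gains d n^2. The sum is at most k n^2,
  so m > k/d rounds suffice. A round enlarges the bound M on the number of sets to M + 2 * 4^M,
  which depends on neither \<open>V\<close> nor \<open>E\<close>.\<close>

lemma regularity: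
  fixes \<epsilon> :: real
  assumes eps: "0 < \<epsilon>"
  shows "\<exists>M. \<forall>(V :: 'a set) (E :: nat \<Rightarrow> 'a \<Rightarrow> 'a \<Rightarrow> bool). finite V \<longrightarrow>
    (\<exists>\<S>. finite \<S> \<and> card \<S> \<le> M \<and>
      (\<forall>j<k. card (irregular (\<epsilon> / 4) V \<S> (E j))
          \<le> \<epsilon> * (real (card V))\<^sup>2))"
proof -
  define good where "good = (\<lambda>(V :: 'a set) (E :: nat \<Rightarrow> 'a \<Rightarrow> 'a \<Rightarrow> bool) \<S>.
      \<forall>j<k. card (irregular (\<epsilon> / 4) V \<S> (E j))
          \<le> \<epsilon> * (real (card V))\<^sup>2)"
  define d where "d = 2 * (\<epsilon> / 4) ^ 5"
  have d: "0 < d" using eps by (simp add: d_def)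
  define alt where "alt m V E \<S> \<longleftrightarrow>
    good V E \<S> \<or> real m * d * (real (card V))\<^sup>2 \<le> (\<Sum>j<k. energy V \<S> (E j))" for m :: nat and V E \<S>
  have step: "\<exists>M. \<forall>V E. finite V \<longrightarrow> (\<exists>\<S>. finite \<S> \<and> card \<S> \<le> M \<and>
      alt m V E \<S>)" for m :: nat
  proof (induction m)
    case 0
    show ?case
      by (intro exI[of _ 0] allI impI exI[of _ "{}"]) (auto intro!: sum_nonneg simp: alt_def energy_def)
  next
    case (Suc m)
    then obtain M where M: "\<And>V E. finite V \<Longrightarrow> \<exists>\<S>. finite \<S> \<and> card \<S> \<le> M \<and>
      alt m V E \<S>" by blast
    show ?case
    proof (intro exI[of _ "M + 2 * 4 ^ M"] allI impI)
      fix V :: "'a set" and E :: "nat \<Rightarrow> 'a \<Rightarrow> 'a \<Rightarrow> bool"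
      assume finV: "finite V"
      from M[OF finV, of E] obtain \<S> where S: "finite \<S>" "card \<S> \<le> M"
        "alt m V E \<S>" by blast
      show "\<exists>\<S>. finite \<S> \<and> card \<S> \<le> M + 2 * 4 ^ M \<and>
        alt (Suc m) V E \<S>"
      proof (cases "good V E \<S>")
        case True
        then show ?thesis using S by (intro exI[of _ \<S>]) (auto simp: alt_def)
      next
        case False
        then obtain j where j: "j < k" and bad:
          "real (card (irregular (\<epsilon> / 4) V \<S> (E j)))
                > \<epsilon> * (real (card V))\<^sup>2"
          unfolding good_def by (auto simp: not_le)
        obtain \<S>' where S': "finite \<S>'" "\<S> \<subseteq> \<S>'" "card \<S>' \<le> card \<S> + 2 * 4 ^ card \<S>"
          "energy V \<S> (E j) + 2 * (\<epsilon> / 4) ^ 5 * (real (card V))\<^sup>2 \<le> energy V \<S>' (E j)"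
          by (rule energy_increment[OF finV S(1) eps bad])
        have mono: "energy V \<S> (E i) \<le> energy V \<S>' (E i)" for i
          unfolding energy_refine[OF finV S'(2)] by (simp add: sum_nonneg)
        have "(\<Sum>i<k. energy V \<S> (E i)) + d * (real (card V))\<^sup>2 \<le> (\<Sum>i<k. energy V \<S>' (E i))"
        proof -
          have "(\<Sum>i<k. energy V \<S> (E i)) = energy V \<S> (E j) + (\<Sum>i\<in>{..<k} - {j}. energy V \<S> (E i))"
            "(\<Sum>i<k. energy V \<S>' (E i)) = energy V \<S>' (E j) + (\<Sum>i\<in>{..<k} - {j}. energy V \<S>' (E i))"
            using j by (auto intro: sum.remove)
          moreover have "(\<Sum>i\<in>{..<k} - {j}. energy V \<S> (E i)) \<le> (\<Sum>i\<in>{..<k} - {j}. energy V \<S>' (E i))"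
            by (rule sum_mono) (rule mono)
          ultimately show ?thesis using S'(4) unfolding d_def by linarith
        qed
        then have "real (Suc m) * d * (real (card V))\<^sup>2 \<le> (\<Sum>i<k. energy V \<S>' (E i))"
          using S(3) False by (simp add: alt_def algebra_simps)
        moreover have "card \<S>' \<le> M + 2 * 4 ^ M"
          using S'(3) S(2) power_increasing[OF S(2), of "4::nat"] by linarith
        ultimately show ?thesis using S' unfolding alt_def by blast
      qed
    qed
  qed
  obtain m :: nat where m: "real k / d < real m" using reals_Archimedean2 by blast
  then have m: "real k < real m * d" using d by (simp add: divide_less_eq)
  from step[of m] obtain M where M: "\<And>V E. finite V \<Longrightarrow> \<exists>\<S>. finite \<S> \<and> card \<S> \<le> M \<and>
      alt m V E \<S>" by blast
  show ?thesis
  proof (intro exI[of _ M] allI impI)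
    fix V :: "'a set" and E :: "nat \<Rightarrow> 'a \<Rightarrow> 'a \<Rightarrow> bool"
    assume finV: "finite V"
    from M[OF finV, of E] obtain \<S> where S: "finite \<S>" "card \<S> \<le> M"
      "alt m V E \<S>" by blast
    have "good V E \<S>"
    proof (cases "V = {}")
      case True
      then show ?thesis by (simp add: good_def irregular_def)
    next
      case False
      have "(\<Sum>j<k. energy V \<S> (E j)) \<le> (\<Sum>j<k. (real (card V))\<^sup>2)"
        by (rule sum_mono) (rule energy_le[OF finV])
      also have "\<dots> = real k * (real (card V))\<^sup>2" by simp
      also have "\<dots> < real m * d * (real (card V))\<^sup>2"
        using m False finV by (intro mult_strict_right_mono) (auto simp: card_gt_0_iff)
      finally show ?thesis using S(3) unfolding alt_def by linarith
    qed
    then show "\<exists>\<S>. finite \<S> \<and> card \<S> \<le> M \<and>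
      (\<forall>j<k. card (irregular (\<epsilon> / 4) V \<S> (E j))
          \<le> \<epsilon> * (real (card V))\<^sup>2)"
      using S unfolding good_def by blast
  qed
qed

section \<open>Counting closed walks through dense pairs\<close>

fun walks :: "'a set \<Rightarrow> ('a \<Rightarrow> 'a \<Rightarrow> bool) list \<Rightarrow> 'a \<Rightarrow> 'a \<Rightarrow> nat" where
  "walks V [] y z = of_bool (y = z)"
| "walks V (E # Es) y z = (\<Sum>x\<in>{x \<in> V. E y x}. walks V Es x z)"

lemma card_pairs_eq_sum:
  assumes "finite A" "finite B"
  shows "card {(x, y) \<in> A \<times> B. E x y} = (\<Sum>x\<in>A. card {y \<in> B. E x y})"
proof -
  have "{(x, y) \<in> A \<times> B. E x y} = (SIGMA x:A. {y \<in> B. E x y})" by auto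
  then show ?thesis using assms by simp
qed

lemma dense_pair_converse:
  assumes "dense_pair c E U W"
  shows "dense_pair c (\<lambda>x y. E y x) W U"
  unfolding dense_pair_def
proof (intro allI impI)
  fix W' U' assume *: "W' \<subseteq> W \<and> U' \<subseteq> U \<and> c * card W \<le> card W' \<and> c * card U \<le> card U'"
  then have "c * card U' * card W' \<le> card {(x, y) \<in> U' \<times> W'. E x y}"
    using assms unfolding dense_pair_def by blast
  also have "card {(x, y) \<in> U' \<times> W'. E x y} = card {(x, y) \<in> W' \<times> U'. E y x}"
    by (rule bij_betw_same_card[of prod.swap]) (auto simp: bij_betw_def inj_on_def image_def)
  finally show "c * card W' * card U' \<le> card {(x, y) \<in> W' \<times> U'. E y x}"
    by (simp add: mult_ac)
qed

text \<open>If there were more vertices of low degree into \<open>S\<close>, they would form with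
  \<open>S\<close> a large rectangle of density below \<open>c\<close>.\<close>

lemma dense_pair_low_degree:
  fixes c :: real
  assumes d: "dense_pair c E U W" and fin: "finite U" "finite W"
    and S: "S \<subseteq> W" "c * card W \<le> card S" and c: "0 \<le> c"
  shows "card {x \<in> U. card {y \<in> S. E x y} < c * card S} \<le> c * card U"
proof (rule ccontr)
  define B where "B = {x \<in> U. card {y \<in> S. E x y} < c * card S}"
  assume "\<not> card {x \<in> U. card {y \<in> S. E x y} < c * card S} \<le> c * card U"
  then have B: "c * card U < card B" by (simp add: B_def)
  have finB: "finite B" and finS: "finite S" using fin S by (auto simp: B_def intro: finite_subset)
  have "0 \<le> c * card U" using c by simp
  then have "B \<noteq> {}" using B by force
  then have "(\<Sum>x\<in>B. real (card {y \<in> S. E x y})) < (\<Sum>x\<in>B. c * card S)"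
    using finB by (intro sum_strict_mono) (auto simp: B_def)
  then have "real (card {(x, y) \<in> B \<times> S. E x y}) < c * card B * card S"
    unfolding card_pairs_eq_sum[OF finB finS] by (simp add: mult_ac)
  moreover have "c * card B * card S \<le> card {(x, y) \<in> B \<times> S. E x y}"
  proof -
    have "B \<subseteq> U" by (auto simp: B_def)
    then show ?thesis using d[unfolded dense_pair_def, rule_format, of B S] B S by simp
  qed
  ultimately show False by linarith
qed

lemma dense_pair_high_degree:
  fixes c :: real
  assumes d: "dense_pair c E U W" and fin: "finite U" "finite W"
    and S: "S \<subseteq> W" "c * card W \<le> card S" and c: "0 \<le> c"
  shows "(1 - c) * card U \<le> card {x \<in> U. c * card S \<le> card {y \<in> S. E x y}}"
proof -
  have "card U = card {x \<in> U. card {y \<in> S. E x y} < c * card S} + card {x \<in> U. c * card S \<le> card {y \<in> S. E x y}}"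
    using fin by (subst card_Un_disjoint[symmetric]) (auto intro: arg_cong[where f = card])
  then show ?thesis using dense_pair_low_degree[OF assms] by (simp add: algebra_simps)
qed

text \<open>For a fixed \<open>z\<close>, the sets of vertices with many walks to \<open>z\<close>
  are grown backwards, each filling a share \<open>c\<close> of its \<open>U j\<close>. The walk
  must also start at \<open>z\<close>, so \<open>Z\<close> asks for many neighbours of
  \<open>z\<close> on both sides; either condition fails for a share of at most c \<le> 1/4 of
  \<open>U 0\<close>, which leaves half of it.\<close>

lemma closed_walks_ge:
  fixes \<mu> c :: real and U :: "nat \<Rightarrow> 'a set" and E :: "nat \<Rightarrow> 'a \<Rightarrow> 'a \<Rightarrow> bool"
  assumes k: "3 \<le> k" and fin: "finite V" and U: "\<And>j. U j \<subseteq> V" and closed: "U k = U 0"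
    and large: "\<And>j. j < k \<Longrightarrow> \<mu> * card V \<le> card (U j)" and mu: "0 < \<mu>"
    and c: "0 < c" "c \<le> 1 / 4"
    and dense: "\<And>j. j < k \<Longrightarrow> dense_pair c (E j) (U j) (U (Suc j))"
  shows "\<mu> / 2 * (c\<^sup>2 * \<mu>) ^ (k - 1) * real (card V) ^ k \<le> (\<Sum>z\<in>V. walks V (map E [0..<k]) z z)"
proof -
  define n where "n = real (card V)"
  \<comment> \<open>The factor gained per step: a set \<open>S\<close> with a share \<open>c\<close>
    of some \<open>U j\<close> has at least c \<mu> n elements, and a vertex of high degree sees a
    share \<open>c\<close> of these.\<close>
  define \<theta> where "\<theta> = c\<^sup>2 * \<mu> * n"
  have \<theta>: "0 \<le> \<theta>" using mu by (simp add: \<theta>_def n_def)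
  have finU: "finite (U j)" for j using U fin by (rule finite_subset)
  define Inn where "Inn z = {y \<in> U (k - 1). E (k - 1) y z}" for z
  define Out where "Out z = {x \<in> U 1. E 0 z x}" for z
  define Z where "Z = {z \<in> U 0. c * card (U (k - 1)) \<le> card (Inn z) \<and> c * card (U 1) \<le> card (Out z)}"
  have backward: "\<exists>S \<subseteq> U (k - 1 - d). c * card (U (k - 1 - d)) \<le> card S \<and>
      (\<forall>y\<in>S. \<theta> ^ d \<le> walks V (map E [k - 1 - d..<k]) y z)"
    if z: "z \<in> Z" and "d \<le> k - 1" for z d
    using that(2)
  proof (induction d)
    case 0
    have "z \<in> V" using z U by (auto simp: Z_def)
    have k1: "[k - 1..<k] = [k - 1]" using k by (subst upt_conv_Cons) auto
    have "1 \<le> walks V (map E [k - 1..<k]) y z" if "y \<in> Inn z" for y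
      using that \<open>z \<in> V\<close> fin unfolding k1 by (auto simp: Inn_def)
    then have "\<forall>y\<in>Inn z. \<theta> ^ 0 \<le> walks V (map E [k - 1..<k]) y z" by simp
    then show ?case using z by (intro exI[of _ "Inn z"]) (auto simp: Z_def Inn_def)
  next
    case (Suc d)
    define j where "j = k - 1 - Suc d"
    have j: "k - 1 - d = Suc j" "j < k" using Suc.prems k by (auto simp: j_def)
    obtain S where S: "S \<subseteq> U (Suc j)" "c * card (U (Suc j)) \<le> card S"
      "\<And>y. y \<in> S \<Longrightarrow> \<theta> ^ d \<le> walks V (map E [Suc j..<k]) y z"
      using Suc j by auto
    define S' where "S' = {x \<in> U j. c * card S \<le> card {y \<in> S. E j x y}}"
    have "(1 - c) * card (U j) \<le> card S'"
      unfolding S'_def using dense[OF j(2)] finU S c by (intro dense_pair_high_degree) auto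
    moreover have "c * card (U j) \<le> (1 - c) * card (U j)"
      using c by (intro mult_right_mono) auto
    ultimately have S'c: "c * card (U j) \<le> card S'" by linarith
    have "\<theta> ^ Suc d \<le> walks V (map E [j..<k]) x z" if x: "x \<in> S'" for x
    proof -
      have "\<mu> * n \<le> card (U (Suc j))"
        using large[of "Suc j"] large[of 0] closed j k by (cases "Suc j < k") (auto simp: n_def less_Suc_eq le_Suc_eq)
      then have "c * (\<mu> * n) \<le> c * card (U (Suc j))" using c by simp
      then have "c * (\<mu> * n) \<le> card S" using S(2) by linarith
      then have "c * (c * (\<mu> * n)) \<le> c * card S" using c by simp
      then have "\<theta> \<le> c * card S" by (simp add: \<theta>_def power2_eq_square mult_ac)
      then have "\<theta> \<le> card {y \<in> S. E j x y}" using x by (auto simp: S'_def)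
      then have "\<theta> * \<theta> ^ d \<le> card {y \<in> S. E j x y} * \<theta> ^ d" using \<theta> by (intro mult_right_mono) auto
      also have "\<dots> = (\<Sum>y\<in>{y \<in> S. E j x y}. \<theta> ^ d)" by simp
      also have "\<dots> \<le> (\<Sum>y\<in>{y \<in> S. E j x y}. real (walks V (map E [Suc j..<k]) y z))"
        by (rule sum_mono) (use S(3) in auto)
      also have "\<dots> \<le> (\<Sum>y\<in>{y \<in> V. E j x y}. real (walks V (map E [Suc j..<k]) y z))"
        using S(1) U fin by (intro sum_mono2) auto
      also have "\<dots> = walks V (map E [j..<k]) x z"
        using j by (simp add: upt_conv_Cons)
      finally show ?thesis by simp
    qed
    then show ?case unfolding j_def[symmetric] using S'c by (intro exI[of _ S']) (auto simp: S'_def)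
  qed
  (* One more step back would give a large set of starting points in U 1, which need not meet
     Out z; so the density of (U 1, U 2) is applied to Out z and the starting points in U 2. *)
  have each: "\<theta> ^ (k - 1) \<le> walks V (map E [0..<k]) z z" if z: "z \<in> Z" for z
  proof -
    have k2: "k - 1 - (k - 3) = 2" and "k - 3 \<le> k - 1" using k by simp_all
    then obtain S where S: "S \<subseteq> U 2" "c * card (U 2) \<le> card S"
      "\<And>y. y \<in> S \<Longrightarrow> \<theta> ^ (k - 3) \<le> walks V (map E [2..<k]) y z"
      using backward[OF z \<open>k - 3 \<le> k - 1\<close>] unfolding k2 by blast
    have up: "[0..<k] = 0 # 1 # [2..<k]"
      using k by (simp add: upt_conv_Cons numeral_2_eq_2)
    have finS: "finite S" and finO: "finite (Out z)" using S finU by (auto simp: Out_def intro: finite_subset)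
    have "Out z \<subseteq> U 1" "c * card (U 1) \<le> card (Out z)" using z by (auto simp: Out_def Z_def)
    moreover have "dense_pair c (E 1) (U 1) (U 2)" using dense[of 1] k by (simp add: numeral_2_eq_2)
    ultimately have D: "c * card (Out z) * card S \<le> card {(x, y) \<in> Out z \<times> S. E 1 x y}"
      using S unfolding dense_pair_def by blast
    have "c * (\<mu> * n) \<le> c * card (U 1)" "c * (\<mu> * n) \<le> c * card (U 2)"
      using c large[of 1] large[of 2] k by (auto simp: n_def)
    then have a: "c * (\<mu> * n) \<le> card (Out z)" "c * (\<mu> * n) \<le> card S"
      using S(2) \<open>c * card (U 1) \<le> card (Out z)\<close> by linarith+
    have "c * ((c * (\<mu> * n)) * (c * (\<mu> * n))) \<le> c * (card (Out z) * card S)"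
      unfolding of_nat_mult using a c mu by (intro mult_left_mono mult_mono) (auto simp: n_def)
    moreover have "c * (c * ((c * (\<mu> * n)) * (c * (\<mu> * n)))) \<le> 1 * (c * ((c * (\<mu> * n)) * (c * (\<mu> * n))))"
      using c mu by (intro mult_right_mono) (auto simp: n_def)
    ultimately have "\<theta>\<^sup>2 \<le> c * card (Out z) * card S"
      by (simp add: \<theta>_def power2_eq_square mult_ac)
    then have "\<theta>\<^sup>2 * \<theta> ^ (k - 3) \<le> card {(x, y) \<in> Out z \<times> S. E 1 x y} * \<theta> ^ (k - 3)"
      using D \<theta> by (intro mult_right_mono) auto
    also have "\<dots> = (\<Sum>x\<in>Out z. \<Sum>y\<in>{y \<in> S. E 1 x y}. \<theta> ^ (k - 3))"
      unfolding card_pairs_eq_sum[OF finO finS] by (simp add: sum_distrib_right)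
    also have "\<dots> \<le> (\<Sum>x\<in>Out z. \<Sum>y\<in>{y \<in> S. E 1 x y}. real (walks V (map E [2..<k]) y z))"
      by (intro sum_mono) (use S(3) in auto)
    also have "\<dots> \<le> (\<Sum>x\<in>Out z. \<Sum>y\<in>{y \<in> V. E 1 x y}. real (walks V (map E [2..<k]) y z))"
      using S(1) U fin by (intro sum_mono sum_mono2) auto
    also have "\<dots> \<le> (\<Sum>x\<in>{x \<in> V. E 0 z x}. \<Sum>y\<in>{y \<in> V. E 1 x y}. real (walks V (map E [2..<k]) y z))"
      using U fin by (intro sum_mono2) (auto simp: Out_def intro!: sum_nonneg)
    also have "\<dots> = walks V (map E [0..<k]) z z" unfolding up by simp
    finally have "\<theta>\<^sup>2 * \<theta> ^ (k - 3) \<le> walks V (map E [0..<k]) z z" .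
    moreover have "k - 1 = 2 + (k - 3)" using k by simp
    then have "\<theta> ^ (k - 1) = \<theta>\<^sup>2 * \<theta> ^ (k - 3)" by (simp only: power_add)
    ultimately show ?thesis by simp
  qed
  have "card (U 0) / 2 \<le> card Z"
  proof -
    have kk: "Suc (k - 1) = k" using k by simp
    have "U 0 \<subseteq> Z \<union> ({z \<in> U 0. card (Inn z) < c * card (U (k - 1))} \<union> {z \<in> U 0. card (Out z) < c * card (U 1)})"
      by (auto simp: Z_def)
    then have "card (U 0) \<le> card (Z \<union> ({z \<in> U 0. card (Inn z) < c * card (U (k - 1))} \<union> {z \<in> U 0. card (Out z) < c * card (U 1)}))"
      by (rule card_mono[rotated]) (use finU in \<open>auto simp: Z_def\<close>)
    also have "\<dots> \<le> card Z + (card {z \<in> U 0. card (Inn z) < c * card (U (k - 1))} + card {z \<in> U 0. card (Out z) < c * card (U 1)})"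
      by (meson card_Un_le order_trans add_left_mono)
    finally have 1: "card (U 0) \<le> card Z + (card {z \<in> U 0. card (Inn z) < c * card (U (k - 1))} + card {z \<in> U 0. card (Out z) < c * card (U 1)})" .
    have sm: "c * card (U j) \<le> 1 * real (card (U j))" for j using c by (intro mult_right_mono) auto
    have d0: "dense_pair c (E 0) (U 0) (U 1)" using dense[of 0] k by simp
    have d1: "dense_pair c (\<lambda>x y. E (k - 1) y x) (U 0) (U (k - 1))"
      by (rule dense_pair_converse) (use dense[of "k - 1"] k closed kk in simp)
    have "card {z \<in> U 0. card (Out z) < c * card (U 1)} \<le> c * card (U 0)"
      unfolding Out_def using dense_pair_low_degree[OF d0 finU finU order_refl] sm[of 1] c by simp
    moreover have "card {z \<in> U 0. card (Inn z) < c * card (U (k - 1))} \<le> c * card (U 0)"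
      unfolding Inn_def using dense_pair_low_degree[OF d1 finU finU order_refl] sm[of "k - 1"] c by simp
    moreover have "c * card (U 0) \<le> 1 / 4 * real (card (U 0))" using c by (intro mult_right_mono) auto
    ultimately show ?thesis using 1 by linarith
  qed
  then have "\<mu> * n / 2 \<le> card Z" using large[of 0] k by (simp add: n_def)
  then have "\<mu> * n / 2 * \<theta> ^ (k - 1) \<le> card Z * \<theta> ^ (k - 1)" using \<theta> by (intro mult_right_mono) auto
  also have "\<dots> = (\<Sum>z\<in>Z. \<theta> ^ (k - 1))" by simp
  also have "\<dots> \<le> (\<Sum>z\<in>Z. real (walks V (map E [0..<k]) z z))" by (rule sum_mono) (rule each)
  also have "\<dots> \<le> (\<Sum>z\<in>V. real (walks V (map E [0..<k]) z z))"
    using fin U by (intro sum_mono2) (auto simp: Z_def)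
  finally have "\<mu> * n / 2 * \<theta> ^ (k - 1) \<le> (\<Sum>z\<in>V. walks V (map E [0..<k]) z z)" by simp
  moreover have "\<mu> / 2 * (c\<^sup>2 * \<mu>) ^ (k - 1) * n ^ k = \<mu> * n / 2 * \<theta> ^ (k - 1)"
  proof -
    have "n ^ k = n * n ^ (k - 1)" using k by (simp flip: power_Suc)
    then show ?thesis by (simp add: \<theta>_def power_mult_distrib mult_ac)
  qed
  ultimately have "\<mu> / 2 * (c\<^sup>2 * \<mu>) ^ (k - 1) * n ^ k \<le> (\<Sum>z\<in>V. walks V (map E [0..<k]) z z)"
    by (simp only:)
  then show ?thesis by (simp only: n_def)
qed

text \<open>Disjointness is meant level by level: at each step \<open>j\<close> an edge belongs to
  at most one walk, but two walks may use the same pair of vertices at different steps.\<close>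

definition disjoint_closed_walks ::
  "nat \<Rightarrow> 'a set \<Rightarrow> (nat \<Rightarrow> 'a \<Rightarrow> 'a \<Rightarrow> bool) \<Rightarrow> 'i set \<Rightarrow> ('i \<Rightarrow> nat \<Rightarrow> 'a) \<Rightarrow> bool" where
  "disjoint_closed_walks k V E I w \<longleftrightarrow>
     (\<forall>i\<in>I. \<forall>j. w i j \<in> V) \<and> (\<forall>i\<in>I. w i k = w i 0) \<and>
     (\<forall>i\<in>I. \<forall>j<k. E j (w i j) (w i (Suc j))) \<and>
     (\<forall>j<k. inj_on (\<lambda>i. (w i j, w i (Suc j))) I)"

text \<open>At each level at most 3 \<epsilon> n^2 edges are discarded: \<epsilon> n^2 in pairs that
  are not dense and 2 \<epsilon> n^2 touching a small atom. By disjointness a discarded edge kills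
  at most one walk per level, so fewer than 4 k \<epsilon> n^2 \<le> \<beta> n^2 walks die. The
  atoms along a surviving walk form a closed chain of large dense pairs, to which
  \<open>closed_walks_ge\<close> applies.\<close>

lemma cycle_removal:
  fixes \<beta> :: real
  assumes k: "3 \<le> k" and beta: "0 < \<beta>"
  shows "\<exists>\<eta>>0. \<forall>(V :: 'a set) E (I :: 'i set) (w :: 'i \<Rightarrow> nat \<Rightarrow> 'a).
    finite V \<longrightarrow> finite I \<longrightarrow> \<beta> * (real (card V))\<^sup>2 \<le> card I \<longrightarrow>
    disjoint_closed_walks k V E I w \<longrightarrow>
    \<eta> * real (card V) ^ k \<le> (\<Sum>z\<in>V. walks V (map E [0..<k]) z z)"
proof -
  define \<epsilon> where "\<epsilon> = min 1 (\<beta> / (4 * k))"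
  have eps: "0 < \<epsilon>" "\<epsilon> \<le> 1" using beta k by (auto simp: \<epsilon>_def)
  have "\<epsilon> \<le> \<beta> / (4 * k)" by (simp add: \<epsilon>_def)
  then have keps: "4 * (k * \<epsilon>) \<le> \<beta>" using k by (simp add: pos_le_divide_eq mult_ac)
  define c where "c = \<epsilon> / 4"
  obtain M where M: "\<And>(V :: 'a set) (E :: nat \<Rightarrow> 'a \<Rightarrow> 'a \<Rightarrow> bool). finite V \<Longrightarrow>
    (\<exists>\<S>. finite \<S> \<and> card \<S> \<le> M \<and>
      (\<forall>j<k. card (irregular c V \<S> (E j))
          \<le> \<epsilon> * (real (card V))\<^sup>2))"
    using regularity[OF eps(1), of k, where 'a = 'a] unfolding c_def by blast
  \<comment> \<open>There are at most 2^M atoms, so those with fewer than \<mu> n elements cover at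
    most \<epsilon> n vertices together.\<close>
  define \<mu> where "\<mu> = \<epsilon> / 2 ^ M"
  have mu: "0 < \<mu>" using eps by (simp add: \<mu>_def)
  define \<eta> where "\<eta> = \<mu> / 2 * (c\<^sup>2 * \<mu>) ^ (k - 1)"
  have eta: "0 < \<eta>" using mu eps by (simp add: \<eta>_def c_def)
  have main: "\<eta> * real (card V) ^ k \<le> (\<Sum>z\<in>V. walks V (map E [0..<k]) z z)"
    if fin: "finite V" and finI: "finite I" and cI: "\<beta> * (real (card V))\<^sup>2 \<le> card I"
      and w: "disjoint_closed_walks k V E I w"
    for V :: "'a set" and E and I :: "'i set" and w
  proof (cases "V = {}")
    case True
    then show ?thesis using k by (simp add: zero_power)
  next
    case False
    have wV: "\<forall>i\<in>I. \<forall>j. w i j \<in> V" and closed: "\<forall>i\<in>I. w i k = w i 0"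
      and wE: "\<forall>i\<in>I. \<forall>j<k. E j (w i j) (w i (Suc j))"
      and inj: "\<forall>j<k. inj_on (\<lambda>i. (w i j, w i (Suc j))) I"
      using w unfolding disjoint_closed_walks_def by blast+
    define n where "n = real (card V)"
    have n: "0 < n" using False fin by (simp add: n_def card_gt_0_iff)
    obtain \<S> where S: "finite \<S>" "card \<S> \<le> M"
      and reg: "\<And>j. j < k \<Longrightarrow> card (irregular c V \<S> (E j))
          \<le> \<epsilon> * n\<^sup>2"
      using M[OF fin, of E] unfolding n_def by blast
    define small where "small = {x \<in> V. card (atom V \<S> x) < \<mu> * n}"
    have fin_atom: "finite (atom V \<S> x)" for x using fin atom_subset by (rule finite_subset[rotated])
    have finsmall: "finite small" using fin by (simp add: small_def)
    have "card small \<le> \<epsilon> * n"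
    proof -
      define At where "At = {U \<in> atom V \<S> ` V. card U < \<mu> * n}"
      have finAt: "finite At" using card_atoms_le(1)[OF S(1), of V] by (simp add: At_def)
      have "card At \<le> card (atom V \<S> ` V)" unfolding At_def
        by (rule card_mono) (use card_atoms_le(1)[OF S(1), of V] in auto)
      also have "\<dots> \<le> 2 ^ card \<S>" by (rule card_atoms_le(2)[OF S(1)])
      also have "\<dots> \<le> 2 ^ M" using S(2) by simp
      finally have cAt: "real (card At) \<le> 2 ^ M" by (metis of_nat_le_iff of_nat_numeral of_nat_power)
      have "small \<subseteq> \<Union>At" by (auto simp: small_def At_def intro: atom_self)
      then have "card small \<le> card (\<Union>At)"
        by (rule card_mono[rotated]) (use finAt fin_atom in \<open>auto simp: At_def\<close>)
      also have "\<dots> \<le> (\<Sum>U\<in>At. card U)"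
        using card_Union_le_sum_card_weak[of At] fin_atom by (force simp: At_def)
      finally have "real (card small) \<le> (\<Sum>U\<in>At. real (card U))"
        by (metis of_nat_le_iff of_nat_sum)
      also have "\<dots> \<le> (\<Sum>U\<in>At. \<mu> * n)" by (rule sum_mono) (simp add: At_def)
      also have "\<dots> = card At * (\<mu> * n)" by simp
      also have "\<dots> \<le> 2 ^ M * (\<mu> * n)" using cAt mu n by (intro mult_right_mono) auto
      finally show ?thesis by (simp add: \<mu>_def)
    qed
    then have small2: "card small * n \<le> \<epsilon> * n\<^sup>2"
      using n by (simp add: power2_eq_square)
    define B where "B j = irregular c V \<S> (E j)
        \<union> (small \<times> V \<union> V \<times> small)" for j
    have cB: "card (B j) \<le> 3 * (\<epsilon> * n\<^sup>2)" if "j < k" for j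
    proof -
      have "card (B j) \<le> card (irregular c V \<S> (E j))
          + (card (small \<times> V) + card (V \<times> small))"
        unfolding B_def by (meson card_Un_le order_trans add_left_mono)
      then have "real (card (B j)) \<le> real (card (irregular c V \<S> (E j)))
          + (card small * n + card small * n)"
        unfolding card_cartesian_product n_def by (simp add: mult_ac flip: of_nat_add of_nat_mult)
      then show ?thesis using reg[OF that] small2 by linarith
    qed
    have finB: "finite (B j)" for j
      by (rule finite_subset[of _ "V \<times> V"]) (use fin in \<open>auto simp: B_def irregular_def small_def\<close>)
    define J where "J j = {i \<in> I. (w i j, w i (Suc j)) \<in> B j}" for j
    have "\<exists>i\<in>I. \<forall>j<k. i \<notin> J j"
    proof (rule ccontr)
      assume "\<not> ?thesis"
      then have "I \<subseteq> (\<Union>j<k. J j)" by blast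
      then have "card I \<le> card (\<Union>j<k. J j)"
        by (rule card_mono[rotated]) (use finI in \<open>auto simp: J_def\<close>)
      also have "\<dots> \<le> (\<Sum>j<k. card (J j))" by (rule card_UN_le) simp
      also have "\<dots> \<le> (\<Sum>j<k. card (B j))"
      proof (rule sum_mono)
        fix j assume "j \<in> {..<k}"
        then have "inj_on (\<lambda>i. (w i j, w i (Suc j))) (J j)"
          using inj by (auto simp: J_def intro: inj_on_subset)
        then show "card (J j) \<le> card (B j)"
          by (rule card_inj_on_le[OF _ _ finB]) (auto simp: J_def)
      qed
      finally have "real (card I) \<le> (\<Sum>j<k. real (card (B j)))"
        by (metis of_nat_le_iff of_nat_sum)
      also have "\<dots> \<le> (\<Sum>j<k. 3 * (\<epsilon> * n\<^sup>2))" by (rule sum_mono) (simp add: cB)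
      also have "\<dots> = 3 * (k * \<epsilon>) * n\<^sup>2" by simp
      also have "\<dots> < 4 * (k * \<epsilon>) * n\<^sup>2" using k eps n by (intro mult_strict_right_mono) auto
      also have "\<dots> \<le> \<beta> * n\<^sup>2" using keps by (intro mult_right_mono) auto
      finally show False using cI by (simp add: n_def)
    qed
    then obtain i where i: "i \<in> I" and good: "\<And>j. j < k \<Longrightarrow> (w i j, w i (Suc j)) \<notin> B j"
      by (auto simp: J_def)
    define U where "U j = atom V \<S> (w i j)" for j
    have wi: "w i j \<in> V" for j using wV i by blast
    show ?thesis unfolding \<eta>_def
    proof (rule closed_walks_ge[OF k fin, where U = U])
      show "U j \<subseteq> V" for j by (simp add: U_def atom_subset)
      show "U k = U 0" using closed i by (simp add: U_def)
      show "\<mu> * card V \<le> card (U j)" if "j < k" for j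
        using good[OF that] wi by (auto simp: B_def small_def U_def n_def)
      show "dense_pair c (E j) (U j) (U (Suc j))" if "j < k" for j
        using good[OF that] wi wE i that by (auto simp: B_def irregular_def U_def)
    qed (use mu eps in \<open>auto simp: c_def\<close>)
  qed
  show ?thesis
    by (rule exI[of _ \<eta>], intro conjI allI impI, rule eta, rule main) assumption+
qed

section \<open>Counting independent sets with the hard-core measure\<close>

abbreviation coords :: "nat set \<Rightarrow> 'a list \<Rightarrow> nat \<Rightarrow> 'a" where
  "coords J \<equiv> \<lambda>xs. restrict ((!) xs) J"

text \<open>An ordered \<open>k\<close>-uniform hypergraph in which any \<open>k - 1\<close> coordinates determine an edge.\<close>
definition tuple_system :: "nat \<Rightarrow> 'a set \<Rightarrow> 'a list set \<Rightarrow> bool" where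
  "tuple_system k V T \<longleftrightarrow>
     (\<forall>xs\<in>T. length xs = k \<and> distinct xs \<and> set xs \<subseteq> V) \<and>
     (\<forall>j<k. inj_on (coords ({..<k} - {j})) T)"

definition supersaturated :: "nat \<Rightarrow> real \<Rightarrow> real \<Rightarrow> 'a set \<Rightarrow> 'a list set \<Rightarrow> bool" where
  "supersaturated k \<beta> \<eta> V T \<longleftrightarrow> (\<forall>A\<subseteq>V. \<beta> * card V \<le> card A \<longrightarrow>
     \<eta> * real (card V) ^ (k - 1) \<le> card {xs \<in> T. set xs \<subseteq> A})"

definition independent_sets :: "'a set \<Rightarrow> 'a list set \<Rightarrow> nat \<Rightarrow> 'a set set" where
  "independent_sets V T t = {X. X \<subseteq> V \<and> card X = t \<and> (\<forall>xs\<in>T. \<not> set xs \<subseteq> X)}"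

lemma tuple_system_finite:
  assumes "tuple_system k V T" "finite V" shows "finite T"
  by (rule finite_subset[OF _ finite_lists_length_eq[OF assms(2), of k]])
    (use assms(1) in \<open>auto simp: tuple_system_def\<close>)

text \<open>As the coordinates in \<open>J\<close> determine a tuple, \<open>U\<close> embeds into
  the functions from \<open>J\<close> to \<open>V\<close>, over which a sum of products
  factorises.\<close>

lemma sum_prod_coords_le:
  fixes f :: "nat \<Rightarrow> 'a \<Rightarrow> real"
  assumes fin: "finite V" "finite J"
    and inj: "inj_on (coords J) U"
    and mem: "\<And>xs j. xs \<in> U \<Longrightarrow> j \<in> J \<Longrightarrow> xs ! j \<in> V"
    and nonneg: "\<And>j x. 0 \<le> f j x"
  shows "(\<Sum>xs\<in>U. \<Prod>j\<in>J. f j (xs ! j)) \<le> (\<Prod>j\<in>J. \<Sum>x\<in>V. f j x)"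
proof -
  have "(\<Sum>xs\<in>U. \<Prod>j\<in>J. f j (xs ! j)) = (\<Sum>xs\<in>U. \<Prod>j\<in>J. f j (coords J xs j))"
    by (intro sum.cong prod.cong) auto
  also have "\<dots> = (\<Sum>g\<in>(coords J) ` U. \<Prod>j\<in>J. f j (g j))"
    by (subst sum.reindex[OF inj]) (simp add: o_def)
  also have "\<dots> \<le> (\<Sum>g\<in>PiE J (\<lambda>_. V). \<Prod>j\<in>J. f j (g j))"
    using mem by (intro sum_mono2 finite_PiE fin prod_nonneg) (auto simp: nonneg)
  also have "\<dots> = (\<Prod>j\<in>J. \<Sum>x\<in>V. f j x)"
    by (rule prod_sum_PiE[symmetric]) (use fin in auto)
  finally show ?thesis .
qed

lemma card_coords_le:
  assumes fin: "finite V" "finite J"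
    and inj: "inj_on (coords J) U"
    and mem: "\<And>xs j. xs \<in> U \<Longrightarrow> j \<in> J \<Longrightarrow> xs ! j \<in> V"
    and A: "\<And>xs j. xs \<in> U \<Longrightarrow> j \<in> J \<Longrightarrow> xs ! j \<in> A j"
  shows "real (card U) \<le> (\<Prod>j\<in>J. real (card (V \<inter> A j)))"
proof -
  have "real (card U) = (\<Sum>xs\<in>U. \<Prod>j\<in>J. of_bool (xs ! j \<in> A j))"
    using A by simp
  also have "\<dots> \<le> (\<Prod>j\<in>J. \<Sum>x\<in>V. of_bool (x \<in> A j))"
    by (rule sum_prod_coords_le[OF fin inj mem]) auto
  also have "\<dots> = (\<Prod>j\<in>J. real (card (V \<inter> A j)))"
    using fin by (simp add: Int_def)
  finally show ?thesis .
qed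

lemma tuple_system_card_le:
  assumes T: "tuple_system k V T" and fin: "finite V" and k: "0 < k"
  shows "card T \<le> card V ^ (k - 1)"
proof -
  have "{..<k} - {k - 1} = {..<k - 1}" by auto
  moreover have "inj_on (coords ({..<k} - {k - 1})) T"
    using T k by (simp add: tuple_system_def)
  ultimately have inj: "inj_on (coords {..<k - 1}) T" by simp
  have "real (card T) \<le> (\<Prod>i\<in>{..<k - 1}. real (card (V \<inter> V)))"
    by (rule card_coords_le[OF fin _ inj]) (use T in \<open>auto simp: tuple_system_def subset_iff\<close>)
  then show ?thesis by (simp flip: of_nat_power)
qed

text \<open>The core of both second moment estimates: the sum measures how the edges through
  \<open>v\<close> interact with a bounded set \<open>D\<close>. Either all other vertices lie in
  \<open>D\<close>, or some coordinate costs a factor \<open>q\<close> and the remaining k - 2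
  coordinates, with coordinate \<open>i\<close> fixed, determine the edge. When q (q n)^(k-2) is
  bounded, so is the whole sum for bounded \<open>D\<close>.\<close>

lemma weighted_fixed_coord_le:
  fixes q :: real
  assumes T: "tuple_system k V T" and fin: "finite V" and k: "2 \<le> k" and i: "i < k"
    and D: "finite D" and q: "0 \<le> q" "q \<le> 1"
  shows "(\<Sum>xs\<in>{xs \<in> T. xs ! i = v}. \<Prod>j\<in>{..<k} - {i}. if xs ! j \<in> D then 1 else q)
     \<le> real (card D) ^ (k - 1) + real (k - 1) * q * (card D + q * card V) ^ (k - 2)"
proof -
  define f where "f x = (if x \<in> D then 1 else q)" for x
  define I where "I = {..<k} - {i}"
  define U where "U = {xs \<in> T. xs ! i = v}"
  have finT: "finite T" by (rule tuple_system_finite[OF T fin])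
  have f: "0 \<le> f x" "f x \<le> 1" for x using q by (auto simp: f_def)
  have injT: "inj_on (coords ({..<k} - {j})) U" if "j < k" for j
    using T that by (auto simp: tuple_system_def U_def intro: inj_on_subset)
  have mem: "xs ! j \<in> V" if "xs \<in> U" "j < k" for xs j
    using T that by (force simp: tuple_system_def U_def)
  have cardI: "card I = k - 1" using i by (simp add: I_def)
  have finI: "finite I" by (simp add: I_def)
  have point: "(\<Prod>j\<in>I. f (xs ! j)) \<le> (\<Prod>j\<in>I. of_bool (xs ! j \<in> D)) + (\<Sum>j0\<in>I. q * (\<Prod>j\<in>I - {j0}. f (xs ! j)))" for xs
  proof (cases "\<forall>j\<in>I. xs ! j \<in> D")
    case True
    then show ?thesis by (simp add: f_def sum_nonneg prod_nonneg q)
  next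
    case False
    then obtain j0 where j0: "j0 \<in> I" "xs ! j0 \<notin> D" by blast
    have "(\<Prod>j\<in>I. f (xs ! j)) = q * (\<Prod>j\<in>I - {j0}. f (xs ! j))"
      using j0 finI by (subst prod.remove[of _ j0]) (auto simp: f_def)
    also have "\<dots> \<le> (\<Sum>j0\<in>I. q * (\<Prod>j\<in>I - {j0}. f (xs ! j)))"
      by (rule member_le_sum[OF j0(1)]) (use finI q f in \<open>auto intro!: mult_nonneg_nonneg prod_nonneg\<close>)
    also have "\<dots> \<le> (\<Prod>j\<in>I. of_bool (xs ! j \<in> D)) + (\<Sum>j0\<in>I. q * (\<Prod>j\<in>I - {j0}. f (xs ! j)))"
      by (simp add: prod_nonneg)
    finally show ?thesis .
  qed
  have "(\<Sum>xs\<in>U. \<Prod>j\<in>I. f (xs ! j)) \<le> (\<Sum>xs\<in>U. (\<Prod>j\<in>I. of_bool (xs ! j \<in> D)) + (\<Sum>j0\<in>I. q * (\<Prod>j\<in>I - {j0}. f (xs ! j))))"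
    by (rule sum_mono) (rule point)
  also have "\<dots> = (\<Sum>xs\<in>U. \<Prod>j\<in>I. of_bool (xs ! j \<in> D)) + (\<Sum>j0\<in>I. q * (\<Sum>xs\<in>U. \<Prod>j\<in>I - {j0}. f (xs ! j)))"
    unfolding sum.distrib sum_distrib_left by (subst sum.swap) simp
  also have "\<dots> \<le> real (card D) ^ (k - 1) + (\<Sum>j0\<in>I. q * (card D + q * card V) ^ (k - 2))"
  proof (rule add_mono)
    have "(\<Sum>xs\<in>U. \<Prod>j\<in>I. of_bool (xs ! j \<in> D)) \<le> (\<Prod>j\<in>I. \<Sum>x\<in>V. (of_bool (x \<in> D) :: real))"
      unfolding I_def by (rule sum_prod_coords_le[OF fin _ injT[OF i]]) (use mem in auto)
    also have "\<dots> = real (card (V \<inter> D)) ^ (k - 1)"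
      using fin cardI by (simp add: Int_def)
    also have "\<dots> \<le> real (card D) ^ (k - 1)"
      using D by (intro power_mono of_nat_mono card_mono) auto
    finally show "(\<Sum>xs\<in>U. \<Prod>j\<in>I. of_bool (xs ! j \<in> D)) \<le> real (card D) ^ (k - 1)" .
    show "(\<Sum>j0\<in>I. q * (\<Sum>xs\<in>U. \<Prod>j\<in>I - {j0}. f (xs ! j))) \<le> (\<Sum>j0\<in>I. q * (card D + q * card V) ^ (k - 2))"
    proof (intro sum_mono mult_left_mono q)
      fix j0 assume j0: "j0 \<in> I"
      have "inj_on (coords (I - {j0})) U"
      proof (rule inj_onI)
        fix xs ys assume xy: "xs \<in> U" "ys \<in> U"
          and eq: "coords (I - {j0}) xs = coords (I - {j0}) ys"
        have "coords ({..<k} - {j0}) xs = coords ({..<k} - {j0}) ys"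
        proof
          fix j
          show "coords ({..<k} - {j0}) xs j = coords ({..<k} - {j0}) ys j"
            using fun_cong[OF eq, of j] xy by (cases "j = i") (auto simp: I_def U_def)
        qed
        then show "xs = ys" using injT[of j0] j0 xy by (auto simp: I_def inj_on_def)
      qed
      then have "(\<Sum>xs\<in>U. \<Prod>j\<in>I - {j0}. f (xs ! j)) \<le> (\<Prod>j\<in>I - {j0}. \<Sum>x\<in>V. f x)"
        by (intro sum_prod_coords_le[OF fin]) (use mem f finI in \<open>auto simp: I_def\<close>)
      also have "\<dots> = (\<Sum>x\<in>V. f x) ^ (k - 2)"
        using j0 cardI finI by (simp add: card_Diff_singleton numeral_2_eq_2)
      also have "\<dots> \<le> (card D + q * card V) ^ (k - 2)"
      proof (rule power_mono)
        have "(\<Sum>x\<in>V. f x) \<le> (\<Sum>x\<in>V. of_bool (x \<in> D) + q)"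
          by (rule sum_mono) (use q in \<open>auto simp: f_def\<close>)
        also have "\<dots> = card (V \<inter> D) + q * card V"
          using fin by (simp add: sum.distrib Int_def)
        also have "\<dots> \<le> card D + q * card V"
          using D by (simp add: card_mono)
        finally show "(\<Sum>x\<in>V. f x) \<le> card D + q * card V" .
      qed (simp add: sum_nonneg f)
      finally show "(\<Sum>xs\<in>U. \<Prod>j\<in>I - {j0}. f (xs ! j)) \<le> (card D + q * card V) ^ (k - 2)" .
    qed
  qed
  also have "\<dots> = real (card D) ^ (k - 1) + real (k - 1) * q * (card D + q * card V) ^ (k - 2)"
    by (simp add: cardI)
  finally show ?thesis by (simp only: U_def I_def f_def)
qed

lemma power_card_Un_set:
  fixes p :: "'b :: comm_monoid_mult"
  assumes "finite D" "distinct ys"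
  shows "p ^ card (D \<union> set ys) = p ^ card D * (\<Prod>j<length ys. if ys ! j \<in> D then 1 else p)"
proof -
  have "(\<Prod>j<length ys. if ys ! j \<in> D then 1 else p) = (\<Prod>y\<in>set ys. if y \<in> D then 1 else p)"
    by (rule prod.reindex_bij_betw[OF bij_betw_nth]) (use assms in auto)
  also have "\<dots> = p ^ card (set ys \<inter> - {y. y \<in> D})"
    by (subst prod.If_cases) auto
  also have "set ys \<inter> - {y. y \<in> D} = set ys - D" by blast
  finally show ?thesis
    using card_Un_disjoint[of D "set ys - D"] assms by (simp add: power_add)
qed

section \<open>Partition functions of down-closed families\<close>

definition down_closed :: "'a set set \<Rightarrow> bool" where
  "down_closed F \<longleftrightarrow> (\<forall>R\<in>F. \<forall>Q\<subseteq>R. Q \<in> F)"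

definition partition_fun :: "real \<Rightarrow> 'a set set \<Rightarrow> real" where
  "partition_fun l F = (\<Sum>R\<in>F. l ^ card R)"

text \<open>In a down-closed \<open>F\<close>, the sets containing \<open>v\<close> have total
  weight \<open>l * partition_fun l (link F v)\<close>. Compared with
  \<open>partition_fun l F\<close>, the link thus measures the probability that \<open>v\<close> is
  occupied, divided by \<open>l\<close>.\<close>

definition link :: "'a set set \<Rightarrow> 'a \<Rightarrow> 'a set set" where
  "link F v = {R \<in> F. v \<notin> R \<and> insert v R \<in> F}"

text \<open>Deleting \<open>Q\<close> maps its supersets injectively into \<open>F\<close>. So
  \<open>Q\<close> is occupied with probability at most l^card Q, as under independence.\<close>

lemma partition_fun_superset_le:
  fixes l :: real
  assumes F: "down_closed F" "F \<subseteq> Pow V" "finite V" and l: "0 \<le> l"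
  shows "(\<Sum>R\<in>{R \<in> F. Q \<subseteq> R}. l ^ card R) \<le> l ^ card Q * partition_fun l F"
proof -
  have finF: "finite F" using F by (auto intro: finite_subset)
  have fR: "finite R" if "R \<in> F" for R using F that by (auto intro: finite_subset)
  have "(\<Sum>R\<in>{R \<in> F. Q \<subseteq> R}. l ^ card R) = (\<Sum>R\<in>{R \<in> F. Q \<subseteq> R}. l ^ card Q * l ^ card (R - Q))"
  proof (rule sum.cong[OF refl])
    fix R assume "R \<in> {R \<in> F. Q \<subseteq> R}"
    then have "card R = card Q + card (R - Q)"
      using fR[of R] by (auto simp: card_Diff_subset card_mono finite_subset)
    then show "l ^ card R = l ^ card Q * l ^ card (R - Q)" by (simp add: power_add)
  qed
  also have "\<dots> = l ^ card Q * (\<Sum>R\<in>{R \<in> F. Q \<subseteq> R}. l ^ card (R - Q))"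
    by (rule sum_distrib_left[symmetric])
  also have "(\<Sum>R\<in>{R \<in> F. Q \<subseteq> R}. l ^ card (R - Q)) = (\<Sum>R\<in>(\<lambda>R. R - Q) ` {R \<in> F. Q \<subseteq> R}. l ^ card R)"
    by (subst sum.reindex) (auto simp: inj_on_def)
  also have "l ^ card Q * \<dots> \<le> l ^ card Q * partition_fun l F"
    unfolding partition_fun_def using F(1) finF l
    by (intro mult_left_mono sum_mono2) (auto simp: down_closed_def)
  finally show ?thesis .
qed

lemma sum_superset_insert:
  fixes l :: real
  assumes F: "down_closed F" "F \<subseteq> Pow V" "finite V" and v: "v \<notin> Q"
  shows "(\<Sum>R\<in>{R \<in> F. insert v Q \<subseteq> R}. l ^ card R) = l * (\<Sum>R\<in>{R \<in> link F v. Q \<subseteq> R}. l ^ card R)"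
proof -
  have fR: "finite R" if "R \<in> F" for R using F that by (auto intro: finite_subset)
  have "(\<Sum>R\<in>{R \<in> F. insert v Q \<subseteq> R}. l ^ card R) = (\<Sum>R\<in>{R \<in> link F v. Q \<subseteq> R}. l ^ card (insert v R))"
    by (rule sum.reindex_bij_witness[where i = "insert v" and j = "\<lambda>R. R - {v}"])
      (use F(1) v in \<open>auto simp: link_def down_closed_def insert_absorb\<close>)
  also have "\<dots> = (\<Sum>R\<in>{R \<in> link F v. Q \<subseteq> R}. l * l ^ card R)"
    by (rule sum.cong) (use fR in \<open>auto simp: link_def\<close>)
  finally show ?thesis by (simp only: sum_distrib_left)
qed

text \<open>A new first entry either repeats one of at most \<open>m\<close> old entries at no cost,
  or costs a factor \<open>l\<close>.\<close>

lemma sum_lists_card_le: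
  fixes l :: real
  assumes fin: "finite V" and l: "0 \<le> l"
  shows "(\<Sum>xs\<in>{xs. set xs \<subseteq> V \<and> length xs = m}. l ^ card (set xs)) \<le> (m + l * card V) ^ m"
proof (induction m)
  case 0
  have "{xs. set xs \<subseteq> V \<and> length xs = 0} = {[]}" by auto
  then show ?case by simp
next
  case (Suc m)
  let ?L = "\<lambda>m. {xs. set xs \<subseteq> V \<and> length xs = m}"
  have "(\<Sum>xs\<in>?L (Suc m). l ^ card (set xs)) = (\<Sum>(x, xs)\<in>V \<times> ?L m. l ^ card (set (x # xs)))"
    by (rule sum.reindex_bij_witness[where i = "\<lambda>(x, xs). x # xs" and j = "\<lambda>xs. (hd xs, tl xs)"])
      (auto simp: length_Suc_conv)
  also have "\<dots> = (\<Sum>xs\<in>?L m. \<Sum>x\<in>V. l ^ card (set (x # xs)))"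
    by (subst sum.swap) (simp add: sum.cartesian_product)
  also have "\<dots> \<le> (\<Sum>xs\<in>?L m. (Suc m + l * card V) * l ^ card (set xs))"
  proof (rule sum_mono)
    fix xs assume xs: "xs \<in> ?L m"
    have "(\<Sum>x\<in>V. l ^ card (set (x # xs))) \<le> (\<Sum>x\<in>V. (of_bool (x \<in> set xs) + l) * l ^ card (set xs))"
      by (rule sum_mono) (use l in \<open>auto simp: insert_absorb algebra_simps\<close>)
    also have "\<dots> = (card (V \<inter> set xs) + l * card V) * l ^ card (set xs)"
      using fin by (simp add: sum.distrib Int_def flip: sum_distrib_right)
    also have "\<dots> \<le> (Suc m + l * card V) * l ^ card (set xs)"
    proof (intro mult_right_mono add_right_mono)
      have "card (V \<inter> set xs) \<le> card (set xs)" by (rule card_mono) auto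
      also have "\<dots> \<le> m" using xs card_length[of xs] by simp
      finally show "real (card (V \<inter> set xs)) \<le> real (Suc m)" by simp
    qed (use l in auto)
    finally show "(\<Sum>x\<in>V. l ^ card (set (x # xs))) \<le> (Suc m + l * card V) * l ^ card (set xs)" .
  qed
  also have "\<dots> = (Suc m + l * card V) * (\<Sum>xs\<in>?L m. l ^ card (set xs))"
    by (rule sum_distrib_left[symmetric])
  also have "\<dots> \<le> (Suc m + l * card V) * (m + l * card V) ^ m"
    using Suc.IH l by (intro mult_left_mono) auto
  also have "\<dots> \<le> (Suc m + l * card V) * (Suc m + l * card V) ^ m"
    using l by (intro mult_left_mono power_mono) auto
  finally show ?case by simp
qed

text \<open>(card R)^m counts the lists of length \<open>m\<close> over \<open>R\<close>; exchanging
  the sums leaves, for each list, the weight of the supersets of its entries.\<close>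

lemma partition_fun_moment_le:
  fixes l :: real
  assumes F: "down_closed F" "F \<subseteq> Pow V" "finite V" and l: "0 \<le> l"
  shows "(\<Sum>R\<in>F. l ^ card R * real (card R) ^ m) \<le> (m + l * card V) ^ m * partition_fun l F"
proof -
  let ?L = "{xs. set xs \<subseteq> V \<and> length xs = m}"
  have finF: "finite F" using F by (auto intro: finite_subset)
  have finL: "finite ?L" by (rule finite_lists_length_eq[OF F(3)])
  have "(\<Sum>R\<in>F. l ^ card R * real (card R) ^ m) = (\<Sum>R\<in>F. \<Sum>xs\<in>?L. of_bool (set xs \<subseteq> R) * l ^ card R)"
  proof (rule sum.cong[OF refl])
    fix R assume R: "R \<in> F"
    have "finite R" using R F by (auto intro: finite_subset)
    have "real (card R) ^ m = card {xs. set xs \<subseteq> R \<and> length xs = m}"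
      using card_lists_length_eq[OF \<open>finite R\<close>, of m] by simp
    also have "{xs. set xs \<subseteq> R \<and> length xs = m} = ?L \<inter> {xs. set xs \<subseteq> R}" using R F by auto
    also have "real (card \<dots>) = (\<Sum>xs\<in>?L. of_bool (set xs \<subseteq> R))" using finL by simp
    finally have eq: "real (card R) ^ m = (\<Sum>xs\<in>?L. of_bool (set xs \<subseteq> R))" .
    show "l ^ card R * real (card R) ^ m = (\<Sum>xs\<in>?L. of_bool (set xs \<subseteq> R) * l ^ card R)"
      by (subst sum_distrib_right[symmetric], subst eq, rule mult.commute)
  qed
  also have "\<dots> = (\<Sum>xs\<in>?L. \<Sum>R\<in>F. of_bool (set xs \<subseteq> R) * l ^ card R)" by (rule sum.swap)
  also have "\<dots> = (\<Sum>xs\<in>?L. \<Sum>R\<in>{R \<in> F. set xs \<subseteq> R}. l ^ card R)"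
    by (rule sum.cong[OF refl]) (simp add: Int_def finF)
  also have "\<dots> \<le> (\<Sum>xs\<in>?L. l ^ card (set xs) * partition_fun l F)"
    by (intro sum_mono partition_fun_superset_le[OF F l])
  also have "\<dots> = (\<Sum>xs\<in>?L. l ^ card (set xs)) * partition_fun l F" by (rule sum_distrib_right[symmetric])
  also have "\<dots> \<le> (m + l * card V) ^ m * partition_fun l F"
    using sum_lists_card_le[OF F(3) l, of m] l
    by (intro mult_right_mono) (auto simp: partition_fun_def sum_nonneg)
  finally show ?thesis .
qed

lemma mult_le_weighted_squares:
  fixes x y s :: real
  assumes "0 < s" shows "x * y \<le> s * x\<^sup>2 + y\<^sup>2 / (4 * s)"
proof -
  have "s * x\<^sup>2 + y\<^sup>2 / (4 * s) - x * y = (2 * s * x - y)\<^sup>2 / (4 * s)"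
    using assms by (simp add: power2_eq_square field_simps)
  moreover have "0 \<le> (2 * s * x - y)\<^sup>2 / (4 * s)" using assms by simp
  ultimately show ?thesis by linarith
qed

text \<open>The constants are fitted to the last inequality: with C1 from the moments of
  \<open>card R\<close> and C2 from the second moment of the edge count, a failure would give \<eta>
  \<le> k s (C1 + C2) + k \<epsilon>/(4 s), and the choice of s and \<epsilon> makes each summand
  \<eta>/4.\<close>

lemma exists_low_occupancy:
  fixes \<eta> l s \<epsilon> :: real and k :: nat
  defines "s \<equiv> \<eta> / (4 * real k * ((2 * real k + 1) ^ (2 * k) + 2 * real k ^ k))"
  defines "\<epsilon> \<equiv> \<eta> * s / real k"
  assumes T: "tuple_system k V T" and fin: "finite V" and k: "3 \<le> k" and A: "A \<subseteq> V"
    and l: "0 < l" "l \<le> 1" and n: "1 \<le> l * card V" and ln: "(l * card V) ^ (k - 1) = card V"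
    and F: "down_closed F" "F \<subseteq> Pow A" "{} \<in> F"
    and ind: "\<And>R xs. R \<in> F \<Longrightarrow> xs \<in> T \<Longrightarrow> \<not> set xs \<subseteq> R"
    and eta: "0 < \<eta>" and super: "\<eta> * real (card V) ^ (k - 1) \<le> card {xs \<in> T. set xs \<subseteq> A}"
  shows "\<exists>v\<in>A. partition_fun l (link F v) \<le> (1 - \<epsilon>) * partition_fun l F"
proof (rule ccontr)
  define n where "n = real (card V)"
  define N where "N = l * n"
  define Z where "Z = partition_fun l F"
  define C1 where "C1 = (2 * real k + 1) ^ (2 * k)"
  define C2 where "C2 = 2 * real k ^ k"
  define TA where "TA = {xs \<in> T. set xs \<subseteq> A}"
  \<comment> \<open>For \<open>R\<close> in \<open>F\<close>, a vertex is blocked if it already lies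
    in \<open>R\<close> or cannot be added without leaving \<open>F\<close>.\<close>
  define B where "B R = {v \<in> A. R \<notin> link F v}" for R
  have C: "0 < C1" "0 < C2" using k by (auto simp: C1_def C2_def)
  have s_eq: "s = \<eta> / (4 * real k * (C1 + C2))" by (simp add: s_def C1_def C2_def)
  have s: "0 < s" unfolding s_eq using eta k C by (intro divide_pos_pos mult_pos_pos add_pos_pos) auto
  have N1: "1 \<le> N" using n by (simp add: N_def n_def)
  have n1: "0 < n" using N1 by (cases "n = 0") (auto simp: N_def n_def)
  have NN: "N ^ (k - 1) = n" using ln by (simp add: N_def n_def)
  have finA: "finite A" using A fin by (rule finite_subset)
  have finT: "finite T" by (rule tuple_system_finite[OF T fin])
  have finTA: "finite TA" using finT by (simp add: TA_def)
  have finF: "finite F" using F(2) finA by (auto intro: finite_subset)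
  have FV: "F \<subseteq> Pow V" using F(2) A by auto
  have finR: "finite R" if "R \<in> F" for R using F(2) finA that by (auto intro: finite_subset)
  have TAp: "length xs = k" "distinct xs" "set xs \<subseteq> A" "xs \<in> T" if "xs \<in> TA" for xs
    using that T by (auto simp: TA_def tuple_system_def)
  have TAj: "xs ! j \<in> A" "xs ! j \<in> V" if "xs \<in> TA" "j < k" for xs j
    using TAp[OF that(1)] that(2) A by (auto simp: subset_iff)
  have Z: "0 < Z"
  proof -
    have "l ^ card ({} :: 'a set) \<le> Z"
      unfolding Z_def partition_fun_def by (rule member_le_sum[OF F(3)]) (use l finF in auto)
    then show ?thesis by simp
  qed
  assume "\<not> ?thesis"
  then have high: "(1 - \<epsilon>) * Z < partition_fun l (link F v)" if "v \<in> A" for v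
    using that by (auto simp: Z_def not_le)
  have blocked1: "(\<Sum>R\<in>F. l ^ card R * of_bool (v \<in> B R)) \<le> \<epsilon> * Z" if v: "v \<in> A" for v
  proof -
    have "Z = (\<Sum>R\<in>F. l ^ card R * of_bool (v \<in> B R)) + (\<Sum>R\<in>F. l ^ card R * of_bool (v \<notin> B R))"
      unfolding Z_def partition_fun_def sum.distrib[symmetric] by (rule sum.cong) auto
    moreover have "(\<Sum>R\<in>F. l ^ card R * of_bool (v \<notin> B R)) = partition_fun l (link F v)"
    proof -
      have "F \<inter> {R. v \<notin> B R} = link F v" using v by (auto simp: B_def link_def)
      then show ?thesis unfolding partition_fun_def using finF by simp
    qed
    ultimately show ?thesis using high[OF v] by (simp add: algebra_simps)
  qed
  have BV: "card (B R) \<le> n" for R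
    unfolding n_def by (intro of_nat_mono card_mono fin) (use A in \<open>auto simp: B_def\<close>)
  have finB: "finite (B R)" for R using finA by (simp add: B_def)
  have eps: "0 < \<epsilon>" using eta s k by (simp add: \<epsilon>_def)
  have blocked: "(\<Sum>R\<in>F. l ^ card R * card (B R)) \<le> \<epsilon> * n * Z"
  proof -
    have "(\<Sum>R\<in>F. l ^ card R * card (B R)) = (\<Sum>R\<in>F. \<Sum>v\<in>A. l ^ card R * of_bool (v \<in> B R))"
    proof (rule sum.cong[OF refl])
      fix R
      have "A \<inter> B R = B R" by (auto simp: B_def)
      then show "l ^ card R * card (B R) = (\<Sum>v\<in>A. l ^ card R * of_bool (v \<in> B R))"
        using finA by (simp flip: sum_distrib_left)
    qed
    also have "\<dots> = (\<Sum>v\<in>A. \<Sum>R\<in>F. l ^ card R * of_bool (v \<in> B R))" by (rule sum.swap)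
    also have "\<dots> \<le> (\<Sum>v\<in>A. \<epsilon> * Z)" by (rule sum_mono) (rule blocked1)
    also have "\<dots> = card A * (\<epsilon> * Z)" by simp
    also have "\<dots> \<le> n * (\<epsilon> * Z)"
      unfolding n_def using eps Z A fin by (intro mult_right_mono of_nat_mono card_mono) auto
    finally show ?thesis by (simp add: mult_ac)
  qed
  (* From here on, R is thought of as distributed with weight l ^ card R (unnormalised, total Z);
     B R is the set of vertices blocked by R, small on average by assumption. A first moment
     bound shows that many edges have their first k - 1 vertices in R; their last vertices are
     all blocked, and by a second moment bound there are too many of them. *)
  define \<kappa> where "\<kappa> = s * C1 + \<epsilon> / (4 * s)"
  \<comment> \<open>The weighted arithmetic-geometric inequality separates the two factors. The
    square of card (B R)/n is at most card (B R)/n itself, so the mean number of blocked vertices is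
    all that is used about \<open>B\<close>.\<close>
  have mixed: "(\<Sum>R\<in>F. l ^ card R * (real (card R) ^ j * card (B R))) \<le> N ^ j * n * Z * \<kappa>" if j: "j < k" for j
  proof -
    have pt: "real (card R) ^ j * card (B R) \<le>
        N ^ j * n * (s * (real (card R) ^ (2 * j) / N ^ (2 * j)) + card (B R) / n / (4 * s))" for R
    proof -
      define x where "x = real (card R) ^ j / N ^ j"
      define y where "y = card (B R) / n"
      have y: "0 \<le> y" "y \<le> 1" using BV[of R] n1 by (auto simp: y_def)
      have "x * y \<le> s * x\<^sup>2 + y\<^sup>2 / (4 * s)" by (rule mult_le_weighted_squares[OF s])
      also have "\<dots> \<le> s * x\<^sup>2 + y / (4 * s)"
        using y s by (intro add_left_mono divide_right_mono) (auto simp: power2_eq_square mult_left_le_one_le)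
      finally have "N ^ j * n * (x * y) \<le> N ^ j * n * (s * x\<^sup>2 + y / (4 * s))"
        using N1 n1 by (intro mult_left_mono) auto
      moreover have "N ^ j * n * (x * y) = real (card R) ^ j * card (B R)"
        using N1 n1 by (simp add: x_def y_def)
      moreover have "x\<^sup>2 = real (card R) ^ (2 * j) / N ^ (2 * j)"
        by (simp add: x_def power_divide power_mult mult.commute[of 2] flip: power_mult)
      ultimately show ?thesis by (simp add: y_def)
    qed
    have mom: "(\<Sum>R\<in>F. l ^ card R * real (card R) ^ (2 * j)) \<le> C1 * N ^ (2 * j) * Z"
    proof -
      have "(\<Sum>R\<in>F. l ^ card R * real (card R) ^ (2 * j)) \<le> (real (2 * j) + l * card V) ^ (2 * j) * Z"
        unfolding Z_def by (rule partition_fun_moment_le[OF F(1) FV fin]) (use l in auto)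
      also have "\<dots> \<le> (C1 * N ^ (2 * j)) * Z"
      proof (rule mult_right_mono)
        have "real (2 * j) + N \<le> (2 * k) * N + N"
          using j N1 mult_mono[of "real (2 * j)" "real (2 * k)" 1 N] by simp
        then have "(real (2 * j) + l * card V) ^ (2 * j) \<le> ((2 * real k + 1) * N) ^ (2 * j)"
          using N1 by (intro power_mono) (auto simp: N_def n_def algebra_simps)
        also have "\<dots> = (2 * real k + 1) ^ (2 * j) * N ^ (2 * j)" by (rule power_mult_distrib)
        also have "\<dots> \<le> C1 * N ^ (2 * j)"
          unfolding C1_def using N1 j by (intro mult_right_mono power_increasing) auto
        finally show "(real (2 * j) + l * card V) ^ (2 * j) \<le> C1 * N ^ (2 * j)" .
      qed (use Z in simp)
      finally show ?thesis .
    qed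
    have "(\<Sum>R\<in>F. l ^ card R * (real (card R) ^ j * card (B R))) \<le>
      (\<Sum>R\<in>F. l ^ card R * (N ^ j * n * (s * (real (card R) ^ (2 * j) / N ^ (2 * j)) + card (B R) / n / (4 * s))))"
      using l by (intro sum_mono mult_left_mono pt) auto
    also have "\<dots> = N ^ j * n * (s / N ^ (2 * j) * (\<Sum>R\<in>F. l ^ card R * real (card R) ^ (2 * j))
        + 1 / (n * (4 * s)) * (\<Sum>R\<in>F. l ^ card R * card (B R)))"
      unfolding sum_distrib_left sum.distrib[symmetric]
      by (rule sum.cong) (auto simp: algebra_simps)
    also have "\<dots> \<le> N ^ j * n * (s / N ^ (2 * j) * (C1 * N ^ (2 * j) * Z) + 1 / (n * (4 * s)) * (\<epsilon> * n * Z))"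
      using N1 n1 s mom blocked by (intro mult_left_mono add_mono) auto
    also have "\<dots> = N ^ j * n * Z * \<kappa>"
      using N1 n1 s by (simp add: \<kappa>_def field_simps)
    finally show ?thesis .
  qed
  define a where "a j xs = (\<Sum>R\<in>{R \<in> F. set (take j xs) \<subseteq> R}. l ^ card R)" for j xs
  define X where "X j R = card {xs \<in> TA. set (take j xs) \<subseteq> R \<and> xs ! j \<in> B R}" for j R
  let ?D = "\<lambda>j xs. \<Sum>R\<in>F. l ^ card R * of_bool (set (take j xs) \<subseteq> R \<and> xs ! j \<in> B R)"
  \<comment> \<open>Occupying one more vertex of the edge costs a factor \<open>l\<close> and loses
    exactly the sets \<open>R\<close> by which that vertex is blocked.\<close>
  have a_Suc: "a (Suc j) xs = l * (a j xs - ?D j xs)"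
    if xs: "xs \<in> TA" and j: "j < k" for j xs
  proof -
    have st: "set (take (Suc j) xs) = insert (xs ! j) (set (take j xs))"
      using TAp[OF xs] j by (simp add: take_Suc_conv_app_nth)
    have nin: "xs ! j \<notin> set (take j xs)"
      using TAp[OF xs] j by (auto simp: in_set_conv_nth nth_eq_iff_index_eq)
    have "a (Suc j) xs = l * (\<Sum>R\<in>{R \<in> link F (xs ! j). set (take j xs) \<subseteq> R}. l ^ card R)"
      unfolding a_def st by (rule sum_superset_insert[OF F(1) FV fin nin])
    also have "{R \<in> link F (xs ! j). set (take j xs) \<subseteq> R} = {R \<in> F. set (take j xs) \<subseteq> R \<and> xs ! j \<notin> B R}"
      using TAj[OF xs j] by (auto simp: B_def link_def)
    also have "(\<Sum>R\<in>\<dots>. l ^ card R) = a j xs - ?D j xs"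
    proof -
      have "a j xs = (\<Sum>R\<in>F. l ^ card R * of_bool (set (take j xs) \<subseteq> R))"
        unfolding a_def using finF by (simp add: Int_def)
      also have "\<dots> = (\<Sum>R\<in>F. l ^ card R * of_bool (set (take j xs) \<subseteq> R \<and> xs ! j \<notin> B R))
          + ?D j xs"
        unfolding sum.distrib[symmetric] by (rule sum.cong) auto
      also have "(\<Sum>R\<in>F. l ^ card R * of_bool (set (take j xs) \<subseteq> R \<and> xs ! j \<notin> B R))
          = (\<Sum>R\<in>{R \<in> F. set (take j xs) \<subseteq> R \<and> xs ! j \<notin> B R}. l ^ card R)"
        using finF by (simp add: Int_def)
      finally show ?thesis by simp
    qed
    finally show ?thesis .
  qed
  \<comment> \<open>The last coordinate is determined by the others: \<open>j\<close> of them lie in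
    \<open>R\<close>, one is blocked, and k - 2 - j are free.\<close>
  have X_le: "X j R \<le> real (card R) ^ j * card (B R) * n ^ (k - 2 - j)" if j: "j < k - 1" and R: "R \<in> F" for j R
  proof -
    define A' where "A' i = (if i < j then R else if i = j then B R else V)" for i
    define U where "U = {xs \<in> TA. set (take j xs) \<subseteq> R \<and> xs ! j \<in> B R}"
    have "{..<k} - {k - 1} = {..<k - 1}" by auto
    moreover have "inj_on (coords ({..<k} - {k - 1})) T"
      using T k by (simp add: tuple_system_def)
    ultimately have inj: "inj_on (coords {..<k - 1}) U"
      by (auto simp: U_def TA_def intro: inj_on_subset)
    have "xs ! i \<in> A' i" if "xs \<in> U" "i \<in> {..<k - 1}" for xs i
    proof -
      have "xs ! i \<in> set (take j xs)" if "i < j"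
        using that \<open>xs \<in> U\<close> TAp[of xs] j by (auto simp: U_def in_set_conv_nth intro!: exI[of _ i])
      then show ?thesis using that TAj[of xs i] by (auto simp: A'_def U_def)
    qed
    then have "real (card U) \<le> (\<Prod>i\<in>{..<k - 1}. real (card (V \<inter> A' i)))"
      using TAj by (intro card_coords_le[OF fin _ inj]) (auto simp: U_def)
    also have "\<dots> = (\<Prod>i\<in>{..<j} \<union> ({j} \<union> {Suc j..<k - 1}). real (card (V \<inter> A' i)))"
      by (rule prod.cong) (use j in auto)
    also have "\<dots> = (\<Prod>i<j. real (card (V \<inter> A' i))) * (real (card (V \<inter> A' j)) * (\<Prod>i=Suc j..<k - 1. real (card (V \<inter> A' i))))"
      by (subst prod.union_disjoint; (subst prod.union_disjoint)?) auto
    also have "(\<Prod>i<j. real (card (V \<inter> A' i))) = real (card R) ^ j"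
    proof -
      have "V \<inter> R = R" using R FV by auto
      then show ?thesis by (simp add: A'_def)
    qed
    also have "V \<inter> A' j = B R" using A by (auto simp: A'_def B_def)
    also have "(\<Prod>i=Suc j..<k - 1. real (card (V \<inter> A' i))) = n ^ (k - 2 - j)"
      by (simp add: A'_def n_def numeral_2_eq_2)
    finally show ?thesis unfolding X_def U_def by (simp add: mult_ac)
  qed
  define e where "e j = (\<Sum>xs\<in>TA. a j xs)" for j
  have e_Suc: "l * e j - l * (N ^ j * n ^ (k - 1 - j) * Z * \<kappa>) \<le> e (Suc j)" if j: "j < k - 1" for j
  proof -
    have jk: "j < k" using j by simp
    have "e (Suc j) = (\<Sum>xs\<in>TA. l * (a j xs - ?D j xs))"
      unfolding e_def by (intro sum.cong refl a_Suc jk)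
    also have "\<dots> = l * e j - l * (\<Sum>xs\<in>TA. ?D j xs)"
      unfolding e_def by (simp only: sum_subtractf right_diff_distrib flip: sum_distrib_left)
    also have "(\<Sum>xs\<in>TA. ?D j xs)
        = (\<Sum>R\<in>F. l ^ card R * X j R)"
      using finTA by (subst sum.swap) (simp add: X_def Int_def flip: sum_distrib_left)
    finally have "e (Suc j) = l * e j - l * (\<Sum>R\<in>F. l ^ card R * X j R)" .
    moreover have "(\<Sum>R\<in>F. l ^ card R * X j R) \<le> N ^ j * n ^ (k - 1 - j) * Z * \<kappa>"
    proof -
      have "(\<Sum>R\<in>F. l ^ card R * X j R) \<le> (\<Sum>R\<in>F. l ^ card R * (real (card R) ^ j * card (B R) * n ^ (k - 2 - j)))"
        using l by (intro sum_mono mult_left_mono X_le j) auto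
      also have "\<dots> = (\<Sum>R\<in>F. l ^ card R * (real (card R) ^ j * card (B R))) * n ^ (k - 2 - j)"
        by (simp only: sum_distrib_right mult.assoc)
      also have "\<dots> \<le> N ^ j * n * Z * \<kappa> * n ^ (k - 2 - j)"
        using n1 by (intro mult_right_mono mixed jk) auto
      also have "\<dots> = N ^ j * (n * n ^ (k - 2 - j)) * Z * \<kappa>" by (simp add: mult_ac)
      also have "n * n ^ (k - 2 - j) = n ^ (k - 1 - j)"
      proof -
        have "k - 1 - j = Suc (k - 2 - j)" using j by simp
        then show ?thesis by simp
      qed
      finally show ?thesis .
    qed
    then have "l * (\<Sum>R\<in>F. l ^ card R * X j R) \<le> l * (N ^ j * n ^ (k - 1 - j) * Z * \<kappa>)"
      using l by (intro mult_left_mono) auto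
    ultimately show ?thesis by linarith
  qed
  have e_ge: "l ^ j * n ^ (k - 1) * Z * (\<eta> - j * \<kappa>) \<le> e j" if "j \<le> k - 1" for j
    using that
  proof (induction j)
    case 0
    have "a 0 xs = Z" for xs by (simp add: a_def Z_def partition_fun_def)
    then have "e 0 = card TA * Z" by (simp add: e_def)
    moreover have "\<eta> * n ^ (k - 1) * Z \<le> card TA * Z"
      using super Z by (intro mult_right_mono) (auto simp: TA_def n_def)
    ultimately show ?case by (simp add: mult_ac)
  next
    case (Suc j)
    then have "l * (l ^ j * n ^ (k - 1) * Z * (\<eta> - j * \<kappa>)) \<le> l * e j"
      using l by (intro mult_left_mono) auto
    moreover have "N ^ j * n ^ (k - 1 - j) = l ^ j * n ^ (k - 1)"
    proof -
      have "n ^ (k - 1) = n ^ j * n ^ (k - 1 - j)" using Suc.prems by (simp flip: power_add)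
      then show ?thesis by (simp add: N_def power_mult_distrib)
    qed
    ultimately have "l * (l ^ j * n ^ (k - 1) * Z * (\<eta> - j * \<kappa>)) - l * (l ^ j * n ^ (k - 1) * Z * \<kappa>) \<le> e (Suc j)"
      using e_Suc[of j] Suc.prems by simp
    then show ?case by (simp add: algebra_simps)
  qed
  \<comment> \<open>Here the fugacity enters: l^(k-1) n^(k-1) = N^(k-1) = n.\<close>
  have low: "n * Z * (\<eta> - (k - 1) * \<kappa>) \<le> e (k - 1)"
    using e_ge[of "k - 1"] NN by (simp add: N_def power_mult_distrib)
  let ?Q = "\<lambda>xs. set (take (k - 1) xs)"
  let ?TA = "\<lambda>v. {xs \<in> TA. xs ! (k - 1) = v}"
  let ?B = "\<lambda>xs ys. \<Sum>R\<in>F. l ^ card R * of_bool (?Q xs \<union> ?Q ys \<subseteq> R)"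
  let ?w = "\<lambda>D ys. \<Prod>j\<in>{..<k} - {k - 1}. if ys ! j \<in> D then 1 else l"
  define Y where "Y v R = card {xs \<in> TA. xs ! (k - 1) = v \<and> ?Q xs \<subseteq> R}" for v R
  have upper: "e (k - 1) \<le> s * (C2 * n * Z) + \<epsilon> * n * Z / (4 * s)"
  proof -
    have "e (k - 1) = (\<Sum>xs\<in>TA. \<Sum>R\<in>F. l ^ card R * of_bool (?Q xs \<subseteq> R))"
      unfolding e_def a_def by (rule sum.cong[OF refl]) (simp add: Int_def finF)
    also have "\<dots> = (\<Sum>R\<in>F. \<Sum>xs\<in>TA. l ^ card R * of_bool (?Q xs \<subseteq> R))" by (rule sum.swap)
    also have "\<dots> = (\<Sum>R\<in>F. l ^ card R * (\<Sum>v\<in>A. real (Y v R)))"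
    proof (rule sum.cong[OF refl])
      fix R
      have "(\<Sum>xs\<in>TA. of_bool (?Q xs \<subseteq> R)) =
          (\<Sum>v\<in>A. \<Sum>xs\<in>?TA v. (of_bool (?Q xs \<subseteq> R) :: real))"
        by (rule sum.group[symmetric]) (use finTA finA TAj k in auto)
      also have "\<dots> = (\<Sum>v\<in>A. real (Y v R))"
        by (rule sum.cong[OF refl]) (simp add: Y_def Int_def conj_ac finTA)
      finally show "(\<Sum>xs\<in>TA. l ^ card R * of_bool (?Q xs \<subseteq> R)) = l ^ card R * (\<Sum>v\<in>A. real (Y v R))"
        by (simp flip: sum_distrib_left)
    qed
    also have "\<dots> \<le> (\<Sum>R\<in>F. l ^ card R * (\<Sum>v\<in>A. s * (real (Y v R))\<^sup>2 + of_bool (v \<in> B R) / (4 * s)))"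
    proof (intro sum_mono mult_left_mono)
      fix R v assume R: "R \<in> F" and v: "v \<in> A"
      show "real (Y v R) \<le> s * (real (Y v R))\<^sup>2 + of_bool (v \<in> B R) / (4 * s)"
      proof (cases "v \<in> B R")
        case True
        then show ?thesis using mult_le_weighted_squares[OF s, of "real (Y v R)" 1] by simp
      next
        case False
        \<comment> \<open>Otherwise the edge would lie in \<open>insert v R\<close>, which belongs
          to \<open>F\<close> because \<open>v\<close> is not blocked, contrary to independence.
          Hence \<open>Y v R\<close> is supported on blocked vertices.\<close>
        have "{xs \<in> TA. xs ! (k - 1) = v \<and> ?Q xs \<subseteq> R} = {}"
        proof (rule ccontr)
          assume "\<not> ?thesis"
          then obtain xs where xs: "xs \<in> TA" "xs ! (k - 1) = v" "?Q xs \<subseteq> R" by blast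
          have "xs = take (k - 1) xs @ [xs ! (k - 1)]"
            using TAp(1)[OF xs(1)] k take_Suc_conv_app_nth[of "k - 1" xs] by simp
          then have "set xs = insert v (?Q xs)"
            using xs(2) by (metis list.simps(15) rotate1.simps(2) set_rotate1)
          then have "set xs \<subseteq> insert v R" using xs(3) by auto
          moreover have "insert v R \<in> F" using False v by (auto simp: B_def link_def)
          ultimately show False using ind TAp(4)[OF xs(1)] by blast
        qed
        then have "Y v R = 0" unfolding Y_def by (simp only: card.empty)
        then show ?thesis using s by simp
      qed
    qed (use l in auto)
    also have "\<dots> = s * (\<Sum>R\<in>F. l ^ card R * (\<Sum>v\<in>A. (real (Y v R))\<^sup>2)) + (\<Sum>R\<in>F. l ^ card R * card (B R)) / (4 * s)"
    proof -
      have "(\<Sum>v\<in>A. s * (real (Y v R))\<^sup>2 + of_bool (v \<in> B R) / (4 * s)) = s * (\<Sum>v\<in>A. (real (Y v R))\<^sup>2) + card (B R) / (4 * s)" for R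
      proof -
        have "A \<inter> B R = B R" by (auto simp: B_def)
        then have "(\<Sum>v\<in>A. of_bool (v \<in> B R)) = real (card (B R))" using finA by simp
        then show ?thesis by (simp only: sum.distrib flip: sum_distrib_left sum_divide_distrib)
      qed
      then show ?thesis
        by (simp only: distrib_left sum.distrib sum_distrib_left sum_divide_distrib mult_ac times_divide_eq_right)
    qed
    also have "\<dots> \<le> s * (C2 * n * Z) + \<epsilon> * n * Z / (4 * s)"
    proof (intro add_mono mult_left_mono divide_right_mono blocked)
      \<comment> \<open>The square counts ordered pairs of edges with the common last vertex
        \<open>v\<close>. Their joint weight is l^(k-1) times the product bounded by
        \<open>weighted_fixed_coord_le\<close>.\<close>
      have sq: "(real (Y v R))\<^sup>2 = (\<Sum>xs\<in>?TA v. \<Sum>ys\<in>?TA v.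
          of_bool (?Q xs \<union> ?Q ys \<subseteq> R))" for v R
      proof -
        have "real (Y v R) = (\<Sum>xs\<in>?TA v. of_bool (?Q xs \<subseteq> R))"
          using finTA by (simp add: Y_def Int_def conj_ac)
        then show ?thesis
          by (simp add: power2_eq_square sum_product flip: of_bool_conj)
      qed
      have "(\<Sum>R\<in>F. l ^ card R * (\<Sum>v\<in>A. (real (Y v R))\<^sup>2)) =
          (\<Sum>v\<in>A. \<Sum>xs\<in>?TA v. \<Sum>ys\<in>?TA v.
            ?B xs ys)"
        unfolding sq sum_distrib_left
        by (subst sum.swap, rule sum.cong[OF refl], subst sum.swap, rule sum.cong[OF refl], rule sum.swap)
      also have "\<dots> \<le> (\<Sum>v\<in>A. \<Sum>xs\<in>?TA v. C2 * l ^ (k - 1) * Z)"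
      proof (intro sum_mono)
        fix v xs assume xs: "xs \<in> ?TA v"
        define D where "D = ?Q xs"
        have cardD: "card D = k - 1" using TAp[of xs] xs by (simp add: D_def distinct_card)
        have "(\<Sum>ys\<in>?TA v. ?B xs ys)
          \<le> (\<Sum>ys\<in>?TA v. l ^ (k - 1) * Z * ?w D ys)"
        proof (rule sum_mono)
          fix ys assume ys: "ys \<in> ?TA v"
          define D' where "D' = ?Q ys"
          have "(\<Sum>R\<in>F. l ^ card R * of_bool (D \<union> D' \<subseteq> R)) = (\<Sum>R\<in>{R \<in> F. D \<union> D' \<subseteq> R}. l ^ card R)"
            using finF by (simp add: Int_def)
          also have "\<dots> \<le> l ^ card (D \<union> D') * Z"
            unfolding Z_def by (rule partition_fun_superset_le[OF F(1) FV fin]) (use l in auto)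
          also have "l ^ card (D \<union> D') = l ^ (k - 1) * ?w D ys"
          proof -
            have len: "length ys = k" "distinct ys" using TAp[of ys] ys by auto
            moreover have "{..<k} - {k - 1} = {..<k - 1}" by auto
            ultimately show ?thesis
              using power_card_Un_set[of D "take (k - 1) ys" l]
              by (simp add: cardD D'_def) (simp add: D_def)
          qed
          finally show "?B xs ys
            \<le> l ^ (k - 1) * Z * ?w D ys"
            by (simp only: D_def D'_def mult_ac)
        qed
        also have "\<dots> \<le> (\<Sum>ys\<in>{ys \<in> T. ys ! (k - 1) = v}. l ^ (k - 1) * Z * ?w D ys)"
        proof (rule sum_mono2)
          show "0 \<le> l ^ (k - 1) * Z * ?w D ys" for ys
            by (intro mult_nonneg_nonneg prod_nonneg) (use l Z in auto)
        qed (use finT in \<open>auto simp: TA_def\<close>)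
        also have "\<dots> = l ^ (k - 1) * Z * (\<Sum>ys\<in>{ys \<in> T. ys ! (k - 1) = v}. ?w D ys)"
          by (rule sum_distrib_left[symmetric])
        also have "\<dots> \<le> l ^ (k - 1) * Z * C2"
        proof (rule mult_left_mono)
          have "(\<Sum>ys\<in>{ys \<in> T. ys ! (k - 1) = v}. ?w D ys)
            \<le> real (card D) ^ (k - 1) + real (k - 1) * l * (card D + l * card V) ^ (k - 2)"
            by (rule weighted_fixed_coord_le[OF T fin]) (use k l in \<open>auto simp: D_def\<close>)
          also have "\<dots> \<le> real k ^ k + real k * l * (k * N) ^ (k - 2)"
          proof (intro add_mono mult_mono power_mono)
            have "real (card D) ^ (k - 1) \<le> real k ^ (k - 1)" by (intro power_mono) (auto simp: cardD)
            also have "\<dots> \<le> real k ^ k" using k by (intro power_increasing) auto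
            finally show "real (card D) ^ (k - 1) \<le> real k ^ k" .
            have "real (k - 1) * 1 \<le> real (k - 1) * N" using N1 by (intro mult_left_mono) auto
            then show "card D + l * card V \<le> k * N"
              using k by (simp add: cardD N_def n_def algebra_simps of_nat_diff)
          qed (use l N1 in auto)
          also have "real k * l * (k * N) ^ (k - 2) = real k * real k ^ (k - 2) * (l * N ^ (k - 2))"
            by (simp add: power_mult_distrib)
          also have "l * N ^ (k - 2) = 1"
          proof -
            have "k - 1 = Suc (k - 2)" using k by simp
            then have "N * N ^ (k - 2) = n" using NN by simp
            then have "n * (l * N ^ (k - 2)) = n * 1" by (simp add: N_def mult_ac)
            then show ?thesis using n1 by simp
          qed
          also have "real k * real k ^ (k - 2) = real k ^ (k - 1)"
          proof -
            have "k - 1 = Suc (k - 2)" using k by simp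
            then show ?thesis by simp
          qed
          also have "real k ^ k + real k ^ (k - 1) * 1 \<le> C2"
            using power_increasing[of "k - 1" k "real k"] k by (simp add: C2_def)
          finally show "(\<Sum>ys\<in>{ys \<in> T. ys ! (k - 1) = v}. ?w D ys) \<le> C2" by simp
        qed (use l Z in auto)
        finally show "(\<Sum>ys\<in>?TA v. ?B xs ys)
            \<le> C2 * l ^ (k - 1) * Z" by (simp add: mult_ac)
      qed
      also have "\<dots> = (\<Sum>xs\<in>TA. C2 * l ^ (k - 1) * Z)"
        by (rule sum.group) (use finTA finA TAj k in auto)
      also have "\<dots> = card TA * (C2 * l ^ (k - 1) * Z)" by simp
      also have "\<dots> \<le> n ^ (k - 1) * (C2 * l ^ (k - 1) * Z)"
      proof (rule mult_right_mono)
        have "card TA \<le> card T" by (rule card_mono[OF finT]) (auto simp: TA_def)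
        also have "\<dots> \<le> card V ^ (k - 1)" by (rule tuple_system_card_le[OF T fin]) (use k in simp)
        finally have "real (card TA) \<le> real (card V ^ (k - 1))" by (rule of_nat_mono)
        then show "real (card TA) \<le> n ^ (k - 1)" by (simp add: n_def)
      qed (use C l Z in auto)
      also have "\<dots> = C2 * (N ^ (k - 1)) * Z" by (simp add: N_def power_mult_distrib)
      finally show "(\<Sum>R\<in>F. l ^ card R * (\<Sum>v\<in>A. (real (Y v R))\<^sup>2)) \<le> C2 * n * Z" by (simp only: NN)
    qed (use s in auto)
    finally show ?thesis .
  qed
  have "(n * Z) * (\<eta> - (k - 1) * \<kappa>) \<le> (n * Z) * (s * C2 + \<epsilon> / (4 * s))"
    using low upper by (simp add: algebra_simps)
  then have "\<eta> - (k - 1) * \<kappa> \<le> s * C2 + \<epsilon> / (4 * s)"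
    using n1 Z by (simp only: mult_le_cancel_left_pos mult_pos_pos)
  moreover have q: "\<epsilon> / (4 * s) = \<eta> / (4 * k)" using s k by (simp add: \<epsilon>_def field_simps)
  moreover have "real (k - 1) * \<kappa> = real (k - 1) * (s * C1) + real (k - 1) * (\<eta> / (4 * k))"
    by (simp only: \<kappa>_def q distrib_left)
  ultimately have "\<eta> \<le> real (k - 1) * (s * C1) + s * C2 + (real (k - 1) * (\<eta> / (4 * k)) + 1 * (\<eta> / (4 * k)))"
    by linarith
  then have "\<eta> \<le> real (k - 1) * (s * C1) + s * C2 + (real (k - 1) + 1) * (\<eta> / (4 * k))"
    by (simp only: distrib_right)
  also have "\<dots> \<le> real k * (s * C1) + real k * (s * C2) + real k * (\<eta> / (4 * k))"
  proof (intro add_mono mult_right_mono)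
    have "1 * (s * C2) \<le> real k * (s * C2)" using k s C by (intro mult_right_mono) auto
    then show "s * C2 \<le> real k * (s * C2)" by simp
  qed (use s C eta k in auto)
  also have "\<dots> = s * (4 * real k * (C1 + C2)) / 4 + \<eta> / 4"
    using k by (simp add: field_simps)
  also have "s * (4 * real k * (C1 + C2)) = \<eta>"
    using k C by (simp add: s_eq)
  finally show False using eta by simp
qed

section \<open>Few free choices and a small container\<close>

lemma down_closed_delete: "down_closed F \<Longrightarrow> down_closed {R \<in> F. v \<notin> R}"
  unfolding down_closed_def by blast

lemma down_closed_link: "down_closed F \<Longrightarrow> down_closed (link F v)"
  unfolding down_closed_def link_def by (simp add: subset_iff) (metis insert_iff subset_iff)

lemma partition_fun_ge_1:
  assumes "finite F" "{} \<in> F" "0 \<le> l"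
  shows "1 \<le> partition_fun l F"
  using member_le_sum[of "{}" F "\<lambda>R. l ^ card R"] assms by (simp add: partition_fun_def)

text \<open>Branch on the vertex \<open>v\<close> provided by \<open>step\<close>: the sets containing \<open>v\<close> use up one of
  the \<open>L\<close> free choices, since passing to the link shrinks the partition function by \<open>1 - \<epsilon>\<close>.\<close>
lemma card_family_le:
  fixes l \<epsilon> :: real
  assumes eps: "\<epsilon> \<le> 1" and l: "0 < l" and "finite A" "down_closed F" "F \<subseteq> Pow A"
    and step: "\<And>A' F'. A' \<subseteq> A \<Longrightarrow> b < card A' \<Longrightarrow> down_closed F' \<Longrightarrow> F' \<subseteq> Pow A' \<Longrightarrow> {} \<in> F' \<Longrightarrow> F' \<subseteq> F \<Longrightarrow>
      \<exists>v\<in>A'. partition_fun l (link F' v) \<le> (1 - \<epsilon>) * partition_fun l F'"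
    and "(1 - \<epsilon>) ^ Suc L * partition_fun l F < 1"
  shows "card {R \<in> F. card R = m} \<le> (\<Sum>j\<le>min L m. (card A choose j) * (b choose (m - j)))"
proof -
  have base: "card {R \<in> F. card R = m} \<le> (\<Sum>j\<le>min L m. (card A choose j) * (b choose (m - j)))"
    if "finite A" "F \<subseteq> Pow A" "card A \<le> b" for A :: "'a set" and F L m
  proof -
    have "card {R \<in> F. card R = m} \<le> card {R. R \<subseteq> A \<and> card R = m}"
      by (rule card_mono) (use that in auto)
    also have "\<dots> = card A choose m" by (rule n_subsets[OF that(1)])
    also have "\<dots> \<le> b choose m" by (rule binomial_right_mono[OF that(3)])
    also have "\<dots> = (\<Sum>j\<in>{0}. (card A choose j) * (b choose (m - j)))" by simp
    also have "\<dots> \<le> (\<Sum>j\<le>min L m. (card A choose j) * (b choose (m - j)))"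
      by (rule sum_mono2) auto
    finally show ?thesis .
  qed
  show ?thesis
    using assms(3-)
  proof (induction "card A" arbitrary: A F L m)
    case (0 A F L m)
    then show ?case by (intro base) auto
  next
    case (Suc a A F L m)
    have finF: "finite F" using Suc.prems by (auto intro: finite_subset)
    consider "card A \<le> b" | "F = {}" | "b < card A" "F \<noteq> {}" by linarith
    then show ?case
    proof cases
      case 1
      then show ?thesis using Suc.prems by (intro base) auto
    next
      case 2
      then show ?thesis by simp
    next
      case 3
      have "{} \<in> F" using Suc.prems(2) 3(2) by (auto simp: down_closed_def)
      then obtain v where v: "v \<in> A" and low: "partition_fun l (link F v) \<le> (1 - \<epsilon>) * partition_fun l F"
        using Suc.prems(4)[OF order_refl 3(1) Suc.prems(2,3)] by auto
      define A' where "A' = A - {v}"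
      define F1 where "F1 = {R \<in> F. v \<notin> R}"
      define F2 where "F2 = link F v"
      have A': "a = card A'" "finite A'" "A' \<subseteq> A" using Suc.prems(1) Suc.hyps(2) v by (auto simp: A'_def)
      have step': "\<exists>w\<in>A''. partition_fun l (link F' w) \<le> (1 - \<epsilon>) * partition_fun l F'"
        if "A'' \<subseteq> A'" "b < card A''" "down_closed F'" "F' \<subseteq> Pow A''" "{} \<in> F'" "F' \<subseteq> F" for A'' F'
        using Suc.prems(4)[of A'' F'] that A' by blast
      have sub: "F1 \<subseteq> F" "F2 \<subseteq> F" "F1 \<subseteq> Pow A'" "F2 \<subseteq> Pow A'"
        using Suc.prems(3) by (auto simp: F1_def F2_def A'_def link_def)
      have dc: "down_closed F1" "down_closed F2"
        using Suc.prems(2) by (auto simp: F1_def F2_def intro: down_closed_delete down_closed_link)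
      have fin12: "finite F1" "finite F2" using sub finF by (auto intro: finite_subset)
      have "partition_fun l F1 \<le> partition_fun l F"
        unfolding partition_fun_def using sub finF l by (intro sum_mono2) auto
      then have "(1 - \<epsilon>) ^ Suc L * partition_fun l F1 \<le> (1 - \<epsilon>) ^ Suc L * partition_fun l F"
        using eps by (intro mult_left_mono) auto
      then have w1: "(1 - \<epsilon>) ^ Suc L * partition_fun l F1 < 1" using Suc.prems(5) by linarith
      \<comment> \<open>Sets avoiding \<open>v\<close> keep the whole budget \<open>L\<close>:
        deleting \<open>v\<close> from the available vertices can only lower the partition
        function.\<close>
      have c1: "card {R \<in> F1. card R = m} \<le> (\<Sum>j\<le>min L m. (card A' choose j) * (b choose (m - j)))"
        by (rule Suc.hyps(1)[OF A'(1,2) dc(1) sub(3) _ w1]) (rule step'; (assumption | erule subset_trans[OF _ sub(1)]))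
      have split: "card {R \<in> F. card R = Suc m'} \<le> card {R \<in> F1. card R = Suc m'} + card {R \<in> F2. card R = m'}" for m'
      proof -
        have "{R \<in> F. card R = Suc m'} \<subseteq> {R \<in> F1. card R = Suc m'} \<union> insert v ` {R \<in> F2. card R = m'}"
        proof
          fix R assume R: "R \<in> {R \<in> F. card R = Suc m'}"
          have fR: "finite R" using R Suc.prems(1,3) by (auto intro: finite_subset)
          show "R \<in> {R \<in> F1. card R = Suc m'} \<union> insert v ` {R \<in> F2. card R = m'}"
          proof (cases "v \<in> R")
            case True
            then have "R = insert v (R - {v})" by auto
            moreover have "R - {v} \<in> F2"
              using True R Suc.prems(2) by (auto simp: F2_def link_def down_closed_def insert_absorb)
            moreover have "card (R - {v}) = m'" using True R fR by simp
            ultimately show ?thesis by blast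
          qed (use R in \<open>simp add: F1_def\<close>)
        qed
        then have "card {R \<in> F. card R = Suc m'} \<le> card ({R \<in> F1. card R = Suc m'} \<union> insert v ` {R \<in> F2. card R = m'})"
          by (rule card_mono[rotated]) (use fin12 in simp)
        also have "\<dots> \<le> card {R \<in> F1. card R = Suc m'} + card (insert v ` {R \<in> F2. card R = m'})"
          by (rule card_Un_le)
        also have "\<dots> \<le> card {R \<in> F1. card R = Suc m'} + card {R \<in> F2. card R = m'}"
          using fin12 by (intro add_left_mono card_image_le) simp
        finally show ?thesis .
      qed
      show ?thesis
      proof (cases m)
        case 0
        have "{R \<in> F. card R = 0} \<subseteq> {{}}"
        proof
          fix R assume "R \<in> {R \<in> F. card R = 0}"
          then show "R \<in> {{}}" using Suc.prems(1,3) finite_subset[of R A] by auto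
        qed
        then have "card {R \<in> F. card R = 0} \<le> card {{} :: 'a set}" by (rule card_mono[rotated]) simp
        then show ?thesis using 0 by simp
      next
        case (Suc m')
        show ?thesis
        proof (cases L)
          case 0
          \<comment> \<open>The budget is exhausted: the link would have partition function below 1,
            while a nonempty down-closed family contains the empty set and has at least 1.\<close>
          have "F2 = {}"
          proof (rule ccontr)
            assume "F2 \<noteq> {}"
            then have "{} \<in> F2" using dc(2) by (auto simp: down_closed_def)
            then have "1 \<le> partition_fun l F2" using fin12 l by (intro partition_fun_ge_1) auto
            then show False using low Suc.prems(5) 0 by (simp add: F2_def)
          qed
          then show ?thesis using split[of m'] c1 0 Suc by simp
        next
          case L: (Suc L')
          have "(1 - \<epsilon>) ^ Suc L' * partition_fun l F2 \<le> (1 - \<epsilon>) ^ Suc L' * ((1 - \<epsilon>) * partition_fun l F)"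
            using eps low unfolding F2_def by (intro mult_left_mono) auto
          also have "\<dots> = (1 - \<epsilon>) ^ Suc L * partition_fun l F" by (simp add: L mult_ac)
          also have "\<dots> < 1" by (rule Suc.prems(5))
          finally have w2: "(1 - \<epsilon>) ^ Suc L' * partition_fun l F2 < 1" .
          have c2: "card {R \<in> F2. card R = m'} \<le> (\<Sum>j\<le>min L' m'. (card A' choose j) * (b choose (m' - j)))"
            by (rule Suc.hyps(1)[OF A'(1,2) dc(2) sub(4) _ w2]) (rule step'; (assumption | erule subset_trans[OF _ sub(2)]))
          have "card A = Suc (card A')" using Suc.hyps(2) A'(1) by simp
          \<comment> \<open>Pascal's rule in \<open>card A\<close>. A set through \<open>v\<close>
            uses up one free choice and one element, so \<open>L\<close> and \<open>m\<close> shift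
            together.\<close>
          then have "(\<Sum>j\<le>min L m. (card A choose j) * (b choose (m - j))) =
              (\<Sum>j\<le>min L m. (card A' choose j) * (b choose (m - j))) + (\<Sum>j\<le>min L' m'. (card A' choose j) * (b choose (m' - j)))"
            unfolding L Suc min_Suc_Suc sum.atMost_Suc_shift by (simp add: sum.distrib algebra_simps)
          then show ?thesis using split[of m'] c1 c2 Suc by simp
        qed
      qed
    qed
  qed
qed

text \<open>Because of 2 L \<le> m at least half of the elements are chosen among the
  \<open>b\<close>, so \<sigma>^(2 (m - j)) \<le> \<sigma>^m. The factor 2^m is the row sum of the
  binomial coefficients left over from the factorials.\<close>

lemma binomial_product_sum_le:
  fixes n b L m :: nat and \<sigma> :: real
  assumes \<sigma>: "0 < \<sigma>" "\<sigma> \<le> 1" and b: "b \<le> \<sigma>\<^sup>2 * n" and L: "2 * L \<le> m"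
  shows "real (\<Sum>j\<le>min L m. (n choose j) * (b choose (m - j))) \<le> (2 * \<sigma> * n) ^ m / fact m"
proof -
  have ch: "real (a choose j) \<le> real a ^ j / fact j" for a j :: nat
  proof -
    have "fact j * (a choose j) \<le> a ^ j"
    proof (cases "j \<le> a")
      case True
      have "fact j * (a choose j) = fact a div fact (a - j)"
        by (subst binomial_fact_lemma[OF True, symmetric]) simp
      then show ?thesis using fact_div_fact_le_pow[OF True] by simp
    qed (simp add: binomial_eq_0)
    then have "real (fact j * (a choose j)) \<le> real (a ^ j)" by (rule of_nat_mono)
    then show ?thesis by (simp add: field_simps)
  qed
  have term_le: "real ((n choose j) * (b choose (m - j))) \<le> (\<sigma> * n) ^ m / fact m * real (m choose j)" if j: "j \<le> min L m" for j
  proof -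
    have jm: "j \<le> m" "m \<le> 2 * (m - j)" using j L by auto
    have "real ((n choose j) * (b choose (m - j))) \<le> (real n ^ j / fact j) * (real b ^ (m - j) / fact (m - j))"
      unfolding of_nat_mult by (rule mult_mono[OF ch ch]) auto
    also have "\<dots> \<le> (real n ^ j / fact j) * ((\<sigma>\<^sup>2 * n) ^ (m - j) / fact (m - j))"
      using b by (intro mult_left_mono divide_right_mono power_mono) auto
    also have "\<dots> = (real n ^ j * real n ^ (m - j)) * \<sigma> ^ (2 * (m - j)) / (fact j * fact (m - j))"
      by (simp add: power_mult_distrib power_mult)
    also have "real n ^ j * real n ^ (m - j) = real n ^ m" using jm by (simp flip: power_add)
    also have "real n ^ m * \<sigma> ^ (2 * (m - j)) / (fact j * fact (m - j)) \<le> real n ^ m * \<sigma> ^ m / (fact j * fact (m - j))"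
      using \<sigma> jm by (intro divide_right_mono mult_left_mono power_decreasing) auto
    also have "\<dots> = (\<sigma> * n) ^ m / fact m * real (m choose j)"
      using jm by (simp add: binomial_fact power_mult_distrib mult_ac)
    finally show ?thesis .
  qed
  have "real (\<Sum>j\<le>min L m. (n choose j) * (b choose (m - j))) \<le> (\<Sum>j\<le>min L m. (\<sigma> * n) ^ m / fact m * real (m choose j))"
    unfolding of_nat_sum by (rule sum_mono) (use term_le in auto)
  also have "\<dots> \<le> (\<Sum>j\<le>m. (\<sigma> * n) ^ m / fact m * real (m choose j))"
    using \<sigma> by (intro sum_mono2) auto
  also have "\<dots> = (\<sigma> * n) ^ m / fact m * real (\<Sum>j\<le>m. m choose j)"
    by (simp add: sum_distrib_left)
  also have "\<dots> = (2 * \<sigma> * n) ^ m / fact m"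
    by (simp only: choose_row_sum) (simp add: power_mult_distrib mult_ac)
  finally show ?thesis .
qed

lemma powr_root_power:
  assumes "2 \<le> k" "0 < (x :: real)"
  shows "(x powr (1 / (real k - 1))) ^ (k - 1) = x"
proof -
  have "(x powr (1 / (real k - 1))) ^ (k - 1) = x powr (1 / (real k - 1) * real (k - 1))"
    using assms by (simp add: powr_powr flip: powr_realpow)
  also have "1 / (real k - 1) * real (k - 1) = 1" using assms by (simp add: of_nat_diff)
  finally show ?thesis using assms by simp
qed

text \<open>From a partition function of at most exp N, more than N/\<epsilon> factors 1 -
  \<epsilon> lead below 1; this gives the budget \<open>L\<close>, and C = 2/\<epsilon> ensures 2 L
  \<le> t. While more than \<sigma>^2 n vertices are available, supersaturation lets
  \<open>exists_low_occupancy\<close> supply the vertex to branch on.\<close>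

lemma card_independent_sets_le:
  fixes \<gamma> \<eta> :: real
  assumes k: "3 \<le> k" and \<gamma>: "0 < \<gamma>" "\<gamma> \<le> 2" and \<eta>: "0 < \<eta>" "\<eta> \<le> 1"
  shows "\<exists>C>0. \<forall>(V :: 'a set) T t. finite V \<longrightarrow> V \<noteq> {} \<longrightarrow> tuple_system k V T \<longrightarrow>
    supersaturated k ((\<gamma> / 2)\<^sup>2) \<eta> V T \<longrightarrow>
    C * card V powr (1 / (real k - 1)) \<le> real t \<longrightarrow>
    card (independent_sets V T t) \<le> (\<gamma> * card V) ^ t / fact t"
proof -
  define s where "s = \<eta> / (4 * real k * ((2 * real k + 1) ^ (2 * k) + 2 * real k ^ k))"
  define \<epsilon> where "\<epsilon> = \<eta> * s / real k"
  define \<sigma> where "\<sigma> = \<gamma> / 2"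
  have \<sigma>: "0 < \<sigma>" "\<sigma> \<le> 1" using \<gamma> by (auto simp: \<sigma>_def)
  have big: "1 \<le> (2 * real k + 1) ^ (2 * k) + 2 * real k ^ k"
  proof -
    have "1 \<le> (2 * real k + 1) ^ (2 * k)" by (rule one_le_power) simp
    then show ?thesis by (simp add: add_increasing2)
  qed
  have big2: "1 * 1 \<le> (4 * real k) * ((2 * real k + 1) ^ (2 * k) + 2 * real k ^ k)"
    by (intro mult_mono big) (use k in auto)
  then have s: "0 < s" "s \<le> 1"
    using \<eta> unfolding s_def by (auto intro!: divide_pos_pos simp: divide_le_eq)
  have eps: "0 < \<epsilon>" "\<epsilon> \<le> 1"
  proof -
    show "0 < \<epsilon>" using \<eta> s k by (simp add: \<epsilon>_def)
    have "\<eta> * s \<le> 1 * 1" by (intro mult_mono) (use \<eta> s in auto)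
    then show "\<epsilon> \<le> 1" using k by (simp add: \<epsilon>_def divide_le_eq)
  qed
  have main: "card (independent_sets V T t) \<le> (\<gamma> * card V) ^ t / fact t"
    if fin: "finite V" and ne: "V \<noteq> {}" and T: "tuple_system k V T"
      and super: "supersaturated k ((\<gamma> / 2)\<^sup>2) \<eta> V T"
      and t: "2 / \<epsilon> * card V powr (1 / (real k - 1)) \<le> real t"
    for V :: "'a set" and T t
  proof -
    define n where "n = real (card V)"
    have "1 \<le> card V" using fin ne by (simp add: Suc_le_eq card_gt_0_iff)
    then have n: "1 \<le> n" by (simp add: n_def)
    define N where "N = n powr (1 / (real k - 1))"
    define l where "l = N / n"
    have N1: "1 \<le> N" unfolding N_def using n k by (intro ge_one_powr_ge_zero) auto
    have Nn: "N \<le> n"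
    proof -
      have "N \<le> n powr 1" unfolding N_def using n k by (intro powr_mono) (auto simp: divide_le_eq)
      then show ?thesis using n by simp
    qed
    have NN: "N ^ (k - 1) = n"
      unfolding N_def by (rule powr_root_power) (use k n in auto)
    have ln: "l * n = N" using n by (simp add: l_def)
    have l: "0 < l" "l \<le> 1" using N1 n Nn by (auto simp: l_def)
    define F where "F = {X. X \<subseteq> V \<and> (\<forall>xs\<in>T. \<not> set xs \<subseteq> X)}"
    define b where "b = nat \<lfloor>\<sigma>\<^sup>2 * n\<rfloor>"
    define L where "L = nat \<lfloor>N / \<epsilon>\<rfloor>"
    have b: "b \<le> \<sigma>\<^sup>2 * n" using n by (simp add: b_def)
    have "real L \<le> N / \<epsilon>" using N1 eps by (simp add: L_def)
    moreover have "2 * (N / \<epsilon>) \<le> t" using t by (simp add: N_def n_def)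
    ultimately have "real (2 * L) \<le> real t" unfolding of_nat_mult of_nat_numeral by linarith
    then have Lt: "2 * L \<le> t" by linarith
    have finF: "finite F" by (rule finite_subset[of _ "Pow V"]) (use fin in \<open>auto simp: F_def\<close>)
    have dcF: "down_closed F" by (auto simp: F_def down_closed_def)
    have Z: "partition_fun l F \<le> exp N"
    proof -
      have "partition_fun l F \<le> (\<Sum>X\<in>Pow V. l ^ card X)"
        unfolding partition_fun_def using fin l by (intro sum_mono2) (auto simp: F_def)
      also have "\<dots> = (\<Sum>X\<in>Pow V. \<Prod>x\<in>X. l)" by simp
      also have "\<dots> = (\<Prod>x\<in>V. l + 1)" by (subst prod_add[OF fin]) simp
      also have "\<dots> = (1 + l) ^ card V" by (simp add: add.commute)
      also have "\<dots> \<le> exp l ^ card V" using l by (intro power_mono) (auto simp: exp_ge_add_one_self)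
      also have "\<dots> = exp N" using ln by (simp add: n_def mult.commute flip: exp_of_nat_mult)
      finally show ?thesis .
    qed
    have "(1 - \<epsilon>) ^ Suc L * partition_fun l F \<le> exp (- \<epsilon>) ^ Suc L * exp N"
      using eps Z exp_ge_add_one_self[of "- \<epsilon>"] l
      by (intro mult_mono power_mono) (auto simp: partition_fun_def intro!: sum_nonneg)
    also have "\<dots> = exp (N - \<epsilon> * Suc L)"
      by (simp add: exp_diff exp_minus mult.commute inverse_eq_divide power_divide flip: exp_of_nat_mult exp_add)
         (simp add: exp_add algebra_simps flip: exp_of_nat_mult)
    also have "\<dots> < 1"
    proof -
      have "N / \<epsilon> < real (Suc L)" unfolding L_def using N1 eps by (simp add: of_nat_nat) linarith
      then show ?thesis using eps by (simp add: divide_less_eq mult.commute)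
    qed
    finally have w: "(1 - \<epsilon>) ^ Suc L * partition_fun l F < 1" .
    have "card {R \<in> F. card R = t} \<le> (\<Sum>j\<le>min L t. (card V choose j) * (b choose (t - j)))"
    proof (rule card_family_le[OF eps(2) l(1) fin dcF _ _ w])
      show "F \<subseteq> Pow V" by (auto simp: F_def)
      fix A' F'
      assume A': "A' \<subseteq> V" "b < card A'" and F': "down_closed F'" "F' \<subseteq> Pow A'" "{} \<in> F'" "F' \<subseteq> F"
      have "\<sigma>\<^sup>2 * n \<le> card A'" using A'(2) unfolding b_def by linarith
      then have sup: "\<eta> * real (card V) ^ (k - 1) \<le> card {xs \<in> T. set xs \<subseteq> A'}"
        using super A'(1) by (simp add: supersaturated_def \<sigma>_def n_def)
      show "\<exists>v\<in>A'. partition_fun l (link F' v) \<le> (1 - \<epsilon>) * partition_fun l F'"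
        unfolding \<epsilon>_def s_def
      proof (rule exists_low_occupancy[OF T fin k A'(1) l _ _ F'(1-3) _ \<eta>(1) sup])
        show "1 \<le> l * real (card V)" "(l * real (card V)) ^ (k - 1) = real (card V)"
          using ln N1 NN by (simp_all flip: n_def)
        show "\<not> set xs \<subseteq> R" if "R \<in> F'" "xs \<in> T" for R xs
          using that F'(4) by (auto simp: F_def)
      qed
    qed
    then have "real (card {R \<in> F. card R = t}) \<le> real (\<Sum>j\<le>min L t. (card V choose j) * (b choose (t - j)))"
      by (rule of_nat_mono)
    also have "\<dots> \<le> (2 * \<sigma> * card V) ^ t / fact t"
      by (rule binomial_product_sum_le[OF \<sigma> _ Lt]) (use b in \<open>simp add: n_def\<close>)
    finally show ?thesis by (simp add: independent_sets_def F_def \<sigma>_def conj_ac)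
  qed
  show ?thesis
    by (rule exI[of _ "2 / \<epsilon>"], intro conjI allI impI, use eps in simp, rule main) assumption+
qed

section \<open>Binomial random subsets\<close>

lemma random_subset_support:
  assumes "finite A"
  shows "finite (set_pmf (binomial_random_subset A p))" "set_pmf (binomial_random_subset A p) \<subseteq> Pow A"
proof -
  show "set_pmf (binomial_random_subset A p) \<subseteq> Pow A"
    by (auto simp: binomial_random_subset_def)
  then show "finite (set_pmf (binomial_random_subset A p))"
    by (rule finite_subset) (use assms in simp)
qed

lemma prob_superset_binomial_random_subset:
  fixes p :: real
  assumes fin: "finite A" and T: "T \<subseteq> A" and p: "0 \<le> p" "p \<le> 1"
  shows "measure_pmf.prob (binomial_random_subset A p) {X. T \<subseteq> X} = p ^ card T"
proof -
  let ?P = "Pi_pmf A False (\<lambda>_. bernoulli_pmf p)"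
  have "measure_pmf.prob (binomial_random_subset A p) {X. T \<subseteq> X} = measure_pmf.prob ?P {f. \<forall>x\<in>T. f x}"
    using T by (auto simp: binomial_random_subset_def vimage_def intro!: arg_cong[where f = "measure_pmf.prob ?P"])
  also have "\<dots> = measure_pmf.prob ?P ({f. \<forall>x\<in>T. f x} \<inter> set_pmf ?P)"
    by (rule measure_Int_set_pmf[symmetric])
  also have "{f. \<forall>x\<in>T. f x} \<inter> set_pmf ?P =
      PiE_dflt A False (\<lambda>x. if x \<in> T then {True} else UNIV) \<inter> set_pmf ?P"
    using T set_Pi_pmf_subset[OF fin, of False "\<lambda>_. bernoulli_pmf p"]
    by (auto simp: PiE_dflt_def split: if_splits)
  also have "measure_pmf.prob ?P \<dots> = measure_pmf.prob ?P (PiE_dflt A False (\<lambda>x. if x \<in> T then {True} else UNIV))"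
    by (rule measure_Int_set_pmf)
  also have "\<dots> = (\<Prod>x\<in>A. if x \<in> T then p else 1)"
    unfolding measure_Pi_pmf_PiE_dflt[OF fin] using p
    by (intro prod.cong refl) (auto simp: measure_pmf_single)
  also have "\<dots> = p ^ card T"
    using fin T by (simp add: prod.If_cases Int_absorb1)
  finally show ?thesis .
qed

lemma prob_le_expectation:
  fixes h :: "'a \<Rightarrow> real"
  assumes fin: "finite (set_pmf M)" and h: "\<And>x. x \<in> set_pmf M \<Longrightarrow> 0 \<le> h x"
    "\<And>x. x \<in> set_pmf M \<Longrightarrow> Q x \<Longrightarrow> 1 \<le> h x"
  shows "measure_pmf.prob M {x. Q x} \<le> measure_pmf.expectation M h"
proof -
  have "measure_pmf.prob M {x. Q x} = measure_pmf.expectation M (indicator {x. Q x})"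
    by simp
  also have "\<dots> \<le> measure_pmf.expectation M h"
    using h by (intro integral_mono_AE integrable_measure_pmf_finite fin)
      (auto simp: AE_measure_pmf_iff indicator_def)
  finally show ?thesis .
qed

lemma prob_le_add:
  assumes "\<And>x. x \<in> set_pmf M \<Longrightarrow> P x \<Longrightarrow> Q x \<or> R x"
  shows "measure_pmf.prob M {x. P x} \<le> measure_pmf.prob M {x. Q x} + measure_pmf.prob M {x. R x}"
proof -
  have "measure_pmf.prob M {x. P x} = measure_pmf.prob M ({x. P x} \<inter> set_pmf M)"
    by (rule measure_Int_set_pmf[symmetric])
  also have "\<dots> \<le> measure_pmf.prob M ({x. Q x} \<union> {x. R x})"
    by (rule measure_pmf.finite_measure_mono) (use assms in auto)
  also have "\<dots> \<le> measure_pmf.prob M {x. Q x} + measure_pmf.prob M {x. R x}"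
    by (rule measure_Un_le) auto
  finally show ?thesis .
qed

lemma expectation_superset:
  fixes p :: real
  assumes "finite A" "T \<subseteq> A" "0 \<le> p" "p \<le> 1"
  shows "measure_pmf.expectation (binomial_random_subset A p) (\<lambda>X. of_bool (T \<subseteq> X)) = p ^ card T"
proof -
  let ?E = "measure_pmf.expectation (binomial_random_subset A p)"
  have "?E (\<lambda>X. of_bool (T \<subseteq> X)) =
      ?E (indicator {X. T \<subseteq> X})"
    by (rule Bochner_Integration.integral_cong) (auto simp: indicator_def)
  also have "\<dots> = measure_pmf.prob (binomial_random_subset A p) {X. T \<subseteq> X}" by simp
  also have "\<dots> = p ^ card T" by (rule prob_superset_binomial_random_subset[OF assms])
  finally show ?thesis .
qed

text \<open>Indexed by \<open>I\<close> so that different edges with the same vertex set are counted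
  separately.\<close>

lemma expectation_count:
  fixes g :: "'i \<Rightarrow> 'a set" and p :: real
  assumes A: "finite A" and p: "0 \<le> p" "p \<le> 1" and I: "finite I" and g: "\<And>i. i \<in> I \<Longrightarrow> g i \<subseteq> A"
  shows "measure_pmf.expectation (binomial_random_subset A p) (\<lambda>X. real (card {i \<in> I. g i \<subseteq> X})) = (\<Sum>i\<in>I. p ^ card (g i))"
    "measure_pmf.expectation (binomial_random_subset A p) (\<lambda>X. (real (card {i \<in> I. g i \<subseteq> X}))\<^sup>2)
      = (\<Sum>i\<in>I. \<Sum>j\<in>I. p ^ card (g i \<union> g j))"
proof -
  let ?Y = "\<lambda>X. real (card {i \<in> I. g i \<subseteq> X})"
  let ?E = "measure_pmf.expectation (binomial_random_subset A p)"
  note int = integrable_measure_pmf_finite[OF random_subset_support(1)[OF A]]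
  have c: "?Y X = (\<Sum>i\<in>I. of_bool (g i \<subseteq> X))" for X
    using I by (simp add: Int_def)
  show "?E (\<lambda>X. ?Y X) = (\<Sum>i\<in>I. p ^ card (g i))"
    unfolding c by (subst Bochner_Integration.integral_sum) (auto intro!: int sum.cong expectation_superset A p g)
  have c2: "(?Y X)\<^sup>2 = (\<Sum>i\<in>I. \<Sum>j\<in>I. of_bool (g i \<union> g j \<subseteq> X))" for X
    unfolding c power2_eq_square sum_product by (intro sum.cong refl) auto
  show "?E (\<lambda>X. (?Y X)\<^sup>2)
      = (\<Sum>i\<in>I. \<Sum>j\<in>I. p ^ card (g i \<union> g j))"
    unfolding c2
    by (subst Bochner_Integration.integral_sum, rule int, rule sum.cong[OF refl],
        subst Bochner_Integration.integral_sum, rule int, rule sum.cong[OF refl],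
        rule expectation_superset[OF A _ p]) (use g in blast)
qed

lemma prob_union_bound:
  fixes p :: real
  assumes A: "finite A" and p: "0 \<le> p" "p \<le> 1" and I: "finite I" "I \<subseteq> Pow A"
  shows "measure_pmf.prob (binomial_random_subset A p) {X. \<exists>W\<in>I. W \<subseteq> X} \<le> (\<Sum>W\<in>I. p ^ card W)"
proof -
  have "measure_pmf.prob (binomial_random_subset A p) {X. \<exists>W\<in>I. W \<subseteq> X}
      \<le> measure_pmf.expectation (binomial_random_subset A p) (\<lambda>X. real (card {W \<in> I. W \<subseteq> X}))"
  proof (rule prob_le_expectation[OF random_subset_support(1)[OF A]])
    fix X assume "\<exists>W\<in>I. W \<subseteq> X"
    then have "{W \<in> I. W \<subseteq> X} \<noteq> {}" by blast
    then have "card {W \<in> I. W \<subseteq> X} \<noteq> 0" using I by simp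
    then show "1 \<le> real (card {W \<in> I. W \<subseteq> X})" by linarith
  qed simp
  also have "\<dots> = (\<Sum>W\<in>I. p ^ card W)"
    by (rule expectation_count(1)[OF A p I(1)]) (use I in auto)
  finally show ?thesis .
qed

text \<open>Chebyshev's inequality, with the second moment kept as an explicit double sum.\<close>

lemma prob_deviation_le:
  fixes a m p :: real
  assumes A: "finite A" and p: "0 \<le> p" "p \<le> 1" and I: "finite I" and g: "\<And>i. i \<in> I \<Longrightarrow> g i \<subseteq> A"
    and a: "0 < a" and m: "m = (\<Sum>i\<in>I. p ^ card (g i))"
  shows "measure_pmf.prob (binomial_random_subset A p) {X. a \<le> \<bar>real (card {i \<in> I. g i \<subseteq> X}) - m\<bar>}
    \<le> ((\<Sum>i\<in>I. \<Sum>j\<in>I. p ^ card (g i \<union> g j)) - m\<^sup>2) / a\<^sup>2"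
proof -
  let ?M = "binomial_random_subset A p" and ?Y = "\<lambda>X. real (card {i \<in> I. g i \<subseteq> X})"
  note int = integrable_measure_pmf_finite[OF random_subset_support(1)[OF A]]
  have "measure_pmf.prob ?M {X. a \<le> \<bar>?Y X - m\<bar>} \<le> measure_pmf.expectation ?M (\<lambda>X. (?Y X - m)\<^sup>2 / a\<^sup>2)"
  proof (rule prob_le_expectation[OF random_subset_support(1)[OF A]])
    fix X assume "a \<le> \<bar>?Y X - m\<bar>"
    then have "a\<^sup>2 \<le> \<bar>?Y X - m\<bar>\<^sup>2" using a by (intro power_mono) auto
    then show "1 \<le> (?Y X - m)\<^sup>2 / a\<^sup>2" using a by (simp add: power2_abs)
  qed simp
  also have "\<dots> = measure_pmf.expectation ?M (\<lambda>X. (?Y X)\<^sup>2 - 2 * m * ?Y X + m\<^sup>2) / a\<^sup>2"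
    by (simp add: power2_diff algebra_simps)
  also have "measure_pmf.expectation ?M (\<lambda>X. (?Y X)\<^sup>2 - 2 * m * ?Y X + m\<^sup>2) =
      measure_pmf.expectation ?M (\<lambda>X. (?Y X)\<^sup>2) - 2 * m * measure_pmf.expectation ?M ?Y + m\<^sup>2"
    by (subst Bochner_Integration.integral_add[OF int int], subst Bochner_Integration.integral_diff[OF int int]) simp
  also have "\<dots> = (\<Sum>i\<in>I. \<Sum>j\<in>I. p ^ card (g i \<union> g j)) - m\<^sup>2"
  proof -
    have "measure_pmf.expectation ?M ?Y = m"
      unfolding m by (rule expectation_count(1)[OF A p I]) (use g in auto)
    moreover have "measure_pmf.expectation ?M (\<lambda>X. (?Y X)\<^sup>2) = (\<Sum>i\<in>I. \<Sum>j\<in>I. p ^ card (g i \<union> g j))"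
      by (rule expectation_count(2)[OF A p I]) (use g in auto)
    ultimately show ?thesis by (simp only:) (simp add: power2_eq_square)
  qed
  finally show ?thesis .
qed

lemma prob_card_small_le:
  fixes p :: real
  assumes A: "finite A" and p: "0 \<le> p" "p \<le> 1" and np: "0 < p * card A"
  shows "measure_pmf.prob (binomial_random_subset A p) {X. card X < p * card A / 2} \<le> 4 / (p * card A)"
proof -
  let ?M = "binomial_random_subset A p"
  define m where "m = (\<Sum>x\<in>A. p ^ card {x})"
  have m: "m = p * card A" by (simp add: m_def)
  have "measure_pmf.prob ?M {X. card X < p * card A / 2} = measure_pmf.prob ?M ({X. card X < p * card A / 2} \<inter> set_pmf ?M)"
    by (rule measure_Int_set_pmf[symmetric])
  also have "\<dots> \<le> measure_pmf.prob ?M {X. m / 2 \<le> \<bar>real (card {x \<in> A. {x} \<subseteq> X}) - m\<bar>}"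
  proof (rule measure_pmf.finite_measure_mono)
    show "{X. card X < p * card A / 2} \<inter> set_pmf ?M \<subseteq> {X. m / 2 \<le> \<bar>real (card {x \<in> A. {x} \<subseteq> X}) - m\<bar>}"
    proof
      fix X assume X: "X \<in> {X. card X < p * card A / 2} \<inter> set_pmf ?M"
      then have "X \<subseteq> A" using random_subset_support(2)[OF A] by blast
      then have "{x \<in> A. {x} \<subseteq> X} = X" by auto
      then show "X \<in> {X. m / 2 \<le> \<bar>real (card {x \<in> A. {x} \<subseteq> X}) - m\<bar>}" using X m by simp
    qed
  qed simp
  also have "\<dots> \<le> ((\<Sum>x\<in>A. \<Sum>y\<in>A. p ^ card ({x} \<union> {y})) - m\<^sup>2) / (m / 2)\<^sup>2"
  proof (rule prob_deviation_le[where g = "\<lambda>x. {x}", OF A p A])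
    show "m = (\<Sum>i\<in>A. p ^ card {i})" by (rule m_def)
  qed (use np m in auto)
  also have "\<dots> \<le> m / (m / 2)\<^sup>2"
  proof (rule divide_right_mono)
    have "(\<Sum>x\<in>A. \<Sum>y\<in>A. p ^ card ({x} \<union> {y})) \<le> (\<Sum>x\<in>A. \<Sum>y\<in>A. p * of_bool (y \<in> {x}) + p\<^sup>2)"
      by (intro sum_mono) (use p in \<open>auto simp: card_insert_if power2_eq_square\<close>)
    also have "\<dots> = (\<Sum>x\<in>A. p * card (A \<inter> {x}) + card A * p\<^sup>2)"
      using A by (simp add: sum.distrib Int_def flip: sum_distrib_left)
    also have "\<dots> = (\<Sum>x\<in>A. p + card A * p\<^sup>2)" by (rule sum.cong) auto
    also have "\<dots> = m + m\<^sup>2" by (simp add: m power2_eq_square algebra_simps)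
    finally show "(\<Sum>x\<in>A. \<Sum>y\<in>A. p ^ card ({x} \<union> {y})) - m\<^sup>2 \<le> m" by simp
  qed simp
  also have "\<dots> = 4 / (p * card A)" using np by (simp add: m power2_eq_square field_simps)
  finally show ?thesis .
qed

text \<open>For fixed \<open>xs\<close>, the edges disjoint from it account for the square of the
  mean. Any other edge has some vertex of \<open>xs\<close> in some position, which can happen in
  k^2 ways; for each, \<open>weighted_fixed_coord_le\<close> applies with
  \<open>D = set xs\<close>.\<close>

lemma count_variance_le:
  fixes p :: real
  assumes T: "tuple_system k V T" and fin: "finite V" and k: "2 \<le> k" and p: "0 \<le> p" "p \<le> 1"
  shows "(\<Sum>xs\<in>T. \<Sum>ys\<in>T. p ^ card (set xs \<union> set ys)) - (card T * p ^ k)\<^sup>2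
    \<le> card T * p ^ k * (real k ^ 2 * (real k ^ (k - 1) + real (k - 1) * p * (k + p * card V) ^ (k - 2)))"
proof -
  define K where "K = real k ^ (k - 1) + real (k - 1) * p * (k + p * card V) ^ (k - 2)"
  have Tp: "length xs = k" "distinct xs" "set xs \<subseteq> V" "card (set xs) = k" if "xs \<in> T" for xs
    using T that by (auto simp: tuple_system_def distinct_card)
  have finT: "finite T" by (rule tuple_system_finite[OF T fin])
  have each: "(\<Sum>ys\<in>T. p ^ card (set xs \<union> set ys)) \<le> p ^ k * (card T * p ^ k + real k ^ 2 * K)" if xs: "xs \<in> T" for xs
  proof -
    define D where "D = set xs"
    have D: "finite D" "card D = k" using Tp[OF xs] by (auto simp: D_def)
    define h where "h y = (if y \<in> D then 1 else p)" for y
    have h: "0 \<le> h y" "h y \<le> 1" for y using p by (auto simp: h_def)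
    have eq: "p ^ card (D \<union> set ys) = p ^ k * (\<Prod>j<k. h (ys ! j))" if ys: "ys \<in> T" for ys
      using power_card_Un_set[OF D(1) Tp(2)[OF ys], of p] by (simp add: D(2) Tp(1)[OF ys] h_def)
    let ?W = "\<lambda>ys. \<Sum>i<k. \<Sum>v\<in>D. of_bool (ys ! i = v) * (\<Prod>j\<in>{..<k} - {i}. h (ys ! j))"
    have pt: "(\<Prod>j<k. h (ys ! j)) \<le> p ^ k + ?W ys" for ys
    proof (cases "\<exists>i<k. ys ! i \<in> D")
      case True
      then obtain i where i: "i < k" "ys ! i \<in> D" by blast
      have nn: "0 \<le> of_bool (ys ! i = v) * (\<Prod>j\<in>{..<k} - {i}. h (ys ! j))" for i v
        by (intro mult_nonneg_nonneg prod_nonneg) (auto simp: h)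
      have "(\<Prod>j<k. h (ys ! j)) = h (ys ! i) * (\<Prod>j\<in>{..<k} - {i}. h (ys ! j))"
        by (rule prod.remove) (use i in auto)
      also have "\<dots> = of_bool (ys ! i = ys ! i) * (\<Prod>j\<in>{..<k} - {i}. h (ys ! j))"
        using i by (simp add: h_def)
      also have "\<dots> \<le> (\<Sum>v\<in>D. of_bool (ys ! i = v) * (\<Prod>j\<in>{..<k} - {i}. h (ys ! j)))"
        by (rule member_le_sum[OF i(2)]) (use nn D in auto)
      also have "\<dots> \<le> ?W ys"
        by (rule member_le_sum[of i]) (use i nn in \<open>auto intro!: sum_nonneg\<close>)
      finally show ?thesis using p by (simp add: add_increasing)
    next
      case False
      then have "(\<Prod>j<k. h (ys ! j)) = p ^ k" by (simp add: h_def)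
      moreover have "0 \<le> ?W ys"
        by (intro sum_nonneg mult_nonneg_nonneg prod_nonneg) (auto simp: h)
      ultimately show ?thesis by simp
    qed
    have "(\<Sum>ys\<in>T. \<Prod>j<k. h (ys ! j)) \<le>
        (\<Sum>ys\<in>T. p ^ k + ?W ys)"
      by (rule sum_mono) (rule pt)
    also have "\<dots> = card T * p ^ k + (\<Sum>i<k. \<Sum>v\<in>D. \<Sum>ys\<in>T. of_bool (ys ! i = v) * (\<Prod>j\<in>{..<k} - {i}. h (ys ! j)))"
    proof -
      have "(\<Sum>ys\<in>T. \<Sum>i<k. \<Sum>v\<in>D. of_bool (ys ! i = v) * (\<Prod>j\<in>{..<k} - {i}. h (ys ! j)))
          = (\<Sum>i<k. \<Sum>ys\<in>T. \<Sum>v\<in>D. of_bool (ys ! i = v) * (\<Prod>j\<in>{..<k} - {i}. h (ys ! j)))"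
        by (rule sum.swap)
      also have "\<dots> = (\<Sum>i<k. \<Sum>v\<in>D. \<Sum>ys\<in>T. of_bool (ys ! i = v) * (\<Prod>j\<in>{..<k} - {i}. h (ys ! j)))"
        by (rule sum.cong[OF refl]) (rule sum.swap)
      finally show ?thesis by (simp add: sum.distrib)
    qed
    also have "\<dots> \<le> card T * p ^ k + (\<Sum>i<k. \<Sum>v\<in>D. K)"
    proof (intro add_left_mono sum_mono)
      fix i v assume i: "i \<in> {..<k}"
      have "(\<Sum>ys\<in>T. of_bool (ys ! i = v) * (\<Prod>j\<in>{..<k} - {i}. h (ys ! j)))
          = (\<Sum>ys\<in>{ys \<in> T. ys ! i = v}. \<Prod>j\<in>{..<k} - {i}. h (ys ! j))"
        using finT by (simp add: Int_def)
      also have "\<dots> \<le> K"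
        unfolding h_def K_def using weighted_fixed_coord_le[OF T fin k _ D(1) p, of i v] i D(2) by simp
      finally show "(\<Sum>ys\<in>T. of_bool (ys ! i = v) * (\<Prod>j\<in>{..<k} - {i}. h (ys ! j))) \<le> K" .
    qed
    also have "\<dots> = card T * p ^ k + real k ^ 2 * K" by (simp add: D power2_eq_square)
    finally have "p ^ k * (\<Sum>ys\<in>T. \<Prod>j<k. h (ys ! j)) \<le> p ^ k * (card T * p ^ k + real k ^ 2 * K)"
      using p by (intro mult_left_mono) auto
    moreover have "(\<Sum>ys\<in>T. p ^ card (set xs \<union> set ys)) = p ^ k * (\<Sum>ys\<in>T. \<Prod>j<k. h (ys ! j))"
      unfolding sum_distrib_left D_def[symmetric] by (rule sum.cong[OF refl]) (rule eq)
    ultimately show ?thesis by simp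
  qed
  have "(\<Sum>xs\<in>T. \<Sum>ys\<in>T. p ^ card (set xs \<union> set ys)) \<le> (\<Sum>xs\<in>T. p ^ k * (card T * p ^ k + real k ^ 2 * K))"
    by (rule sum_mono) (rule each)
  also have "\<dots> = (card T * p ^ k)\<^sup>2 + card T * p ^ k * (real k ^ 2 * K)"
    by (simp add: power2_eq_square algebra_simps)
  finally show ?thesis by (simp add: K_def)
qed

section \<open>Stability below and above the threshold\<close>

definition tuple_stable :: "real \<Rightarrow> 'a list set \<Rightarrow> 'a set \<Rightarrow> bool" where
  "tuple_stable \<delta> T X \<longleftrightarrow>
     (\<forall>X'\<subseteq>X. \<delta> * real (card X) \<le> real (card X') \<longrightarrow> (\<exists>xs\<in>T. set xs \<subseteq> X'))"

lemma tuple_stable_count: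
  assumes X: "finite X" and ne: "\<And>xs. xs \<in> T \<Longrightarrow> xs \<noteq> []" and T: "finite T" and st: "tuple_stable \<delta> T X"
  shows "(1 - \<delta>) * card X < card {xs \<in> T. set xs \<subseteq> X}"
proof (rule ccontr)
  define Y where "Y = {xs \<in> T. set xs \<subseteq> X}"
  assume "\<not> (1 - \<delta>) * card X < card {xs \<in> T. set xs \<subseteq> X}"
  (* Deleting one vertex of every edge leaves too large an independent set. *)
  then have Y: "card Y \<le> (1 - \<delta>) * card X" by (simp add: Y_def)
  have "card X - card Y \<le> card X - card (hd ` Y)"
    using T card_image_le[of Y hd] by (simp add: Y_def)
  also have "\<dots> \<le> card (X - hd ` Y)" by (rule diff_card_le_card_Diff) (use T in \<open>simp add: Y_def\<close>)
  finally have "real (card X) - card Y \<le> card (X - hd ` Y)" by linarith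
  then have "\<delta> * card X \<le> card (X - hd ` Y)" using Y by (simp add: algebra_simps)
  then obtain xs where xs: "xs \<in> T" "set xs \<subseteq> X - hd ` Y"
    using st unfolding tuple_stable_def by blast
  then have "xs \<in> Y" "hd xs \<in> set xs" using ne by (auto simp: Y_def)
  then show False using xs by auto
qed

lemma prob_stable_le:
  fixes p \<delta> c :: real
  assumes T: "tuple_system k V T" and fin: "finite V" and k: "3 \<le> k" and p: "0 \<le> p" "p \<le> 1"
    and \<delta>: "\<delta> \<le> 1 / 2" and n: "1 \<le> card V" and pn: "(p * card V) ^ (k - 1) \<le> card V / 8"
  shows "measure_pmf.prob (binomial_random_subset V p) {X. tuple_stable \<delta> T X}
    \<le> real (card V) powr (- 1 / 2) +
      (64 * (real k ^ 2 * (real k ^ k + real k * real (k + 1) ^ k)) + 4) * real (card V) powr (- 1 / (2 * real k))"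
proof -
  let ?M = "binomial_random_subset V p" and ?Y = "\<lambda>X. card {xs \<in> T. set xs \<subseteq> X}"
  let ?V2 = "\<Sum>xs\<in>T. \<Sum>ys\<in>T. p ^ card (set xs \<union> set ys)"
  define n where "n = real (card V)"
  define m where "m = (\<Sum>xs\<in>T. p ^ card (set xs))"
  define K where "K = real k ^ 2 * (real k ^ k + real k * real (k + 1) ^ k)"
  have n1: "1 \<le> n" using n by (simp add: n_def)
  have finT: "finite T" by (rule tuple_system_finite[OF T fin])
  have Tp: "length xs = k" "distinct xs" "set xs \<subseteq> V" "card (set xs) = k" "xs \<noteq> []" if "xs \<in> T" for xs
    using T that k by (auto simp: tuple_system_def distinct_card)
  have m: "m = card T * p ^ k" unfolding m_def using Tp by simp
  have mle: "m \<le> p * n * ((p * n) ^ (k - 1) / n)"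
  proof -
    have "m \<le> n ^ (k - 1) * p ^ k"
      unfolding m using of_nat_mono[OF tuple_system_card_le[OF T fin], where 'a = real] k p
      by (intro mult_right_mono) (auto simp: n_def)
    also have "p ^ k = p * p ^ (k - 1)" using k by (simp flip: power_Suc)
    finally show ?thesis using n1 by (simp add: power_mult_distrib mult_ac)
  qed
  have stable_count: "(1 - \<delta>) * card X < ?Y X" if "tuple_stable \<delta> T X" "X \<in> set_pmf ?M" for X
    using that random_subset_support(2)[OF fin, of p] fin
    by (intro tuple_stable_count finT Tp) (auto intro: finite_subset)
  have K0: "0 \<le> K" by (simp add: K_def)
  show ?thesis
  (* Markov's inequality suffices when the expected size p n is small. Otherwise it only bounds
     the probability by a constant, and the number of edges has to be concentrated. *)
  proof (cases "p * n \<le> n powr (1 / (2 * k))")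
    case True
    have "measure_pmf.prob ?M {X. tuple_stable \<delta> T X} \<le> measure_pmf.expectation ?M (\<lambda>X. real (?Y X))"
    proof (rule prob_le_expectation[OF random_subset_support(1)[OF fin]])
      fix X assume "X \<in> set_pmf ?M" "tuple_stable \<delta> T X"
      then have "(1 - \<delta>) * card X < ?Y X" using stable_count by blast
      moreover have "0 \<le> (1 - \<delta>) * card X" using \<delta> by simp
      ultimately have "0 < real (?Y X)" by linarith
      then have "1 \<le> ?Y X" unfolding of_nat_0_less_iff by (simp only: Suc_le_eq One_nat_def)
      then show "1 \<le> real (?Y X)" using of_nat_mono[of 1 "?Y X"] by (simp only: of_nat_1)
    qed simp
    also have "\<dots> = m"
      unfolding m_def by (rule expectation_count(1)[OF fin p finT]) (use Tp in auto)
    also have "\<dots> \<le> p * n * ((p * n) ^ (k - 1) / n)" by (rule mle)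
    also have "\<dots> = (p * n) ^ k / n" using k by (simp flip: power_Suc)
    \<comment> \<open>The case split is placed at the exponent 1/(2 k) so that (p n)^k is at most
      the square root of n.\<close>
    also have "\<dots> \<le> (n powr (1 / (2 * k))) ^ k / n"
      using True p n1 by (intro divide_right_mono power_mono) auto
    also have "(n powr (1 / (2 * k))) ^ k = n powr (1 / 2)"
      using n1 k by (simp add: powr_powr flip: powr_realpow)
    also have "n powr (1 / 2) / n = n powr (- 1 / 2)"
      using n1 powr_diff[of n "1 / 2" 1] by simp
    also have "\<dots> \<le> n powr (- 1 / 2) + (64 * K + 4) * n powr (- 1 / (2 * real k))"
      using K0 by simp
    finally show ?thesis by (simp add: n_def K_def)
  next
    case False
    have big: "n powr (1 / (2 * k)) < p * n" using False by simp
    have "1 \<le> n powr (1 / (2 * k))" using n1 by (intro ge_one_powr_ge_zero) auto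
    then have pn1: "1 \<le> p * n" using big by linarith
    have m8: "m \<le> p * n / 8"
    proof -
      have "(p * n) ^ (k - 1) / n \<le> 1 / 8" using pn n1 by (simp add: n_def field_simps)
      then have "p * n * ((p * n) ^ (k - 1) / n) \<le> p * n * (1 / 8)" using pn1 by (intro mult_left_mono) auto
      then show ?thesis using mle by simp
    qed
    have m0: "0 \<le> m" using p by (simp add: m)
    \<comment> \<open>A stable set with at least p n/2 elements spans more than p n/4 edges, as 1 -
      \<delta> \<ge> 1/2, while the expected number is at most p n/8. The difference is
      \<open>a\<close>.\<close>
    define a where "a = p * n / 8"
    have a: "0 < a" using pn1 by (simp add: a_def)
    have "measure_pmf.prob ?M {X. tuple_stable \<delta> T X} \<le>
        measure_pmf.prob ?M {X. card X < p * card V / 2} + measure_pmf.prob ?M {X. a \<le> \<bar>real (?Y X) - m\<bar>}"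
    proof (rule prob_le_add)
      fix X assume X: "X \<in> set_pmf ?M" "tuple_stable \<delta> T X"
      show "card X < p * card V / 2 \<or> a \<le> \<bar>real (?Y X) - m\<bar>"
      proof (cases "card X < p * card V / 2")
        case False
        have "p * n / 4 \<le> 1 / 2 * card X" using False by (simp add: n_def)
        also have "\<dots> \<le> (1 - \<delta>) * card X" using \<delta> by (intro mult_right_mono) auto
        also have "\<dots> < ?Y X" using stable_count X by blast
        finally have "a \<le> \<bar>real (?Y X) - m\<bar>" using m8 by (simp add: a_def)
        then show ?thesis ..
      qed simp
    qed
    also have "\<dots> \<le> 4 / (p * n) + (?V2 - m\<^sup>2) / a\<^sup>2"
    proof (rule add_mono)
      show "measure_pmf.prob ?M {X. card X < p * card V / 2} \<le> 4 / (p * n)"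
        unfolding n_def by (rule prob_card_small_le[OF fin p]) (use pn1 in \<open>simp add: n_def\<close>)
      show "measure_pmf.prob ?M {X. a \<le> \<bar>real (?Y X) - m\<bar>} \<le> (?V2 - m\<^sup>2) / a\<^sup>2"
        by (rule prob_deviation_le[OF fin p finT _ a m_def]) (use Tp in auto)
    qed
    also have "\<dots> \<le> 4 / (p * n) + (p * n * K) / a\<^sup>2"
    proof (intro add_left_mono divide_right_mono)
      have "?V2 - m\<^sup>2
          \<le> m * (real k ^ 2 * (real k ^ (k - 1) + real (k - 1) * p * (k + p * n) ^ (k - 2)))"
        unfolding m n_def by (rule count_variance_le[OF T fin _ p]) (use k in simp)
      also have "\<dots> \<le> p * n * K"
      proof (rule mult_mono)
        show "m \<le> p * n" using m8 pn1 by simp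
        have e1: "real k ^ (k - 1) \<le> real k ^ k" using k by (intro power_increasing) auto
        have "real k * 1 \<le> real k * (p * n)" using pn1 by (intro mult_left_mono) auto
        then have "(k + p * n) ^ (k - 2) \<le> (real (k + 1) * (p * n)) ^ (k - 2)"
          using pn1 by (intro power_mono) (auto simp: algebra_simps)
        then have "p * (k + p * n) ^ (k - 2) \<le> p * (real (k + 1) * (p * n)) ^ (k - 2)"
          using p by (intro mult_left_mono) auto
        \<comment> \<open>Below the threshold (p n)^(k-1)/n is bounded, so the variance is of order
          p n, and Chebyshev's inequality yields a bound of order 1/(p n).\<close>
        also have "\<dots> = real (k + 1) ^ (k - 2) * ((p * n) ^ (k - 1) / n)"
        proof -
          have "k - 1 = Suc (k - 2)" using k by simp
          then have "(p * n) ^ (k - 1) / n = p * (p * n) ^ (k - 2)" using n1 by simp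
          then show ?thesis by (simp only: power_mult_distrib mult_ac)
        qed
        also have "\<dots> \<le> real (k + 1) ^ k * 1"
        proof (rule mult_mono)
          show "(p * n) ^ (k - 1) / n \<le> 1" using pn n1 by (simp add: n_def field_simps)
          show "real (k + 1) ^ (k - 2) \<le> real (k + 1) ^ k" by (intro power_increasing) auto
        qed (use p n1 in auto)
        finally have "real (k - 1) * (p * (k + p * n) ^ (k - 2)) \<le> real k * real (k + 1) ^ k"
          using p n1 by (intro mult_mono) auto
        then have "real (k - 1) * p * (k + p * n) ^ (k - 2) \<le> real k * real (k + 1) ^ k"
          by (simp only: mult.assoc)
        then show "real k ^ 2 * (real k ^ (k - 1) + real (k - 1) * p * (k + p * n) ^ (k - 2)) \<le> K"
          unfolding K_def using e1 by (intro mult_left_mono add_mono) auto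
      qed (use p n1 m0 in auto)
      finally show "?V2 - m\<^sup>2 \<le> p * n * K" .
    qed simp
    also have "\<dots> = (64 * K + 4) / (p * n)"
      using pn1 by (simp add: a_def power2_eq_square field_simps)
    also have "\<dots> \<le> (64 * K + 4) / n powr (1 / (2 * k))"
    proof (rule divide_left_mono)
      have "0 < p * n" using pn1 by linarith
      then show "0 < p * n * n powr (1 / (2 * k))" by (rule mult_pos_pos) (use n1 in simp)
    qed (use big K0 in auto)
    also have "\<dots> = (64 * K + 4) * n powr (- 1 / (2 * real k))"
    proof -
      have "n powr (- 1 / (2 * real k)) = n powr (- (1 / (2 * k)))" by simp
      also have "\<dots> = inverse (n powr (1 / (2 * k)))" by (rule powr_minus)
      finally show ?thesis by (simp only: divide_inverse)
    qed
    also have "\<dots> \<le> n powr (- 1 / 2) + (64 * K + 4) * n powr (- 1 / (2 * real k))" by simp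
    finally show ?thesis by (simp add: n_def K_def)
  qed
qed

text \<open>t^t / t! is one term of the exponential series at t, and exp 1 \<le> 3.\<close>

lemma power_self_le_fact: "real t ^ t \<le> 3 ^ t * fact t"
proof -
  have "real t ^ t /\<^sub>R fact t \<le> exp (real t)"
  proof -
    have "(\<Sum>i\<in>{t}. real t ^ i /\<^sub>R fact i) \<le> (\<Sum>i. real t ^ i /\<^sub>R fact i)"
      by (rule sum_le_suminf) (use exp_converges[of "real t"] in \<open>auto simp: sums_iff\<close>)
    then show ?thesis by (simp add: exp_def)
  qed
  also have "exp (real t) = exp 1 ^ t" by (simp flip: exp_of_nat_mult)
  also have "\<dots> \<le> 3 ^ t" by (intro power_mono exp_le) auto
  finally show ?thesis by (simp add: field_simps)
qed

text \<open>An unstable set with at least p n/2 elements contains an independent set of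
  \<open>t\<close> elements. The constant 12 makes the union bound geometric: since p n \<delta>
  \<le> 2 t, the sum is at most (t/6)^t / t!, which is at most 2^(-t) by t^t \<le> 3^t t!.\<close>

lemma prob_unstable_le:
  fixes p \<delta> :: real
  assumes fin: "finite V" and p: "0 \<le> p" "p \<le> 1" and \<delta>: "0 < \<delta>" and pn: "0 < p * card V"
    and t: "t = nat \<lceil>\<delta> * (p * card V) / 2\<rceil>"
    and count: "card (independent_sets V T t) \<le> (\<delta> / 12 * card V) ^ t / fact t"
  shows "measure_pmf.prob (binomial_random_subset V p) {X. \<not> tuple_stable \<delta> T X} \<le> (4 + 2 / \<delta>) / (p * card V)"
proof -
  let ?M = "binomial_random_subset V p"
  define n where "n = real (card V)"
  define I where "I = independent_sets V T t"
  have finI: "finite I" by (rule finite_subset[of _ "Pow V"]) (use fin in \<open>auto simp: I_def independent_sets_def\<close>)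
  have tge: "\<delta> * (p * n) / 2 \<le> t" unfolding t n_def by linarith
  have t0: "0 < real t" using tge \<delta> pn by (smt (verit) divide_pos_pos mult_pos_pos n_def)
  have "measure_pmf.prob ?M {X. \<not> tuple_stable \<delta> T X} \<le>
      measure_pmf.prob ?M {X. card X < p * card V / 2} + measure_pmf.prob ?M {X. \<exists>W\<in>I. W \<subseteq> X}"
  proof (rule prob_le_add)
    fix X assume X: "X \<in> set_pmf ?M" "\<not> tuple_stable \<delta> T X"
    then have XV: "X \<subseteq> V" using random_subset_support(2)[OF fin, of p] by blast
    obtain X' where X': "X' \<subseteq> X" "\<delta> * card X \<le> card X'" "\<forall>xs\<in>T. \<not> set xs \<subseteq> X'"
      using X unfolding tuple_stable_def by blast
    show "card X < p * card V / 2 \<or> (\<exists>W\<in>I. W \<subseteq> X)"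
    proof (cases "card X < p * card V / 2")
      case False
      then have "\<delta> * (p * card V / 2) \<le> \<delta> * card X" using \<delta> by (intro mult_left_mono) auto
      then have "\<delta> * (p * card V) / 2 \<le> card X'" using X'(2) by simp
      then have "t \<le> card X'" unfolding t by linarith
      then obtain W where W: "W \<subseteq> X'" "card W = t" using obtain_subset_with_card_n by metis
      then have "W \<in> I" "W \<subseteq> X" using X' XV unfolding I_def independent_sets_def by blast+
      then show ?thesis by blast
    qed simp
  qed
  also have "\<dots> \<le> 4 / (p * n) + 1 / real t"
  proof (rule add_mono)
    show "measure_pmf.prob ?M {X. card X < p * card V / 2} \<le> 4 / (p * n)"
      unfolding n_def by (rule prob_card_small_le[OF fin p pn])
    have "measure_pmf.prob ?M {X. \<exists>W\<in>I. W \<subseteq> X} \<le> (\<Sum>W\<in>I. p ^ card W)"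
      by (rule prob_union_bound[OF fin p finI]) (auto simp: I_def independent_sets_def)
    also have "\<dots> = card I * p ^ t" by (simp add: I_def independent_sets_def)
    also have "\<dots> \<le> ((\<delta> / 12 * n) ^ t / fact t) * p ^ t"
      using count p by (intro mult_right_mono) (auto simp: I_def n_def)
    also have "\<dots> = (\<delta> * (p * n) / 12) ^ t / fact t"
      by (simp add: power_mult_distrib power_divide mult_ac)
    also have "\<dots> \<le> (real t / 6) ^ t / fact t"
      using tge \<delta> p by (intro divide_right_mono power_mono) (auto simp: n_def)
    also have "\<dots> = (real t ^ t / 6 ^ t) / fact t" by (simp add: power_divide)
    also have "\<dots> \<le> (3 ^ t * fact t / 6 ^ t) / fact t"
      by (intro divide_right_mono power_self_le_fact) auto
    also have "\<dots> = (1 / 2) ^ t" by (simp flip: power_divide)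
    also have "\<dots> \<le> 1 / real t"
      using t0 of_nat_less_two_power[of t, where 'a = real] by (simp add: power_one_over field_simps)
    finally show "measure_pmf.prob ?M {X. \<exists>W\<in>I. W \<subseteq> X} \<le> 1 / real t" .
  qed
  also have "\<dots> \<le> 4 / (p * n) + 1 / (\<delta> * (p * n) / 2)"
    using tge \<delta> pn t0 by (intro add_left_mono divide_left_mono) (auto simp: n_def)
  also have "\<dots> = (4 + 2 / \<delta>) / (p * n)"
  proof -
    have "4 / q + 1 / (\<delta> * q / 2) = (4 + 2 / \<delta>) / q" if "0 < q" for q
      using \<delta> that by (simp add: field_simps)
    then show ?thesis using pn unfolding n_def by blast
  qed
  finally show ?thesis by (simp add: n_def)
qed

section \<open>The equation in a finite group\<close>

text \<open>By Bezout and Lagrange, a further power inverts the map x to x^m. The trivial group is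
  treated apart because \<open>coprime_bezout_strong\<close> excludes the modulus 1.\<close>

lemma (in group) pow_coprime_inj:
  assumes fin: "finite (carrier G)" and cop: "coprime m (card (carrier G))"
    and x: "x \<in> carrier G" and y: "y \<in> carrier G" and eq: "x [^] m = y [^] m"
  shows "x = y"
proof (cases "card (carrier G) = 1")
  case True
  then obtain z where "carrier G = {z}" by (rule card_1_singletonE)
  then show ?thesis using x y by simp
next
  case False
  obtain u v where uv: "m * u = card (carrier G) * v + 1"
    using coprime_bezout_strong[OF cop False] by auto
  have root: "z [^] (m * u) = z" if "z \<in> carrier G" for z
    unfolding uv using that pow_order_eq_1[OF that, unfolded Coset.order_def]
    by (simp add: nat_pow_mult[symmetric] nat_pow_pow[symmetric])
  have "x [^] (m * u) = y [^] (m * u)" using x y eq by (simp flip: nat_pow_pow)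
  then show ?thesis using root x y by simp
qed

lemma power_product_Cons:
  "power_product G (r # rs) (x # xs) = x [^]\<^bsub>G\<^esub> r \<otimes>\<^bsub>G\<^esub> power_product G rs xs"
  by (simp add: power_product_def)

lemma power_product_Nil: "power_product G [] xs = \<one>\<^bsub>G\<^esub>"
  by (simp add: power_product_def)

lemma (in group) power_product_closed:
  "length xs = length rs \<Longrightarrow> set xs \<subseteq> carrier G \<Longrightarrow> power_product G rs xs \<in> carrier G"
  by (induction xs rs rule: list_induct2) (auto simp: power_product_Cons power_product_Nil)

text \<open>Cancelling the equal factors to the left and to the right of position \<open>j\<close>
  leaves an equality of two powers with exponent \<open>rs ! j\<close>, which is coprime to the
  order.\<close>

lemma (in group) power_product_determines_coord:
  assumes fin: "finite (carrier G)"
    and "length xs = length rs" "length ys = length rs" "set xs \<subseteq> carrier G" "set ys \<subseteq> carrier G"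
    and "\<And>i. i < length rs \<Longrightarrow> coprime (rs ! i) (card (carrier G))"
    and "j < length rs" and "\<And>i. i < length rs \<Longrightarrow> i \<noteq> j \<Longrightarrow> xs ! i = ys ! i"
    and "power_product G rs xs = power_product G rs ys"
  shows "xs = ys"
  using assms(2-)
proof (induction rs arbitrary: xs ys j)
  case (Cons r rs)
  obtain x xs' y ys' where xy: "xs = x # xs'" "ys = y # ys'"
    using Cons.prems(1,2) by (metis length_Suc_conv)
  have cl: "power_product G rs xs' \<in> carrier G" "power_product G rs ys' \<in> carrier G"
    "x \<in> carrier G" "y \<in> carrier G"
    using Cons.prems xy by (auto intro: power_product_closed)
  show ?case
  proof (cases j)
    case 0
    have "xs' = ys'"
      using Cons.prems(1,2) Cons.prems(7)[of "Suc _"] 0 xy by (intro nth_equalityI) auto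
    then have "x [^] r = y [^] r"
      using Cons.prems(8) xy cl by (simp add: power_product_Cons)
    then show ?thesis
      using pow_coprime_inj[OF fin _ cl(3,4)] Cons.prems(5)[of 0] xy \<open>xs' = ys'\<close> by simp
  next
    case (Suc j')
    have "x = y" using Cons.prems(7)[of 0] Suc xy by simp
    then have eq: "power_product G rs xs' = power_product G rs ys'"
      using Cons.prems(8) xy cl by (simp add: power_product_Cons)
    have "xs' = ys'"
    proof (rule Cons.IH)
      show "coprime (rs ! i) (card (carrier G))" if "i < length rs" for i
        using Cons.prems(5)[of "Suc i"] that by simp
      show "xs' ! i = ys' ! i" if "i < length rs" "i \<noteq> j'" for i
        using Cons.prems(7)[of "Suc i"] that Suc xy by simp
    qed (use Cons.prems xy Suc eq in auto)
    then show ?thesis using \<open>x = y\<close> xy by simp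
  qed
qed simp

lemma (in group) equation_solutions_inj:
  assumes fin: "finite (carrier G)" and k: "length rs = k"
    and cop: "\<And>i. i < k \<Longrightarrow> coprime (rs ! i) (card (carrier G))" and j: "j < k"
  shows "inj_on (coords ({..<k} - {j})) (equation_solutions G rs)"
proof (rule inj_onI)
  fix xs ys assume xs: "xs \<in> equation_solutions G rs" and ys: "ys \<in> equation_solutions G rs"
    and eq: "coords ({..<k} - {j}) xs = coords ({..<k} - {j}) ys"
  have "xs ! i = ys ! i" if "i < k" "i \<noteq> j" for i
    using fun_cong[OF eq, of i] that by simp
  then show "xs = ys"
    using xs ys k cop j fin
    by (intro power_product_determines_coord[of xs rs ys j]) (auto simp: equation_solutions_def tuples_def)
qed

lemma (in group) tuple_system_solutions:
  assumes fin: "finite (carrier G)" and k: "length rs = k"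
    and cop: "\<And>i. i < k \<Longrightarrow> coprime (rs ! i) (card (carrier G))"
  shows "tuple_system k (carrier G) (distinct_tuples (equation_solutions G rs))"
  unfolding tuple_system_def
proof (intro conjI allI impI ballI)
  fix xs assume "xs \<in> distinct_tuples (equation_solutions G rs)"
  then show "length xs = k" "distinct xs" "set xs \<subseteq> carrier G"
    using k by (auto simp: distinct_tuples_def equation_solutions_def tuples_def)
next
  fix j assume "j < k"
  then show "inj_on (coords ({..<k} - {j})) (distinct_tuples (equation_solutions G rs))"
    by (intro inj_on_subset[OF equation_solutions_inj[OF fin k cop]]) (auto simp: distinct_tuples_def)
qed

text \<open>A walk records only its vertices. By coprimality each step determines the element
  \<open>a\<close> that produced it, so walks and lists of elements of \<open>A\<close> correspond
  bijectively.\<close>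

lemma (in group) walks_eq_card:
  assumes fin: "finite (carrier G)" and A: "A \<subseteq> carrier G"
    and "\<And>i. i < length rs \<Longrightarrow> coprime (rs ! i) (card (carrier G))"
    and "y \<in> carrier G"
  shows "walks (carrier G) (map (\<lambda>r x y. \<exists>a\<in>A. y = x \<otimes> a [^] r) rs) y z =
    card {as. length as = length rs \<and> set as \<subseteq> A \<and> y \<otimes> power_product G rs as = z}"
  using assms(3-)
proof (induction rs arbitrary: y)
  case Nil
  have "{as. length as = 0 \<and> set as \<subseteq> A \<and> y \<otimes> power_product G [] as = z} = (if y = z then {[]} else {})"
    using Nil by (auto simp: power_product_Nil)
  then show ?case by simp
next
  case (Cons r rs)
  let ?R = "\<lambda>r x y. \<exists>a\<in>A. y = x \<otimes> a [^] r"
  let ?S = "\<lambda>x. {as. length as = length rs \<and> set as \<subseteq> A \<and> x \<otimes> power_product G rs as = z}"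
  have finA: "finite A" using A fin by (rule finite_subset)
  have finS: "finite (?S x)" for x
    by (rule finite_subset[OF _ finite_lists_length_eq[OF finA, of "length rs"]]) auto
  have cop: "coprime (rs ! i) (card (carrier G))" if "i < length rs" for i
    using Cons.prems(1)[of "Suc i"] that by simp
  have Ac: "a \<in> carrier G" if "a \<in> A" for a using that A by blast
  have inj: "inj_on (\<lambda>a. y \<otimes> a [^] r) A"
  proof (rule inj_onI)
    fix a b assume ab: "a \<in> A" "b \<in> A" "y \<otimes> a [^] r = y \<otimes> b [^] r"
    then have "a [^] r = b [^] r" using Cons.prems(2) Ac by simp
    then show "a = b" using pow_coprime_inj[OF fin _ Ac Ac, of r a b] ab Cons.prems(1)[of 0] by simp
  qed
  have "{x \<in> carrier G. ?R r y x} = (\<lambda>a. y \<otimes> a [^] r) ` A"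
    using Cons.prems(2) Ac by auto
  then have "walks (carrier G) (map ?R (r # rs)) y z =
      (\<Sum>a\<in>A. walks (carrier G) (map ?R rs) (y \<otimes> a [^] r) z)"
    by (simp add: sum.reindex[OF inj])
  also have "\<dots> = (\<Sum>a\<in>A. card (?S (y \<otimes> a [^] r)))"
    by (rule sum.cong[OF refl], rule Cons.IH) (use cop Cons.prems(2) Ac in auto)
  also have "\<dots> = card (SIGMA a:A. ?S (y \<otimes> a [^] r))"
    using finA finS by simp
  also have "\<dots> = card {as. length as = length (r # rs) \<and> set as \<subseteq> A \<and> y \<otimes> power_product G (r # rs) as = z}"
  proof (rule bij_betw_same_card[of "\<lambda>(a, as). a # as"], rule bij_betw_imageI)
    show "inj_on (\<lambda>(a, as). a # as) (SIGMA a:A. ?S (y \<otimes> a [^] r))" by (auto simp: inj_on_def)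
    have assoc: "y \<otimes> a [^] r \<otimes> power_product G rs as = y \<otimes> (a [^] r \<otimes> power_product G rs as)"
      if "a \<in> A" "length as = length rs" "set as \<subseteq> A" for a as
      using that Cons.prems(2) Ac A by (intro m_assoc power_product_closed) auto
    show "(\<lambda>(a, as). a # as) ` (SIGMA a:A. ?S (y \<otimes> a [^] r)) =
      {as. length as = length (r # rs) \<and> set as \<subseteq> A \<and> y \<otimes> power_product G (r # rs) as = z}" (is "?L = ?P")
    proof (intro equalityI subsetI)
      fix bs assume "bs \<in> ?L"
      then show "bs \<in> ?P" using assoc by (auto simp: power_product_Cons)
    next
      fix bs assume bs: "bs \<in> ?P"
      then obtain a as where "bs = a # as" by (cases bs) auto
      then show "bs \<in> ?L" using bs assoc[of a as] by (auto simp: power_product_Cons image_iff)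
    qed
  qed
  finally show ?case .
qed

section \<open>Supersaturation of the solutions\<close>

definition admissible_equation :: "nat \<Rightarrow> ('a, 'b) monoid_scheme \<Rightarrow> nat list \<Rightarrow> bool" where
  "admissible_equation k G rs \<longleftrightarrow> group G \<and> finite (carrier G) \<and> length rs = k \<and>
     (\<forall>j<k. coprime (rs ! j) (card (carrier G))) \<and>
     (\<forall>x\<in>carrier G. x [^]\<^bsub>G\<^esub> sum_list rs = \<one>\<^bsub>G\<^esub>)"

text \<open>Whatever the base point, the closed walks with steps from \<open>A\<close> at it
  correspond to the solutions in \<open>A\<close>. Dividing the bound \<eta> n^k of
  \<open>cycle_removal\<close> by the n base points gives the claim, with \<eta> chosen before the
  group.\<close>

lemma many_solutions:
  fixes \<beta> :: real
  assumes k: "3 \<le> k" and beta: "0 < \<beta>"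
  shows "\<exists>\<eta>>0. \<forall>(G :: ('a, 'b) monoid_scheme) rs. admissible_equation k G rs \<longrightarrow>
    supersaturated k \<beta> \<eta> (carrier G) (equation_solutions G rs)"
proof -
  obtain \<eta> where eta: "0 < \<eta>" and removal: "\<And>(V :: 'a set) E (I :: ('a \<times> 'a) set) w.
    finite V \<Longrightarrow> finite I \<Longrightarrow> \<beta> * (real (card V))\<^sup>2 \<le> card I \<Longrightarrow>
    disjoint_closed_walks k V E I w \<Longrightarrow>
    \<eta> * real (card V) ^ k \<le> (\<Sum>z\<in>V. walks V (map E [0..<k]) z z)"
    using cycle_removal[OF k beta, where 'a = 'a and 'i = "'a \<times> 'a"] by (elim exE conjE) blast
  have main: "supersaturated k \<beta> \<eta> (carrier G) (equation_solutions G rs)"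
    if adm: "admissible_equation k G rs" for G :: "('a, 'b) monoid_scheme" and rs
    unfolding supersaturated_def
  proof (intro allI impI)
    fix A assume A: "A \<subseteq> carrier G" and cA: "\<beta> * card (carrier G) \<le> card A"
    have G: "group G" and fin: "finite (carrier G)" and len: "length rs = k"
      and cop: "\<forall>j<k. coprime (rs ! j) (card (carrier G))"
      and expo: "\<forall>x\<in>carrier G. x [^]\<^bsub>G\<^esub> sum_list rs = \<one>\<^bsub>G\<^esub>"
      using adm unfolding admissible_equation_def by blast+
    interpret group G by (rule G)
    let ?SA = "{xs \<in> equation_solutions G rs. set xs \<subseteq> A}"
    let ?V = "carrier G"
    (* Every a in A gives the diagonal solution (a, ..., a), because the exponent divides the sum
       of the coefficients. So (g, a) indexes a closed walk, and these walks are edge-disjoint. *)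
    define E where "E j x y \<longleftrightarrow> (\<exists>a\<in>A. y = x \<otimes>\<^bsub>G\<^esub> a [^]\<^bsub>G\<^esub> (rs ! j))" for j x y
    define w where "w p j = (case p of (g, a) \<Rightarrow> g \<otimes>\<^bsub>G\<^esub> a [^]\<^bsub>G\<^esub> sum_list (take j rs))" for p j
    have Ac: "a \<in> ?V" if "a \<in> A" for a using that A by blast
    have finA: "finite A" using A fin by (rule finite_subset)
    have w_Suc: "w (g, a) (Suc j) = w (g, a) j \<otimes>\<^bsub>G\<^esub> a [^]\<^bsub>G\<^esub> (rs ! j)" if "g \<in> ?V" "a \<in> A" "j < k" for g a j
      using that len Ac[of a] by (simp add: w_def take_Suc_conv_app_nth nat_pow_mult[symmetric] m_assoc)
    have w_closed: "w (g, a) j \<in> ?V" if "g \<in> ?V" "a \<in> A" for g a j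
      using that Ac[of a] by (simp add: w_def)
    have "\<eta> * real (card ?V) ^ k \<le> (\<Sum>z\<in>?V. walks ?V (map E [0..<k]) z z)"
    proof (rule removal[where w = w and I = "?V \<times> A"])
      show "\<beta> * (real (card ?V))\<^sup>2 \<le> card (?V \<times> A)"
        using mult_left_mono[OF cA, of "real (card ?V)"]
        by (simp add: card_cartesian_product power2_eq_square mult_ac)
      show "disjoint_closed_walks k ?V E (?V \<times> A) w"
        unfolding disjoint_closed_walks_def
      proof (intro conjI)
        show "\<forall>i\<in>?V \<times> A. \<forall>j. w i j \<in> ?V" using w_closed by auto
        show "\<forall>i\<in>?V \<times> A. w i k = w i 0"
          using len expo Ac by (auto simp: w_def)
        show "\<forall>i\<in>?V \<times> A. \<forall>j<k. E j (w i j) (w i (Suc j))"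
          using w_Suc by (auto simp: E_def)
        show "\<forall>j<k. inj_on (\<lambda>i. (w i j, w i (Suc j))) (?V \<times> A)"
        proof (intro allI impI inj_onI)
          fix j p q assume j: "j < k" and p: "p \<in> ?V \<times> A" and q: "q \<in> ?V \<times> A"
            and eq: "(w p j, w p (Suc j)) = (w q j, w q (Suc j))"
          obtain g a h b where [simp]: "p = (g, a)" "q = (h, b)" by (cases p; cases q)
          have mem: "g \<in> ?V" "a \<in> A" "h \<in> ?V" "b \<in> A" using p q by auto
          have e1: "w (g, a) j = w (h, b) j" and e2: "w (g, a) (Suc j) = w (h, b) (Suc j)"
            using eq by simp_all
          have "w (h, b) j \<otimes>\<^bsub>G\<^esub> a [^]\<^bsub>G\<^esub> (rs ! j) = w (h, b) j \<otimes>\<^bsub>G\<^esub> b [^]\<^bsub>G\<^esub> (rs ! j)"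
            using e2 unfolding w_Suc[OF mem(1,2) j] w_Suc[OF mem(3,4) j] e1 .
          then have "a [^]\<^bsub>G\<^esub> (rs ! j) = b [^]\<^bsub>G\<^esub> (rs ! j)"
            using w_closed mem Ac by simp
          then have ab: "a = b" using pow_coprime_inj[OF fin _ Ac Ac, of "rs ! j" a b] mem cop j by simp
          have "g \<otimes>\<^bsub>G\<^esub> a [^]\<^bsub>G\<^esub> sum_list (take j rs) = h \<otimes>\<^bsub>G\<^esub> a [^]\<^bsub>G\<^esub> sum_list (take j rs)"
            using eq ab by (simp add: w_def)
          then have "g = h" using mem Ac by simp
          then show "p = q" using ab by simp
        qed
      qed
    qed (use fin finA in auto)
    also have "map E [0..<k] = map (\<lambda>r x y. \<exists>a\<in>A. y = x \<otimes>\<^bsub>G\<^esub> a [^]\<^bsub>G\<^esub> r) rs"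
      unfolding E_def by (rule nth_equalityI) (use len in \<open>auto simp: fun_eq_iff\<close>)
    also have "(\<Sum>z\<in>?V. walks ?V \<dots> z z) = (\<Sum>z\<in>?V. card ?SA)"
    proof (rule sum.cong[OF refl])
      fix z assume z: "z \<in> ?V"
      have "{as. length as = length rs \<and> set as \<subseteq> A \<and> z \<otimes>\<^bsub>G\<^esub> power_product G rs as = z} =
          ?SA"
      proof -
        have "z \<otimes>\<^bsub>G\<^esub> power_product G rs as = z \<longleftrightarrow> power_product G rs as = \<one>\<^bsub>G\<^esub>"
          if "length as = length rs" "set as \<subseteq> A" for as
        proof -
          have "power_product G rs as \<in> ?V" using that A by (intro power_product_closed) auto
          then show ?thesis using z by simp
        qed
        then show ?thesis using A by (auto simp: equation_solutions_def tuples_def)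
      qed
      then show "walks ?V (map (\<lambda>r x y. \<exists>a\<in>A. y = x \<otimes>\<^bsub>G\<^esub> a [^]\<^bsub>G\<^esub> r) rs) z z =
          card ?SA"
        using walks_eq_card[OF fin A, of rs z z] cop len z by simp
    qed
    also have "\<dots> = card ?V * card ?SA" by simp
    finally have "\<eta> * real (card ?V) ^ k \<le> card ?V * real (card ?SA)"
      by (simp only: of_nat_mult)
    moreover have "real (card ?V) ^ k = card ?V * real (card ?V) ^ (k - 1)"
      using k by (simp flip: power_Suc)
    ultimately have "card ?V * (\<eta> * real (card ?V) ^ (k - 1)) \<le> card ?V * real (card ?SA)"
      by (simp only: mult_ac)
    moreover have "0 < real (card ?V)" using fin one_closed by (auto simp: card_gt_0_iff)
    ultimately show "\<eta> * real (card ?V) ^ (k - 1) \<le> card ?SA"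
      by (simp only: mult_le_cancel_left_pos)
  qed
  show ?thesis
    by (rule exI[of _ \<eta>], intro conjI allI impI, rule eta, rule main) assumption+
qed

text \<open>Prescribing an equality between two coordinates removes one degree of freedom. The at
  most k^2 n^(k-2) degenerate solutions are outweighed by half of the bound \<eta> n^(k-1) as soon
  as n \<ge> 2 k^2/\<eta>.\<close>

lemma many_distinct_solutions:
  fixes \<beta> :: real
  assumes k: "3 \<le> k" and beta: "0 < \<beta>"
  shows "\<exists>\<eta>>0. \<eta> \<le> 1 \<and> (\<exists>n0 :: nat. \<forall>(G :: ('a, 'b) monoid_scheme) rs. admissible_equation k G rs \<longrightarrow>
    n0 \<le> card (carrier G) \<longrightarrow> supersaturated k \<beta> \<eta> (carrier G) (distinct_tuples (equation_solutions G rs)))"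
proof -
  obtain \<eta> where eta: "0 < \<eta>" and many: "\<And>(G :: ('a, 'b) monoid_scheme) rs. admissible_equation k G rs \<Longrightarrow>
    supersaturated k \<beta> \<eta> (carrier G) (equation_solutions G rs)"
    using many_solutions[OF k beta, where 'a = 'a and 'b = 'b] by (elim exE conjE) blast
  define \<eta>' where "\<eta>' = min 1 (\<eta> / 2)"
  obtain n0 :: nat where n0: "2 * real k ^ 2 / \<eta> < real n0" using reals_Archimedean2 by blast
  have main: "supersaturated k \<beta> \<eta>' (carrier G) (distinct_tuples (equation_solutions G rs))"
    if adm: "admissible_equation k G rs" and n: "n0 \<le> card (carrier G)"
    for G :: "('a, 'b) monoid_scheme" and rs
    unfolding supersaturated_def
  proof (intro allI impI)
    fix A assume A: "A \<subseteq> carrier G" and cA: "\<beta> * card (carrier G) \<le> card A"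
    have G: "group G" and fin: "finite (carrier G)" and len: "length rs = k"
      and cop: "\<forall>j<k. coprime (rs ! j) (card (carrier G))"
      using adm unfolding admissible_equation_def by blast+
    define n where "n = real (card (carrier G))"
    define S where "S = equation_solutions G rs"
    define N where "N p = {xs \<in> S. xs ! fst p = xs ! snd p}" for p :: "nat \<times> nat"
    define P where "P = {p \<in> {..<k} \<times> {..<k}. fst p \<noteq> snd p}"
    have finS: "finite S"
      by (rule finite_subset[OF _ finite_lists_length_eq[OF fin, of k]])
        (use len in \<open>auto simp: S_def equation_solutions_def tuples_def\<close>)
    have Sp: "length xs = k" "\<And>i. i < k \<Longrightarrow> xs ! i \<in> carrier G" if "xs \<in> S" for xs
      using that len by (auto simp: S_def equation_solutions_def tuples_def subset_iff)
    have cN: "card (N p) \<le> n ^ (k - 2)" if p: "p \<in> P" for p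
    proof -
      obtain a b where ab: "p = (a, b)" "a < k" "b < k" "a \<noteq> b" using p by (auto simp: P_def)
      \<comment> \<open>As k \<ge> 3 there is a third position \<open>c\<close>. Coordinate
        \<open>b\<close> is copied from \<open>a\<close> and coordinate \<open>c\<close> follows
        from the equation, so k - 2 coordinates remain free.\<close>
      have "card {a, b} < card {..<k}" using k ab by simp
      then obtain c where c: "c < k" "c \<noteq> a" "c \<noteq> b"
        using card_mono[of "{a, b}" "{..<k}"] by force
      have "inj_on (coords ({..<k} - {c, b})) (N p)"
      proof (rule inj_onI)
        fix xs ys assume xs: "xs \<in> N p" and ys: "ys \<in> N p"
          and eq: "coords ({..<k} - {c, b}) xs = coords ({..<k} - {c, b}) ys"
        have eqa: "xs ! a = ys ! a" using fun_cong[OF eq, of a] ab c by simp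
        have "coords ({..<k} - {c}) xs = coords ({..<k} - {c}) ys"
        proof
          fix j
          show "coords ({..<k} - {c}) xs j = coords ({..<k} - {c}) ys j"
            using fun_cong[OF eq, of j] xs ys eqa ab by (cases "j = b") (auto simp: N_def)
        qed
        then show "xs = ys"
          using group.equation_solutions_inj[OF G fin len, of c] cop c xs ys
          by (auto simp: N_def S_def inj_on_def)
      qed
      then have "real (card (N p)) \<le> (\<Prod>j\<in>{..<k} - {c, b}. real (card (carrier G \<inter> carrier G)))"
        by (intro card_coords_le[OF fin]) (use Sp in \<open>auto simp: N_def\<close>)
      also have "\<dots> = n ^ (k - 2)"
      proof -
        have "card ({..<k} - {c, b}) = k - 2" using c ab by (subst card_Diff_subset) auto
        then show ?thesis by (simp add: n_def)
      qed
      finally show ?thesis .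
    qed
    have finP: "finite P" and cP: "card P \<le> k ^ 2"
    proof -
      show "finite P" by (simp add: P_def)
      have "card P \<le> card ({..<k} \<times> {..<k})" by (rule card_mono) (auto simp: P_def)
      then show "card P \<le> k ^ 2" by (simp add: card_cartesian_product power2_eq_square)
    qed
    have "card (\<Union>p\<in>P. N p) \<le> (\<Sum>p\<in>P. card (N p))" by (rule card_UN_le[OF finP])
    then have "real (card (\<Union>p\<in>P. N p)) \<le> (\<Sum>p\<in>P. real (card (N p)))" by (metis of_nat_le_iff of_nat_sum)
    also have "\<dots> \<le> (\<Sum>p\<in>P. n ^ (k - 2))" by (rule sum_mono) (rule cN)
    also have "\<dots> = card P * n ^ (k - 2)" by simp
    also have "\<dots> \<le> real k ^ 2 * n ^ (k - 2)"
      using of_nat_mono[OF cP, where 'a = real] by (intro mult_right_mono) (auto simp: n_def)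
    also have "\<dots> \<le> \<eta> / 2 * n * n ^ (k - 2)"
    proof (rule mult_right_mono)
      have "2 * real k ^ 2 / \<eta> \<le> n" using n0 n unfolding n_def by linarith
      then show "real k ^ 2 \<le> \<eta> / 2 * n" using eta by (simp add: field_simps)
    qed (simp add: n_def)
    also have "\<dots> = \<eta> / 2 * n ^ (k - 1)"
    proof -
      have "k - 1 = Suc (k - 2)" using k by simp
      then show ?thesis by simp
    qed
    finally have bad: "real (card (\<Union>p\<in>P. N p)) \<le> \<eta> / 2 * n ^ (k - 1)" .
    define D where "D = {xs \<in> distinct_tuples S. set xs \<subseteq> A}"
    have "{xs \<in> S. set xs \<subseteq> A} \<subseteq> D \<union> (\<Union>p\<in>P. N p)"
    proof
      fix xs assume xs: "xs \<in> {xs \<in> S. set xs \<subseteq> A}"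
      show "xs \<in> D \<union> (\<Union>p\<in>P. N p)"
      proof (cases "distinct xs")
        case True
        then show ?thesis using xs by (simp add: D_def distinct_tuples_def)
      next
        case False
        then obtain i j where "i < k" "j < k" "i \<noteq> j" "xs ! i = xs ! j"
          using Sp(1)[of xs] xs by (auto simp: distinct_conv_nth)
        then have "(i, j) \<in> P" "xs \<in> N (i, j)" using xs by (auto simp: P_def N_def)
        then show ?thesis by blast
      qed
    qed
    then have "card {xs \<in> S. set xs \<subseteq> A} \<le> card (D \<union> (\<Union>p\<in>P. N p))"
      by (rule card_mono[rotated]) (use finS finP in \<open>auto simp: D_def N_def distinct_tuples_def\<close>)
    also have "\<dots> \<le> card D + card (\<Union>p\<in>P. N p)" by (rule card_Un_le)
    finally have "real (card {xs \<in> S. set xs \<subseteq> A}) \<le> real (card D) + real (card (\<Union>p\<in>P. N p))" by linarith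
    moreover have "\<eta> * n ^ (k - 1) \<le> card {xs \<in> S. set xs \<subseteq> A}"
      using many[OF adm] A cA by (simp add: supersaturated_def n_def S_def)
    ultimately have "\<eta> / 2 * n ^ (k - 1) \<le> card D" using bad by linarith
    moreover have "\<eta>' * n ^ (k - 1) \<le> \<eta> / 2 * n ^ (k - 1)"
      by (intro mult_right_mono) (auto simp: \<eta>'_def n_def)
    ultimately show "\<eta>' * real (card (carrier G)) ^ (k - 1)
        \<le> card {xs \<in> distinct_tuples (equation_solutions G rs). set xs \<subseteq> A}"
      by (simp add: D_def S_def n_def)
  qed
  have eta': "0 < \<eta>'" "\<eta>' \<le> 1" using eta by (auto simp: \<eta>'_def)
  show ?thesis
    by (rule exI[of _ \<eta>'], intro conjI, rule eta'(1), rule eta'(2), rule exI[of _ n0],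
        intro allI impI, rule main) assumption+
qed

section \<open>Choice of constants and passage to the limit\<close>

lemma threshold_eq:
  assumes "2 \<le> k" "0 < n"
  shows "threshold k n = real n powr (1 / (real k - 1)) / real n"
proof -
  have "- ((real k - 2) / (real k - 1)) = 1 / (real k - 1) - 1"
    using assms by (simp add: field_simps)
  then show ?thesis using assms by (simp add: threshold_def powr_diff)
qed

lemma (in group) pow_group_exponent_dvd:
  assumes fin: "finite (carrier G)" and x: "x \<in> carrier G" and d: "group_exponent G dvd r"
  shows "x [^] r = \<one>"
proof -
  let ?P = "\<lambda>n. 0 < n \<and> (\<forall>x\<in>carrier G. x [^] n = \<one>)"
  have "?P (Coset.order G)"
    using fin pow_order_eq_1 order_gt_0_iff_finite by auto
  then have "?P (group_exponent G)" unfolding group_exponent_def by (rule LeastI)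
  moreover obtain q where "r = group_exponent G * q" using d by blast
  ultimately show ?thesis using x by (simp flip: nat_pow_pow)
qed

text \<open>For i < t each factor \<beta> n - i of the falling product is at least \<beta>
  n/2.\<close>

lemma power_fact_le_gbinomial:
  fixes \<beta> n :: real
  assumes "0 < \<beta>" "0 < n" "real t \<le> \<beta> * n / 2"
  shows "(\<beta> / 2 * n) ^ t / fact t \<le> (\<beta> * n) gchoose t"
proof -
  have "(\<beta> / 2 * n) ^ t = (\<Prod>i = 0..<t. \<beta> / 2 * n)" by simp
  also have "\<dots> \<le> (\<Prod>i = 0..<t. \<beta> * n - real i)"
    using assms by (intro prod_mono) auto
  finally show ?thesis
    by (simp add: gbinomial_prod_rev divide_right_mono)
qed

lemma stable_iff_tuple_stable:
  assumes "\<And>xs. xs \<in> S \<Longrightarrow> length xs = k"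
  shows "stable \<delta> S k X \<longleftrightarrow> tuple_stable \<delta> (distinct_tuples S) X"
proof -
  have "(\<exists>xs\<in>tuples k X' \<inter> S. distinct xs) \<longleftrightarrow> (\<exists>xs\<in>distinct_tuples S. set xs \<subseteq> X')" for X'
    using assms unfolding tuples_def distinct_tuples_def by blast
  then show ?thesis by (simp only: stable_def tuple_stable_def)
qed

theorem theorem6p16:
  fixes k r :: nat and rs :: "nat list"
    and G :: "nat \<Rightarrow> ('a, 'b) monoid_scheme"
    and \<beta> \<delta> :: real
  assumes k: "k \<ge> 3" and len: "length rs = k"
    and rs_pos: "\<forall>j < k. rs ! j > 0"
    and r: "r = sum_list rs"
    and grp: "\<And>i. i \<ge> 1 \<Longrightarrow> group (G i)"
    and fin: "\<And>i. i \<ge> 1 \<Longrightarrow> finite (carrier (G i))"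
    and size: "filterlim (\<lambda>i. card (carrier (G i))) at_top sequentially"
    and expo: "\<And>i. i \<ge> 1 \<Longrightarrow> group_exponent (G i) dvd r"
    and cop: "\<And>i j. i \<ge> 1 \<Longrightarrow> j < k \<Longrightarrow> gcd (rs ! j) (card (carrier (G i))) = 1"
    and beta: "\<beta> > 0"
    and delta: "0 < \<delta>" "\<delta> \<le> min (\<beta> / 2) (1 / 40)"
  shows "\<exists>(i0::nat) (c1::real) (c2::real) (C::real). i0 > 0 \<and> c1 > 0 \<and> c2 > 0 \<and> C > 0 \<and>
    (\<forall>i \<ge> i0. \<forall>t::nat.
        C / \<delta> * real k powr (- (1 / (real k - 1)))
            * real (card (carrier (G i))) powr (1 / (real k - 1)) \<le> real t \<and>
        real t \<le> \<delta> / 2 * real (card (carrier (G i))) \<longrightarrow>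
        real (card {X. X \<subseteq> carrier (G i) \<and> card X = t \<and>
                       tuples k X \<inter> distinct_tuples (equation_solutions (G i) rs) = {}})
          \<le> (\<beta> * real (card (carrier (G i)))) gchoose t) \<and>
    (\<forall>p :: nat \<Rightarrow> real. (\<forall>i. 0 \<le> p i \<and> p i \<le> 1) \<longrightarrow>
        ((\<forall>\<^sub>F i in sequentially. p i \<ge> c1 * threshold k (card (carrier (G i)))) \<longrightarrow>
          (\<lambda>i. measure_pmf.prob (binomial_random_subset (carrier (G i)) (p i))
                 {X. stable \<delta> (equation_solutions (G i) rs) k X}) \<longlonglongrightarrow> 1) \<and>
        ((\<forall>\<^sub>F i in sequentially. p i < c2 * threshold k (card (carrier (G i)))) \<longrightarrow>
          (\<lambda>i. measure_pmf.prob (binomial_random_subset (carrier (G i)) (p i))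
                 {X. stable \<delta> (equation_solutions (G i) rs) k X}) \<longlonglongrightarrow> 0))"
proof -
  let ?V = "\<lambda>i. carrier (G i)"
  define n where "n i = card (?V i)" for i
  define S where "S i = equation_solutions (G i) rs" for i
  define T where "T i = distinct_tuples (S i)" for i
  define N where "N i = real (n i) powr (1 / (real k - 1))" for i
  have n1: "1 \<le> n i" if "1 \<le> i" for i
  proof -
    have "?V i \<noteq> {}" using group.is_monoid[OF grp[OF that]] monoid.one_closed by blast
    then show ?thesis using fin[OF that] by (simp add: n_def Suc_le_eq card_gt_0_iff)
  qed
  have cop': "coprime (rs ! j) (card (?V i))" if "1 \<le> i" "j < k" for i j
    using cop[OF that] by (simp add: coprime_iff_gcd_eq_1)
  have tsys: "tuple_system k (?V i) (T i)" if "1 \<le> i" for i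
    unfolding T_def S_def by (rule group.tuple_system_solutions[OF grp fin len cop']) (use that in auto)
  have pow1: "x [^]\<^bsub>G i\<^esub> sum_list rs = \<one>\<^bsub>G i\<^esub>" if "1 \<le> i" "x \<in> ?V i" for i x
    using group.pow_group_exponent_dvd[OF grp fin that(2)] expo that(1) r by simp
  have stable_eq: "stable \<delta> (S i) k X \<longleftrightarrow> tuple_stable \<delta> (T i) X" for i X
    unfolding T_def
    by (rule stable_iff_tuple_stable) (use len in \<open>auto simp: S_def equation_solutions_def tuples_def\<close>)
  \<comment> \<open>The supersaturation and counting constants depend on \<gamma> and
    \<open>k\<close> but not on the group; \<open>i0\<close> only waits for the order to exceed
    \<open>n0\<close>.\<close>
  have count: "\<exists>C>0. \<exists>i0\<ge>1. \<forall>i\<ge>i0. \<forall>t. C * N i \<le> real t \<longrightarrow>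
      card (independent_sets (?V i) (T i) t) \<le> (\<gamma> * n i) ^ t / fact t"
    if \<gamma>: "0 < \<gamma>" "\<gamma> \<le> 2" for \<gamma> :: real
  proof -
    have "0 < (\<gamma> / 2)\<^sup>2" using \<gamma> by simp
    from many_distinct_solutions[OF k this, where 'a = 'a and 'b = 'b]
    obtain \<eta> n0 where eta: "0 < \<eta>" "\<eta> \<le> 1"
      and super: "\<And>(H :: ('a, 'b) monoid_scheme) rs. admissible_equation k H rs \<Longrightarrow> n0 \<le> card (carrier H) \<Longrightarrow>
        supersaturated k ((\<gamma> / 2)\<^sup>2) \<eta> (carrier H) (distinct_tuples (equation_solutions H rs))"
      by (elim exE conjE) blast
    from card_independent_sets_le[OF k \<gamma> eta, where 'a = 'a]
    obtain C where C: "0 < C" and indep: "\<And>(V :: 'a set) T t. finite V \<Longrightarrow> V \<noteq> {} \<Longrightarrow> tuple_system k V T \<Longrightarrow>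
      supersaturated k ((\<gamma> / 2)\<^sup>2) \<eta> V T \<Longrightarrow>
      C * card V powr (1 / (real k - 1)) \<le> real t \<Longrightarrow>
      card (independent_sets V T t) \<le> (\<gamma> * card V) ^ t / fact t"
      by (elim exE conjE) blast
    have "\<forall>\<^sub>F i in sequentially. n0 \<le> n i"
      using size unfolding filterlim_at_top n_def by blast
    then obtain i1 where i1: "\<And>i. i1 \<le> i \<Longrightarrow> n0 \<le> n i" unfolding eventually_sequentially by blast
    have "card (independent_sets (?V i) (T i) t) \<le> (\<gamma> * n i) ^ t / fact t"
      if i: "max 1 i1 \<le> i" and t: "C * N i \<le> real t" for i t
      unfolding n_def
    proof (rule indep)
      have i1': "1 \<le> i" using i by simp
      show "finite (?V i)" by (rule fin[OF i1'])
      show "?V i \<noteq> {}" using n1[OF i1'] by (auto simp: n_def)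
      show "tuple_system k (?V i) (T i)" by (rule tsys[OF i1'])
      show "C * real (card (?V i)) powr (1 / (real k - 1)) \<le> real t"
        using t by (simp add: N_def n_def)
      show "supersaturated k ((\<gamma> / 2)\<^sup>2) \<eta> (?V i) (T i)"
        unfolding T_def S_def
      proof (rule super)
        show "admissible_equation k (G i) rs"
          unfolding admissible_equation_def using grp[OF i1'] fin[OF i1'] len cop'[OF i1'] pow1[OF i1'] by blast
        show "n0 \<le> card (?V i)" using i1[of i] i by (simp add: n_def)
      qed
    qed
    then show ?thesis using C by (intro exI[of _ C] conjI exI[of _ "max 1 i1"]) auto
  qed
  \<comment> \<open>The cap brings the density into the range \<gamma> \<le> 2 of
    \<open>count\<close>. The latter is applied to \<beta>'/2, as the other half is spent on passing
    to the binomial coefficient.\<close>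
  define \<beta>' where "\<beta>' = min \<beta> 1"
  have b': "0 < \<beta>'" "\<beta>' \<le> 2" "\<beta>' / 2 \<le> \<beta> / 2" using beta by (auto simp: \<beta>'_def)
  have "0 < \<beta>' / 2" "\<beta>' / 2 \<le> 2" using b' by auto
  from count[OF this] obtain C1 i1 where C1: "0 < C1" "1 \<le> i1"
    and count1: "\<And>i t. i1 \<le> i \<Longrightarrow> C1 * N i \<le> real t \<Longrightarrow>
      card (independent_sets (?V i) (T i) t) \<le> (\<beta>' / 2 * n i) ^ t / fact t"
    by blast
  have d12: "0 < \<delta> / 12" "\<delta> / 12 \<le> 2" using delta by auto
  from count[OF d12] obtain C2 i2 where C2: "0 < C2" "1 \<le> i2"
    and count2: "\<And>i t. i2 \<le> i \<Longrightarrow> C2 * N i \<le> real t \<Longrightarrow>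
      card (independent_sets (?V i) (T i) t) \<le> (\<delta> / 12 * n i) ^ t / fact t"
    by blast
  \<comment> \<open>\<open>C\<close> cancels the prefactors in the lower bound on t down to
    \<open>C1\<close>. The constant \<open>c1\<close> is such that p n \<ge> c1 N gives \<delta> p
    n/2 \<ge> C2 N, the size from which \<open>count2\<close> holds.\<close>
  define C where "C = C1 * \<delta> * real k powr (1 / (real k - 1))"
  define c1 where "c1 = 2 * C2 / \<delta>"
  have Cpos: "0 < C" using C1 delta k by (simp add: C_def)
  have c1: "0 < c1" using C2 delta by (simp add: c1_def)
  have ev1: "\<forall>\<^sub>F i in sequentially. 1 \<le> i" by (rule eventually_ge_at_top)
  have n_top: "filterlim (\<lambda>i. real (n i)) at_top sequentially"
    unfolding n_def by (rule filterlim_compose[OF filterlim_real_sequentially size])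
  have N_top: "filterlim N at_top sequentially"
    unfolding N_def using k by (intro filterlim_compose[OF _ n_top] real_powr_at_top) auto
  have thr: "threshold k (n i) = N i / real (n i)" if "1 \<le> i" for i
    unfolding N_def by (rule threshold_eq) (use k n1[OF that] in auto)
  have part1: "real (card {X. X \<subseteq> ?V i \<and> card X = t \<and>
                       tuples k X \<inter> distinct_tuples (equation_solutions (G i) rs) = {}})
          \<le> (\<beta> * real (card (?V i))) gchoose t"
    if i: "i1 \<le> i" and lo: "C / \<delta> * real k powr (- (1 / (real k - 1)))
            * real (card (?V i)) powr (1 / (real k - 1)) \<le> real t"
      and hi: "real t \<le> \<delta> / 2 * real (card (?V i))" for i t
  proof -
    have i1: "1 \<le> i" using i C1 by simp
    have "C / \<delta> * real k powr (- (1 / (real k - 1))) = C1"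
      using delta k by (simp add: C_def powr_minus)
    then have t: "C1 * N i \<le> real t" using lo by (simp add: N_def n_def)
    have "{X. X \<subseteq> ?V i \<and> card X = t \<and> tuples k X \<inter> distinct_tuples (equation_solutions (G i) rs) = {}}
        = independent_sets (?V i) (T i) t"
      using tsys[OF i1] by (auto simp: independent_sets_def T_def S_def tuple_system_def tuples_def)
    then have "real (card {X. X \<subseteq> ?V i \<and> card X = t \<and> tuples k X \<inter> distinct_tuples (equation_solutions (G i) rs) = {}})
        \<le> (\<beta>' / 2 * n i) ^ t / fact t"
      using count1[OF i t] by simp
    also have "\<dots> \<le> (\<beta> / 2 * n i) ^ t / fact t"
      using b' by (intro divide_right_mono power_mono mult_right_mono) auto
    also have "\<dots> \<le> (\<beta> * n i) gchoose t"
    proof (rule power_fact_le_gbinomial[OF beta])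
      show "0 < real (n i)" using n1[OF i1] by simp
      have "\<delta> / 2 * n i \<le> \<beta> / 2 * n i" using delta beta by (intro mult_right_mono) auto
      then show "real t \<le> \<beta> * n i / 2" using hi by (simp add: n_def)
    qed
    finally show ?thesis by (simp add: n_def)
  qed
  let ?Pr = "\<lambda>p i. measure_pmf.prob (binomial_random_subset (?V i) (p i))"
  have part2: "(\<lambda>i. ?Pr p i {X. stable \<delta> (S i) k X}) \<longlonglongrightarrow> 1"
    if p: "\<forall>i. 0 \<le> p i \<and> p i \<le> 1" and large: "\<forall>\<^sub>F i in sequentially. c1 * threshold k (n i) \<le> p i" for p
  proof -
    let ?P = "\<lambda>i. ?Pr p i {X. stable \<delta> (S i) k X}"
    have lower: "1 - (4 + 2 / \<delta>) / (c1 * N i) \<le> ?P i" if i: "i2 \<le> i" and pi: "c1 * threshold k (n i) \<le> p i" for i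
    proof -
      have i1: "1 \<le> i" using i C2 by simp
      have N0: "0 < N i" using n1[OF i1] by (simp add: N_def)
      have n0: "0 < real (n i)" using n1[OF i1] by simp
      have pn: "c1 * N i \<le> p i * n i" using pi n0 by (simp add: thr[OF i1] pos_divide_le_eq)
      have "0 < c1 * N i" using c1 N0 by simp
      then have pn0: "0 < p i * n i" using pn by linarith
      define t where "t = nat \<lceil>\<delta> * (p i * card (?V i)) / 2\<rceil>"
      have "C2 * N i = \<delta> * (c1 * N i) / 2" using delta by (simp add: c1_def)
      also have "\<dots> \<le> \<delta> * (p i * n i) / 2" using pn delta by (intro divide_right_mono mult_left_mono) auto
      also have "\<dots> \<le> t" unfolding t_def n_def by linarith
      finally have t: "C2 * N i \<le> t" .
      have "?Pr p i {X. \<not> tuple_stable \<delta> (T i) X}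
          \<le> (4 + 2 / \<delta>) / (p i * n i)"
        unfolding n_def
        by (rule prob_unstable_le[OF fin[OF i1] _ _ delta(1) _ t_def])
          (use p pn0 count2[OF i t] in \<open>auto simp: n_def\<close>)
      also have "\<dots> \<le> (4 + 2 / \<delta>) / (c1 * N i)"
        using pn pn0 \<open>0 < c1 * N i\<close> delta by (intro divide_left_mono) auto
      also have "{X. \<not> tuple_stable \<delta> (T i) X} = UNIV - {X. stable \<delta> (S i) k X}"
        by (auto simp: stable_eq)
      also have "?Pr p i \<dots> = 1 - ?P i"
        using measure_pmf.prob_compl[of "{X. stable \<delta> (S i) k X}" "binomial_random_subset (?V i) (p i)"] by simp
      finally show ?thesis by simp
    qed
    have ev: "\<forall>\<^sub>F i in sequentially. 1 - (4 + 2 / \<delta>) / (c1 * N i) \<le> ?P i"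
      using large eventually_ge_at_top[of i2] by eventually_elim (rule lower)
    have "(\<lambda>i. (4 + 2 / \<delta>) / (c1 * N i)) \<longlonglongrightarrow> 0"
      by (intro real_tendsto_divide_at_top[OF tendsto_const] filterlim_tendsto_pos_mult_at_top[OF tendsto_const c1 N_top])
    then have "(\<lambda>i. 1 - (4 + 2 / \<delta>) / (c1 * N i)) \<longlonglongrightarrow> 1 - 0"
      by (intro tendsto_diff tendsto_const)
    then have lim: "(\<lambda>i. 1 - (4 + 2 / \<delta>) / (c1 * N i)) \<longlonglongrightarrow> 1" by simp
    show ?thesis
      by (rule tendsto_sandwich[OF ev _ lim tendsto_const]) simp
  qed
  \<comment> \<open>Taking c2 = 1/8 gives (p n)^(k-1) \<le> (1/8)^(k-1) n \<le> n/8, as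
    \<open>prob_stable_le\<close> requires.\<close>
  have part3: "(\<lambda>i. ?Pr p i {X. stable \<delta> (S i) k X}) \<longlonglongrightarrow> 0"
    if p: "\<forall>i. 0 \<le> p i \<and> p i \<le> 1" and small: "\<forall>\<^sub>F i in sequentially. p i < 1 / 8 * threshold k (n i)" for p
  proof -
    let ?P = "\<lambda>i. ?Pr p i {X. stable \<delta> (S i) k X}"
    define K where "K = 64 * (real k ^ 2 * (real k ^ k + real k * real (k + 1) ^ k)) + 4"
    define u where "u i = real (n i) powr (- 1 / 2) + K * real (n i) powr (- 1 / (2 * real k))" for i
    have upper: "?P i \<le> u i" if i1: "1 \<le> i" and pi: "p i < 1 / 8 * threshold k (n i)" for i
      unfolding stable_eq u_def K_def n_def
    proof (rule prob_stable_le[OF tsys[OF i1] fin[OF i1] k])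
      have n0: "0 < real (n i)" using n1[OF i1] by simp
      have "p i * n i \<le> 1 / 8 * N i" using pi n0 by (simp add: thr[OF i1] pos_less_divide_eq mult.commute)
      then have "(p i * n i) ^ (k - 1) \<le> (1 / 8 * N i) ^ (k - 1)" using p by (intro power_mono) auto
      also have "\<dots> = (1 / 8) ^ (k - 1) * n i"
        unfolding power_mult_distrib N_def using k n0 powr_root_power[of k "real (n i)"] by simp
      also have "\<dots> \<le> 1 / 8 * n i"
        using power_decreasing[of 1 "k - 1" "1 / 8 :: real"] k n0 by (intro mult_right_mono) auto
      finally show "(p i * real (card (?V i))) ^ (k - 1) \<le> real (card (?V i)) / 8"
        by (simp add: n_def)
    qed (use p delta n1[OF i1] in \<open>auto simp: n_def\<close>)
    have ev: "\<forall>\<^sub>F i in sequentially. ?P i \<le> u i"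
      using small ev1 by eventually_elim (rule upper)
    have "u \<longlonglongrightarrow> 0 + K * 0"
      unfolding u_def using k
      by (intro tendsto_add tendsto_mult tendsto_const tendsto_neg_powr n_top) auto
    then have lim: "u \<longlonglongrightarrow> 0" by simp
    show ?thesis
      by (rule tendsto_sandwich[OF _ ev tendsto_const lim]) simp
  qed

  show ?thesis
  proof (intro exI conjI allI impI)
    show "0 < i1" using C1 by simp
    show "0 < c1" by (rule c1)
    show "(0::real) < 1 / 8" by simp
    show "0 < C" by (rule Cpos)
  next
    fix i t
    assume "i1 \<le> i" "C / \<delta> * real k powr (- (1 / (real k - 1)))
        * real (card (carrier (G i))) powr (1 / (real k - 1)) \<le> real t \<and>
      real t \<le> \<delta> / 2 * real (card (carrier (G i)))"
    then show "real (card {X. X \<subseteq> carrier (G i) \<and> card X = t \<and>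
        tuples k X \<inter> distinct_tuples (equation_solutions (G i) rs) = {}})
        \<le> (\<beta> * real (card (carrier (G i)))) gchoose t"
      by (intro part1) simp_all
  next
    fix p :: "nat \<Rightarrow> real"
    assume "\<forall>i. 0 \<le> p i \<and> p i \<le> 1"
      and "\<forall>\<^sub>F i in sequentially. c1 * threshold k (card (carrier (G i))) \<le> p i"
    then show "(\<lambda>i. measure_pmf.prob (binomial_random_subset (carrier (G i)) (p i))
        {X. stable \<delta> (equation_solutions (G i) rs) k X}) \<longlonglongrightarrow> 1"
      unfolding S_def[symmetric] n_def[symmetric] by (rule part2)
  next
    fix p :: "nat \<Rightarrow> real"
    assume "\<forall>i. 0 \<le> p i \<and> p i \<le> 1"
      and "\<forall>\<^sub>F i in sequentially. p i < 1 / 8 * threshold k (card (carrier (G i)))"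
    then show "(\<lambda>i. measure_pmf.prob (binomial_random_subset (carrier (G i)) (p i))
        {X. stable \<delta> (equation_solutions (G i) rs) k X}) \<longlonglongrightarrow> 0"
      unfolding S_def[symmetric] n_def[symmetric] by (rule part3)
  qed
qed

end
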